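(* Let $k$ and $r$ be two positive integers, let $F(x) = x^{2^k \cdot 3^r} + ax +b\in\mathbb{Z}[x]$ be irreducible over $\mathbb{Q}$, and let $K=\mathbb{Q}(\theta)$, where $\theta$ is a complex root of $F(x)$. If one of the following conditions holds: (1) $k \ge 1$, $r = 3$, $a \equiv 0 \pmod{243}$ and $b \equiv -1 \pmod{243}$; (2) $k \in \{1,2\}$, $r \ge 4$ and $(\bar{a},\bar{b}) \in \{\overline{81}, \overline{162}\}\times \{ \overline{80}, \overline{161}, \overline{242} \} \cup \{ \overline{0}\}\times \{\overline{80}, \overline{161} \}$ in $(\mathbb{Z}/243\mathbb{Z})^2$; (3) $k \geq 1$, $r=1$, $a \equiv 0 \pmod{27}$ and $b \equiv -1 \pmod{27}$; (4) $k\ge 1$, $r \ge 2$ and $(\bar{a},\bar{b})\in \{\overline{9}, \overline{18}\}\times \{\overline{26} \} \cup \{\overline{0} \} \times \{ \overline{8}, \overline{17} \}$ in $(\mathbb{Z}/27\mathbb{Z})^2$; (5) $k \ge 1$, $r \ge 3$ and $(\bar{a}, \bar{b}) \in \{\overline{0}\}\times \{\overline{26}, \overline{53}\}\cup \{\overline{27}, \overline{54}\}\times \{\overline{26}, \overline{53},\overline{80}\}$ in $(\mathbb{Z}/81\mathbb{Z})^2$; (6) $k \ge 1$, $r=2$, $a\equiv 0 \pmod{81}$ and $b\equiv -1 \pmod{81}$; (7) $k=1$, $r=3$, $a \equiv 0 \pmod{243}$ and $b\equiv 1 \pmod{243}$; (8) $k=1$, $r\ge 4$ and $(\bar{a}, \bar{b})\in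 \{\overline{81}, \overline{162}\}\times \{\overline{1}, \overline{82}, \overline{163}\}\cup \{\overline{0}\}\times \{\overline{82}, \overline{163}\}$ in $(\mathbb{Z}/243\mathbb{Z})^2$; (9) $k=2$, $r=1$, $a\equiv 0 \pmod{27}$ and $b \equiv 1 \pmod{27}$; (10) $k = 2$, $r \ge 2$ and $(\bar{a}, \bar{b}) \in \{\overline{9}, \overline{18}\}\times \{\overline{1}, \overline{10}, \overline{19}\} \cup \{\overline{0}\}\times\{\overline{10}, \overline{19}\}$ in $(\mathbb{Z}/27\mathbb{Z})^2$; (11) $k \ge 3$, $r \ge 2$ and $(\bar{a}, \bar{b})\in \{\overline{9}, \overline{18}\}\times \{ \overline{8}, \overline{17}\}$ in $(\mathbb{Z}/27\mathbb{Z})^2$; then $K$ is not monogenic.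
   Context: $\bar t$ denotes the residue class of the integer $t$ in the indicated ring $\mathbb{Z}/N\mathbb{Z}$. $\mathbb{Z}_K$ denotes the ring of integers of $K$. $K$ is called monogenic if $\mathbb{Z}_K=\mathbb{Z}[\eta]$ for some $\eta\in\mathbb{Z}_K$ with $K=\mathbb{Q}(\eta)$; otherwise $K$ is not monogenic. *)

theory Defs
  imports
    "HOL-Algebra.Algebraic_Closure_Type"
    "HOL-Algebra.Generated_Fields"
    "HOL-Number_Theory.Cong"
begin

text \<open>Number fields are rendered as subfields of the field of complex numbers.\<close>

abbreviation complex_ring :: "complex ring"
  where "complex_ring \<equiv> ring_of_type_algebra"

text \<open>The subfield generated by a single element contains the prime field of rational numbers,
  so this is the field obtained by adjoining \<open>\<theta>\<close> to the rationals.\<close>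

definition rat_adjoin :: "complex \<Rightarrow> complex set"
  where "rat_adjoin \<theta> = generate_field complex_ring {\<theta>}"

text \<open>Likewise, the subring generated by \<open>\<eta>\<close> contains the integers.\<close>

definition int_adjoin :: "complex \<Rightarrow> complex set"
  where "int_adjoin \<eta> = generate_ring complex_ring {\<eta>}"

definition ring_of_integers :: "complex set \<Rightarrow> complex set"
  where "ring_of_integers K = {x \<in> K. algebraic_int x}"

definition monogenic :: "complex set \<Rightarrow> bool"
  where "monogenic K \<longleftrightarrow>
    (\<exists>\<eta> \<in> ring_of_integers K. K = rat_adjoin \<eta> \<and> ring_of_integers K = int_adjoin \<eta>)"

end

(* The contradiction comes from counting primes above 3. Fix a place of the algebraic numbers above 3,
   given by a valuation ring of the complex numbers. The 3-adic Newton polygon of F at a root of unity z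
   with z^(2^k) = -b (mod 3) splits the roots t of F that reduce to z into groups, according to the
   valuation 1/e of t - z; such a group has exactly e members. If the ring of integers is
   Z[eta], the conjugates of eta attached to one group all have the same residue: a residue of that
   group has multiplicity at least e in the minimal polynomial of eta modulo 3, because t - z has valuation 1/e
   there, while only e conjugates are available. Frobenius then fixes this residue
   whenever it fixes that of z. As different groups have different residues, this gives four elements
   of F_3, or eight elements of F_9 outside F_3: more than there are. *)

theory Submission
  imports Defs
begin

section \<open>Valuation rings and algebraic integers\<close>

text \<open>The number z need not lie in K, so \<open>t - z\<close> cannot be compared between
  conjugates. With \<open>N = 2 ^ k\<close> and \<open>z ^ N = \<epsilon>\<close>, the number
  \<open>t ^ N - \<epsilon>\<close> does lie in K, and for t reducing to z it differs from
  \<open>t - z\<close> by a unit, N being prime to 3. A group is thereby determined by a prime of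
  Z[eta] together with the residue of t. This is why Frobenius fixes its residue: the Frobenius
  power is again a root of the minimal polynomial of eta modulo 3, and the conjugate it comes from
  has the same prime and the same residue of t, so it lies in the same group. In the case of F_9 the
  residue is outside F_3 because z modulo 3 is an integer polynomial in it. No value group,
  completion or prime ideal is formed: that \<open>x ^ e / 3\<close> is a unit expresses valuation
  1/e, and a complex e-th root of 3 serves for rescaling. The counts: 1 and -1 with two groups each
  make four; i and -i with four groups each, or the four primitive eighth roots of unity with two
  groups each, make eight, against six elements of F_9 outside F_3.\<close>

definition is_subring :: "'a :: field set \<Rightarrow> bool" where
  "is_subring A \<longleftrightarrow> 1 \<in> A \<and> (\<forall>x\<in>A. \<forall>y\<in>A. x - y \<in> A \<and> x * y \<in> A)"

definition is_valuation_ring :: "'a :: field set \<Rightarrow> bool" where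
  "is_valuation_ring V \<longleftrightarrow> is_subring V \<and> (\<forall>x. x \<in> V \<or> inverse x \<in> V)"

lemma is_subringD:
  assumes "is_subring A"
  shows "0 \<in> A" "1 \<in> A"
    "x \<in> A \<Longrightarrow> y \<in> A \<Longrightarrow> x - y \<in> A" "x \<in> A \<Longrightarrow> y \<in> A \<Longrightarrow> x * y \<in> A"
    "x \<in> A \<Longrightarrow> - x \<in> A" "x \<in> A \<Longrightarrow> y \<in> A \<Longrightarrow> x + y \<in> A"
    "x \<in> A \<Longrightarrow> x ^ n \<in> A" "of_nat n \<in> A" "of_int k \<in> A"
    "(\<And>i. i \<in> I \<Longrightarrow> f i \<in> A) \<Longrightarrow> sum f I \<in> A"
    "(\<And>i. i \<in> I \<Longrightarrow> f i \<in> A) \<Longrightarrow> prod f I \<in> A"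
proof -
  show 1: "1 \<in> A" and diff: "\<And>x y. x \<in> A \<Longrightarrow> y \<in> A \<Longrightarrow> x - y \<in> A"
    and mult: "\<And>x y. x \<in> A \<Longrightarrow> y \<in> A \<Longrightarrow> x * y \<in> A"
    using assms by (auto simp: is_subring_def)
  from diff[OF 1 1] show 0: "0 \<in> A" by simp
  have neg: "- x \<in> A" if "x \<in> A" for x using diff[OF 0 that] by simp
  have add: "x + y \<in> A" if "x \<in> A" "y \<in> A" for x y using diff[OF that(1) neg[OF that(2)]] by simp
  show "x \<in> A \<Longrightarrow> - x \<in> A" "x \<in> A \<Longrightarrow> y \<in> A \<Longrightarrow> x + y \<in> A" by (fact neg add)+
  show "x \<in> A \<Longrightarrow> x ^ n \<in> A" by (induction n) (auto intro: 1 mult)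
  have nat: "of_nat n \<in> A" for n by (induction n) (auto intro: 0 1 add)
  thus "of_nat n \<in> A" .
  show "of_int k \<in> A" by (cases k rule: int_cases2) (auto intro: nat neg)
  show "(\<And>i. i \<in> I \<Longrightarrow> f i \<in> A) \<Longrightarrow> sum f I \<in> A"
    by (induction I rule: infinite_finite_induct) (auto intro: 0 add)
  show "(\<And>i. i \<in> I \<Longrightarrow> f i \<in> A) \<Longrightarrow> prod f I \<in> A"
    by (induction I rule: infinite_finite_induct) (auto intro: 1 mult)
qed

lemma is_subring_mult_closed_coeffs:
  assumes "is_subring A" "\<And>i. coeff p i \<in> A" "\<And>i. coeff q i \<in> A"
  shows "coeff (p * q) i \<in> A"
  unfolding coeff_mult by (intro is_subringD(10)[OF assms(1)] is_subringD(4)[OF assms(1)] assms)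

lemma is_subring_poly_closed:
  assumes "is_subring A" "\<And>i. coeff p i \<in> A" "x \<in> A"
  shows "poly p x \<in> A"
  unfolding poly_altdef
  by (intro is_subringD(10)[OF assms(1)] is_subringD(4)[OF assms(1)] is_subringD(7)[OF assms(1)] assms)

lemma is_subring_adjoin:
  assumes A: "is_subring A"
  shows "is_subring {poly p x | p. \<forall>i. coeff p i \<in> A}" (is "is_subring ?B")
  unfolding is_subring_def
proof (intro conjI ballI)
  show "1 \<in> ?B"
    by (rule CollectI, rule exI[of _ 1]) (auto simp: is_subringD(1,2)[OF A] coeff_1)
  fix a b assume "a \<in> ?B" "b \<in> ?B"
  then obtain p q where p: "a = poly p x" "\<forall>i. coeff p i \<in> A" and q: "b = poly q x" "\<forall>i. coeff q i \<in> A"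
    by blast
  show "a - b \<in> ?B"
    by (rule CollectI, rule exI[of _ "p - q"]) (use p q is_subringD(3)[OF A] in auto)
  show "a * b \<in> ?B"
    by (rule CollectI, rule exI[of _ "p * q"])
       (use p q is_subring_mult_closed_coeffs[OF A] in auto)
qed

lemma adjoin_superset:
  assumes A: "is_subring A"
  shows "A \<subseteq> {poly p x | p. \<forall>i. coeff p i \<in> A}" "x \<in> {poly p x | p. \<forall>i. coeff p i \<in> A}"
proof
  fix a assume "a \<in> A"
  thus "a \<in> {poly p x | p. \<forall>i. coeff p i \<in> A}"
    by (intro CollectI exI[of _ "[:a:]"]) (auto simp: is_subringD(1)[OF A] coeff_pCons split: nat.split)
next
  show "x \<in> {poly p x | p. \<forall>i. coeff p i \<in> A}"
    by (intro CollectI exI[of _ "[:0,1:]"]) (auto simp: is_subringD(1,2)[OF A] coeff_pCons split: nat.split)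
qed

section \<open>Existence of valuation rings and integral closure\<close>

lemma maximal_subring_avoiding_inverse:
  fixes A :: "'a :: field set"
  assumes A: "is_subring A" and uA: "u \<in> A" and nA: "inverse u \<notin> A"
  obtains V where "is_subring V" "A \<subseteq> V" "inverse u \<notin> V"
    "\<And>B. is_subring B \<Longrightarrow> V \<subseteq> B \<Longrightarrow> inverse u \<notin> B \<Longrightarrow> B = V"
proof -
  define \<A> where "\<A> = {B. is_subring B \<and> A \<subseteq> B \<and> inverse u \<notin> B}"
  have "\<exists>V\<in>\<A>. \<forall>B\<in>\<A>. V \<subseteq> B \<longrightarrow> B = V"
  proof (rule subset_Zorn_nonempty)
    show "\<A> \<noteq> {}" using A nA by (auto simp: \<A>_def)
  next
    fix C assume C: "C \<noteq> {}" "subset.chain \<A> C"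
    have sub: "\<And>B. B \<in> C \<Longrightarrow> is_subring B \<and> A \<subseteq> B \<and> inverse u \<notin> B"
      using C by (auto simp: \<A>_def subset.chain_def)
    have tot: "\<And>B B'. B \<in> C \<Longrightarrow> B' \<in> C \<Longrightarrow> B \<subseteq> B' \<or> B' \<subseteq> B"
      using C by (auto simp: subset.chain_def subset_iff_psubset_eq)
    have "is_subring (\<Union>C)"
      unfolding is_subring_def
    proof (intro conjI ballI)
      show "1 \<in> \<Union>C" using C(1) sub is_subringD(2) by blast
      fix x y assume "x \<in> \<Union>C" "y \<in> \<Union>C"
      then obtain B B' where "B \<in> C" "B' \<in> C" "x \<in> B" "y \<in> B'" by blast
      then obtain B'' where "B'' \<in> C" "x \<in> B''" "y \<in> B''" using tot by blast
      thus "x - y \<in> \<Union>C" "x * y \<in> \<Union>C" using sub is_subringD(3,4) by blast+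
    qed
    thus "\<Union>C \<in> \<A>" using sub C(1) by (auto simp: \<A>_def)
  qed
  then obtain V where V: "V \<in> \<A>" "\<forall>B\<in>\<A>. V \<subseteq> B \<longrightarrow> B = V" by blast
  show ?thesis
    by (rule that[of V]) (use V in \<open>auto simp: \<A>_def\<close>)
qed

text \<open>A subring V maximal among those avoiding \<open>inverse u\<close> works. If neither x
  nor its inverse were in V, adjoining either would produce \<open>inverse u\<close>, and two such
  polynomial expressions of least degree contradict each other.\<close>

lemma exists_valuation_ring:
  fixes A :: "'a :: field set"
  assumes A: "is_subring A" and uA: "u \<in> A" and nA: "inverse u \<notin> A"
  shows "\<exists>V. is_valuation_ring V \<and> A \<subseteq> V \<and> inverse u \<notin> V"
proof -
  obtain V where V: "is_subring V" "A \<subseteq> V" "inverse u \<notin> V"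
    and max: "\<And>B. is_subring B \<Longrightarrow> V \<subseteq> B \<Longrightarrow> inverse u \<notin> B \<Longrightarrow> B = V"
    by (rule maximal_subring_avoiding_inverse[OF assms]) blast
  note VD = is_subringD[OF V(1)]
  have u: "u \<in> V" "u \<noteq> 0" using uA V VD(1) by auto
  have unit: "1 - u * b \<noteq> 0" "inverse (1 - u * b) \<in> V" if b: "b \<in> V" for b
  proof -
    have nz: "1 - u * b \<noteq> 0" if "b \<in> V" for b
    proof
      assume "1 - u * b = 0"
      hence "inverse u = b" using u by (simp add: field_simps)
      thus False using that V by simp
    qed
    \<comment> \<open>Localizing V at the elements \<open>1 - u * b\<close> still avoids
      \<open>inverse u\<close>, so by maximality they are already units of V.\<close>
    define W where "W = {a / (1 - u * b) | a b. a \<in> V \<and> b \<in> V}"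
    have "W = V"
    proof (rule max)
      show "V \<subseteq> W"
      proof
        fix a assume "a \<in> V" thus "a \<in> W" unfolding W_def using VD(1)
          by (intro CollectI exI[of _ a] exI[of _ 0]) auto
      qed
      thus "is_subring W" unfolding is_subring_def
      proof (intro conjI ballI)
        show "1 \<in> W" using \<open>V \<subseteq> W\<close> VD(2) by blast
        fix x y assume "x \<in> W" "y \<in> W"
        then obtain a b a' b' where ab: "x = a / (1 - u * b)" "a \<in> V" "b \<in> V"
          "y = a' / (1 - u * b')" "a' \<in> V" "b' \<in> V" by (auto simp: W_def)
        have eq: "1 - u * (b + b' - u * b * b') = (1 - u * b) * (1 - u * b')" by (simp add: algebra_simps)
        have mem: "b + b' - u * b * b' \<in> V" using ab u by (intro VD)
        show "x * y \<in> W" unfolding W_def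
          by (intro CollectI exI[of _ "a * a'"] exI[of _ "b + b' - u * b * b'"] conjI mem VD(4) ab)
             (simp only: eq ab, simp)
        show "x - y \<in> W" unfolding W_def
        proof (intro CollectI exI conjI)
          show "x - y = (a * (1 - u * b') - a' * (1 - u * b)) / (1 - u * (b + b' - u * b * b'))"
            using nz[OF ab(3)] nz[OF ab(6)] by (simp only: eq ab) (simp add: diff_frac_eq)
        qed (use ab u VD(2) mem in \<open>auto intro!: VD(3,4)\<close>)
      qed
      show "inverse u \<notin> W"
      proof
        assume "inverse u \<in> W"
        then obtain a b where ab: "a \<in> V" "b \<in> V" "inverse u = a / (1 - u * b)" by (auto simp: W_def)
        hence "inverse u = a + b" using nz[OF ab(2)] u by (simp add: field_simps)
        thus False using VD(6)[OF ab(1,2)] V by simp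
      qed
    qed
    moreover have "inverse (1 - u * b) \<in> W" unfolding W_def using b VD(2)
      by (intro CollectI exI[of _ 1] exI[of _ b]) (auto simp: field_simps)
    ultimately show "inverse (1 - u * b) \<in> V" by simp
    show "1 - u * b \<noteq> 0" by (rule nz[OF b])
  qed
  define R where "R = (\<lambda>x p. (\<forall>i. coeff p i \<in> V) \<and> poly p x = inverse u)"
  have ex: "\<exists>p. R x p" if "x \<notin> V" for x
  proof (rule ccontr)
    assume "\<nexists>p. R x p"
    hence "inverse u \<notin> {poly p x | p. \<forall>i. coeff p i \<in> V}" by (force simp: R_def)
    from max[OF is_subring_adjoin[OF V(1)] adjoin_superset(1)[OF V(1)] this]
      adjoin_superset(2)[OF V(1), of x] that show False by simp
  qed
  have shrink: "\<exists>p'. R x p' \<and> degree p' < degree p"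
    if p: "R x p" and q: "R (inverse x) q" and deg: "degree q \<le> degree p" and x: "x \<noteq> 0" for x p q
  proof -
    define n where "n = degree p"
    have "n > 0"
    proof (rule ccontr)
      assume "\<not> n > 0"
      then obtain c where "p = [:c:]" unfolding n_def by (auto elim: degree_eq_zeroE)
      with p show False using V(3) by (auto simp: R_def dest: spec[of _ 0])
    qed
    \<comment> \<open>As \<open>1 - u * coeff q 0\<close> is a unit, the relation for
      \<open>inverse x\<close> can be solved for 1. Multiplied by \<open>x ^ n\<close> it gives
      \<open>x ^ n\<close> as a polynomial \<open>r\<close> in x of degree below n, which replaces
      the leading term of p.\<close>
    define c where "c = inverse (1 - u * coeff q 0)"
    have c: "c \<in> V" "c * (1 - u * coeff q 0) = 1" using unit[of "coeff q 0"] q by (auto simp: c_def R_def)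
    define r where "r = (\<Sum>i=1..degree q. monom (c * u * coeff q i) (n - i))"
    have "inverse u = poly q (inverse x)" using q by (simp add: R_def)
    also have "\<dots> = (\<Sum>i\<le>degree q. coeff q i * inverse x ^ i)" by (simp add: poly_altdef)
    also have "{..degree q} = insert 0 {1..degree q}" by auto
    also have "(\<Sum>i\<in>\<dots>. coeff q i * inverse x ^ i) = coeff q 0 + (\<Sum>i=1..degree q. coeff q i * inverse x ^ i)"
      by (subst sum.insert) auto
    finally have "1 - u * coeff q 0 = u * (\<Sum>i=1..degree q. coeff q i * inverse x ^ i)"
      using u by (simp add: field_simps)
    hence "x ^ n = (c * u * (\<Sum>i=1..degree q. coeff q i * inverse x ^ i)) * x ^ n"
      using c(2) by (simp add: mult.assoc)
    also have "\<dots> = poly r x"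
      unfolding r_def poly_sum sum_distrib_left sum_distrib_right
      using deg x by (intro sum.cong) (auto simp: poly_monom n_def power_diff field_simps)
    finally have r: "poly r x = x ^ n" ..
    define p' where "p' = p - smult (coeff p n) (monom 1 n - r)"
    have degr: "degree r < n" unfolding r_def using \<open>n > 0\<close>
      by (intro degree_sum_less) (auto intro: le_less_trans[OF degree_monom_le])
    have "degree p' < n"
    proof -
      have "coeff p' n = 0" using degr by (simp add: p'_def coeff_eq_0)
      moreover have "degree p' \<le> n" unfolding p'_def using degr
        by (intro degree_diff_le order.trans[OF degree_smult_le]) (auto simp: n_def degree_monom_le)
      ultimately show ?thesis using \<open>n > 0\<close>
        by (metis degree_0 leading_coeff_0_iff nat_less_le)
    qed
    moreover have "coeff r i \<in> V" for i unfolding r_def coeff_sum coeff_monom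
      using c u q by (intro VD(10)) (auto simp: R_def intro!: VD)
    hence "coeff p' i \<in> V" for i unfolding p'_def coeff_diff coeff_smult coeff_monom
      using p VD(1,2) by (intro VD(3,4)) (auto simp: R_def)
    moreover have "poly p' x = inverse u" using p by (simp add: p'_def r poly_monom R_def)
    ultimately show ?thesis by (auto simp: R_def n_def)
  qed
  have "x \<in> V \<or> inverse x \<in> V" for x
  proof (rule ccontr)
    assume "\<not> (x \<in> V \<or> inverse x \<in> V)"
    hence x: "x \<notin> V" "inverse x \<notin> V" "x \<noteq> 0" "inverse x \<noteq> 0" using VD(1) by auto
    define p where "p = arg_min degree (R x)"
    define q where "q = arg_min degree (R (inverse x))"
    obtain p0 where p0: "R x p0" using ex[OF x(1)] by blast
    obtain q0 where q0: "R (inverse x) q0" using ex[OF x(2)] by blast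
    have p: "R x p" and pm: "\<And>p'. R x p' \<Longrightarrow> degree p \<le> degree p'" unfolding p_def
      by (rule arg_min_natI[of "R x", OF p0]) (rule arg_min_nat_le[of "R x"])
    have q: "R (inverse x) q" and qm: "\<And>q'. R (inverse x) q' \<Longrightarrow> degree q \<le> degree q'" unfolding q_def
      by (rule arg_min_natI[of "R (inverse x)", OF q0]) (rule arg_min_nat_le[of "R (inverse x)"])
    show False
    proof (cases "degree q \<le> degree p")
      case True
      from shrink[OF p q True x(3)] pm show False by force
    next
      case False
      from shrink[of "inverse x" q p] p q False x(4) qm show False by force
    qed
  qed
  thus ?thesis using V by (auto simp: is_valuation_ring_def)
qed

text \<open>Dividing a monic equation by \<open>x ^ (n - 1)\<close> writes x as a polynomial in
  \<open>inverse x\<close>, and one of x and \<open>inverse x\<close> is in V.\<close>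

lemma algebraic_int_in_valuation_ring:
  assumes V: "is_valuation_ring V" and x: "algebraic_int x"
  shows "x \<in> V"
proof (rule ccontr)
  assume nx: "x \<notin> V"
  note VD = is_subringD[OF conjunct1[OF V[unfolded is_valuation_ring_def]]]
  have ix: "inverse x \<in> V" "x \<noteq> 0" using V nx VD(1) by (auto simp: is_valuation_ring_def)
  from x obtain p where p: "lead_coeff p = 1" "\<And>i. coeff p i \<in> \<int>" "poly p x = 0"
    by (auto elim: algebraic_int.cases)
  define n where "n = degree p"
  have "n > 0" using p by (intro Nat.gr0I) (auto simp: n_def elim!: degree_eq_zeroE)
  have "0 = (\<Sum>i\<le>n. coeff p i * x ^ i)" using p by (simp add: poly_altdef n_def)
  also have "{..n} = insert n {..<n}" by auto
  also have "(\<Sum>i\<in>\<dots>. coeff p i * x ^ i) = x ^ n + (\<Sum>i<n. coeff p i * x ^ i)"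
    using p by (subst sum.insert) (auto simp: n_def)
  finally have "x ^ n = - (\<Sum>i<n. coeff p i * x ^ i)" by (simp add: eq_neg_iff_add_eq_0)
  hence "x = - (\<Sum>i<n. coeff p i * x ^ i) * inverse x ^ (n - 1)"
    using \<open>n > 0\<close> ix by (cases n) (auto simp: field_simps)
  also have "\<dots> = - (\<Sum>i<n. coeff p i * inverse x ^ (n - 1 - i))"
    unfolding minus_mult_left [symmetric] sum_distrib_right
  proof (intro arg_cong[of _ _ uminus] sum.cong refl)
    fix i assume "i \<in> {..<n}"
    then obtain k where "n - 1 = i + k" using le_Suc_ex[of i "n - 1"] by force
    moreover from this have "n - 1 - i = k" by simp
    ultimately show "coeff p i * x ^ i * inverse x ^ (n - 1) = coeff p i * inverse x ^ (n - 1 - i)"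
      using ix by (simp add: power_add power_inverse field_simps)
  qed
  also have "\<dots> \<in> V"
  proof (intro VD(5,10,4,7) ix)
    fix i show "coeff p i \<in> V" using p(2)[of i] VD(9) by (auto elim: Ints_cases)
  qed
  finally show False using nx by simp
qed

text \<open>For the converse, some valuation ring containing Z[1/x] avoids x unless x lies in
  Z[1/x], and then clearing denominators gives a monic equation. Integrality can thus be tested in
  one valuation ring at a time, which makes closure under ring operations immediate.\<close>

lemma algebraic_int_iff_valuation_rings:
  fixes x :: "'a :: field_char_0"
  shows "algebraic_int x \<longleftrightarrow> (\<forall>V. is_valuation_ring V \<longrightarrow> x \<in> V)"
proof (rule iffI)
  assume V: "\<forall>V. is_valuation_ring V \<longrightarrow> x \<in> V"
  have Z: "is_subring (\<int> :: 'a set)" by (auto simp: is_subring_def)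
  define A where "A = {poly p (inverse x) | p. \<forall>i. coeff p i \<in> (\<int> :: 'a set)}"
  have A: "is_subring A" "inverse x \<in> A" unfolding A_def
    using is_subring_adjoin[OF Z] adjoin_superset[OF Z] by blast+
  have "x \<in> A"
  proof (rule ccontr)
    assume "x \<notin> A"
    with exists_valuation_ring[OF A] V show False by auto
  qed
  then obtain p where p: "x = poly p (inverse x)" "\<And>i. coeff p i \<in> \<int>" by (auto simp: A_def)
  show "algebraic_int x"
  proof (cases "x = 0")
    case False
    define d where "d = degree p"
    define q where "q = monom 1 (Suc d) - (\<Sum>i\<le>d. monom (coeff p i) (d - i))"
    have degs: "degree (\<Sum>i\<le>d. monom (coeff p i) (d - i)) \<le> d"
      by (intro degree_sum_le) (auto intro: order.trans[OF degree_monom_le])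
    have c1: "coeff (\<Sum>i\<le>d. monom (coeff p i) (d - i)) (Suc d) = 0"
      using degs by (intro coeff_eq_0) auto
    have "degree q = Suc d"
    proof (rule antisym)
      show "degree q \<le> Suc d" unfolding q_def using degs
        by (intro degree_diff_le) (auto simp: degree_monom_le)
      show "Suc d \<le> degree q" by (rule le_degree) (simp add: q_def c1)
    qed
    hence "lead_coeff q = 1" by (simp add: q_def c1)
    moreover have "\<forall>i. coeff q i \<in> \<int>" using p(2)
      by (auto simp: q_def coeff_sum coeff_monom intro!: Ints_diff Ints_sum)
    moreover have "poly q x = 0"
    proof -
      have "x * x ^ d = (\<Sum>i\<le>d. coeff p i * inverse x ^ i) * x ^ d"
        by (subst p(1)) (simp add: poly_altdef d_def)
      also have "\<dots> = (\<Sum>i\<le>d. coeff p i * x ^ (d - i))" unfolding sum_distrib_right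
        using False by (intro sum.cong) (auto simp: power_diff field_simps)
      finally show ?thesis by (simp add: q_def poly_monom poly_sum)
    qed
    ultimately show ?thesis by (intro algebraic_int.intros)
  qed auto
qed (auto intro: algebraic_int_in_valuation_ring)

lemma is_subring_algebraic_int: "is_subring {x :: 'a :: field_char_0. algebraic_int x}"
  unfolding is_subring_def algebraic_int_iff_valuation_rings
  by (auto simp: is_valuation_ring_def intro: is_subringD)

section \<open>A place of the complex numbers above 3\<close>

definition val3 :: "complex set" where
  "val3 = (SOME V. is_valuation_ring V \<and> inverse 3 \<notin> V)"

text \<open>The clause \<open>x = 0\<close> is there because \<open>inverse 0 = 0\<close> lies in
  \<open>val3\<close>.\<close>

definition max3 :: "complex set" where
  "max3 = {x \<in> val3. x = 0 \<or> inverse x \<notin> val3}"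

lemma val3_valuation_ring: "is_valuation_ring val3" and inverse_3_notin_val3: "inverse 3 \<notin> val3"
proof -
  have "inverse 3 \<notin> (\<int> :: complex set)"
  proof
    assume "inverse 3 \<in> (\<int> :: complex set)"
    then obtain k where "inverse 3 = (of_int k :: complex)" by (auto elim: Ints_cases)
    hence "of_int (3 * k) = (of_int 1 :: complex)" by (simp add: field_simps)
    hence "3 * k = 1" by (simp only: of_int_eq_iff)
    thus False by presburger
  qed
  moreover have "is_subring (\<int> :: complex set)" by (auto simp: is_subring_def)
  ultimately have "\<exists>V. is_valuation_ring V \<and> \<int> \<subseteq> V \<and> inverse 3 \<notin> (V :: complex set)"
    by (intro exists_valuation_ring) auto
  hence "\<exists>V :: complex set. is_valuation_ring V \<and> inverse 3 \<notin> V" by blast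
  from someI_ex[OF this] show "is_valuation_ring val3" "inverse 3 \<notin> val3"
    by (simp_all add: val3_def)
qed

lemma val3_subring: "is_subring val3"
  using val3_valuation_ring by (simp add: is_valuation_ring_def)

lemmas val3_closed = is_subringD[OF val3_subring]

lemmas val3_closed' [simp, intro] = val3_closed(1,2)

lemma numeral_in_val3 [simp, intro]: "numeral k \<in> val3"
  using val3_closed(8)[of "numeral k"] by simp

lemma of_int_in_val3 [simp, intro]: "of_int k \<in> val3" by (rule val3_closed)

lemma val3_total: "x \<in> val3 \<or> inverse x \<in> val3"
  using val3_valuation_ring by (simp add: is_valuation_ring_def)

lemma algebraic_int_in_val3 [intro]: "algebraic_int x \<Longrightarrow> x \<in> val3"
  by (rule algebraic_int_in_valuation_ring[OF val3_valuation_ring])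

lemma max3_in_val3: "x \<in> max3 \<Longrightarrow> x \<in> val3" by (simp add: max3_def)

lemma inverse_in_val3: "x \<in> val3 \<Longrightarrow> x \<notin> max3 \<Longrightarrow> inverse x \<in> val3" by (simp add: max3_def)

lemma inverse_in_max3: "x \<notin> val3 \<Longrightarrow> inverse x \<in> max3"
  using val3_total[of x] by (auto simp: max3_def)

lemma zero_in_max3 [simp]: "0 \<in> max3" by (simp add: max3_def)

lemma one_notin_max3 [simp]: "1 \<notin> max3" by (simp add: max3_def)

lemma three_in_max3 [simp]: "3 \<in> max3" using inverse_3_notin_val3 by (simp add: max3_def)

lemma max3_mult_left: 
  assumes "x \<in> val3" "y \<in> max3"
  shows "x * y \<in> max3"
proof (cases "x * y = 0")
  case False
  have "inverse (x * y) \<notin> val3"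
  proof
    assume "inverse (x * y) \<in> val3"
    from val3_closed(4)[OF assms(1) this] False have "inverse y \<in> val3" by (simp add: field_simps)
    thus False using assms False by (simp add: max3_def)
  qed
  thus ?thesis using assms by (simp add: max3_def val3_closed(4))
qed (simp only: zero_in_max3)

lemma max3_mult_right: "x \<in> max3 \<Longrightarrow> y \<in> val3 \<Longrightarrow> x * y \<in> max3"
  using max3_mult_left[of y x] by (simp add: mult.commute)

lemma max3_minus: "x \<in> max3 \<Longrightarrow> - x \<in> max3"
  using max3_mult_left[of "-1" x] val3_closed(5)[of 1] by simp

lemma max3_add:
  assumes "x \<in> max3" "y \<in> max3"
  shows "x + y \<in> max3"
proof -
  \<comment> \<open>Factor out the summand of smaller valuation; one of \<open>x / y\<close> and
    \<open>y / x\<close> lies in \<open>val3\<close>.\<close>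
  have *: "x + y \<in> max3" if "x \<in> max3" "y \<in> max3" "x * inverse y \<in> val3" "y \<noteq> 0" for x y
  proof -
    have "x + y = (x * inverse y + 1) * y" using that by (simp add: field_simps)
    also have "\<dots> \<in> max3" by (intro max3_mult_left val3_closed that)
    finally show ?thesis .
  qed
  show ?thesis
  proof (cases "x = 0 \<or> y = 0")
    case False
    hence "inverse (x * inverse y) = y * inverse x" by simp
    with val3_total[of "x * inverse y"] *[of x y] *[of y x] False assms show ?thesis
      by (auto simp: add.commute mult.commute)
  qed (use assms in auto)
qed

lemma max3_diff: "x \<in> max3 \<Longrightarrow> y \<in> max3 \<Longrightarrow> x - y \<in> max3"
  using max3_add[of x "-y"] max3_minus[of y] by simp

lemma max3_power: "x \<in> max3 \<Longrightarrow> n > 0 \<Longrightarrow> x ^ n \<in> max3"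
  by (cases n) (simp_all add: max3_mult_right val3_closed(7) max3_in_val3)

lemma val3_power_iff [simp]:
  assumes "n > 0"
  shows "x ^ n \<in> val3 \<longleftrightarrow> x \<in> val3"
proof
  assume *: "x ^ n \<in> val3"
  show "x \<in> val3"
  proof (rule ccontr)
    assume "x \<notin> val3"
    hence "inverse x ^ n \<in> max3" "x \<noteq> 0" using assms by (auto intro!: max3_power inverse_in_max3)
    from max3_mult_left[OF * this(1)] this(2) show False by (simp flip: power_mult_distrib)
  qed
qed (rule val3_closed)

section \<open>The residue field of the place\<close>

definition residue_rel :: "complex \<Rightarrow> complex \<Rightarrow> bool" where
  "residue_rel x y \<longleftrightarrow> x \<in> val3 \<and> y \<in> val3 \<and> x - y \<in> max3"

\<comment> \<open>The quotient is partial because only elements of \<open>val3\<close> have a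
  residue. As a type of class \<open>field\<close> it admits polynomials, \<open>order\<close> and
  bounds on the number of roots.\<close>
quotient_type residue3 = complex / partial: residue_rel
proof (rule part_equivpI)
  show "\<exists>x. residue_rel x x" by (rule exI[of _ 0]) (simp add: residue_rel_def)
  show "symp residue_rel"
  proof (rule sympI)
    fix x y assume "residue_rel x y"
    thus "residue_rel y x" using max3_minus[of "x - y"] by (simp add: residue_rel_def)
  qed
  show "transp residue_rel"
  proof (rule transpI)
    fix x y z assume "residue_rel x y" "residue_rel y z"
    thus "residue_rel x z" using max3_add[of "x - y" "y - z"] by (simp add: residue_rel_def)
  qed
qed

lemma residue_rel_inverse:
  assumes "residue_rel x y"
  shows "residue_rel (if x \<in> max3 then 0 else inverse x) (if y \<in> max3 then 0 else inverse y)"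
proof (cases "x \<in> max3")
  case True
  hence "y \<in> max3" using max3_diff[of x "x - y"] assms by (simp add: residue_rel_def)
  with True show ?thesis by (simp add: residue_rel_def)
next
  case False
  hence n: "y \<notin> max3" using max3_add[of "x - y" y] assms by (auto simp: residue_rel_def)
  with False have nz: "x \<noteq> 0" "y \<noteq> 0" by auto
  have iv: "inverse x \<in> val3" "inverse y \<in> val3"
    using n False assms by (auto simp: residue_rel_def intro: inverse_in_val3)
  have "inverse x - inverse y = - (inverse x * inverse y) * (x - y)"
    using nz by (simp add: field_simps)
  also have "\<dots> \<in> max3" using iv assms
    by (intro max3_mult_left val3_closed) (auto simp: residue_rel_def)
  finally show ?thesis using n False iv by (simp add: residue_rel_def)
qed

instantiation residue3 :: field
begin

lift_definition zero_residue3 :: residue3 is 0 by (simp add: residue_rel_def)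
lift_definition one_residue3 :: residue3 is 1 by (simp add: residue_rel_def)
lift_definition plus_residue3 :: "residue3 \<Rightarrow> residue3 \<Rightarrow> residue3" is "(+)"
proof -
  fix a b c d assume "residue_rel a b" "residue_rel c d"
  thus "residue_rel (a + c) (b + d)" using max3_add[of "a - b" "c - d"]
    by (simp add: residue_rel_def val3_closed algebra_simps)
qed
lift_definition uminus_residue3 :: "residue3 \<Rightarrow> residue3" is "uminus"
proof -
  fix a b assume "residue_rel a b"
  thus "residue_rel (- a) (- b)" using max3_minus[of "a - b"]
    by (simp add: residue_rel_def val3_closed algebra_simps)
qed
definition "x - y = x + (- y :: residue3)"
lift_definition times_residue3 :: "residue3 \<Rightarrow> residue3 \<Rightarrow> residue3" is "(*)"
proof -
  fix a b c d assume *: "residue_rel a b" "residue_rel c d"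
  have "a * c - b * d = a * (c - d) + (a - b) * d" by (simp add: algebra_simps)
  also have "\<dots> \<in> max3" using * by (intro max3_add max3_mult_left max3_mult_right) (auto simp: residue_rel_def)
  finally show "residue_rel (a * c) (b * d)" using * by (simp add: residue_rel_def val3_closed)
qed
lift_definition inverse_residue3 :: "residue3 \<Rightarrow> residue3"
  is "\<lambda>x. if x \<in> max3 then 0 else inverse x" by (rule residue_rel_inverse)
definition "x div y = x * inverse (y :: residue3)"

instance
proof
  fix a b c :: residue3
  show "a + b + c = a + (b + c)"
    by transfer (auto simp: residue_rel_def add.assoc intro!: val3_closed)
  show "a + b = b + a"
    by transfer (auto simp: residue_rel_def add.commute intro!: val3_closed)
  show "0 + a = a" by transfer (auto simp: residue_rel_def)
  show "- a + a = 0" by transfer (auto simp: residue_rel_def)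
  show "a - b = a + - b" by (fact minus_residue3_def)
  show "a * b * c = a * (b * c)"
    by transfer (auto simp: residue_rel_def mult.assoc intro!: val3_closed)
  show "a * b = b * a"
    by transfer (auto simp: residue_rel_def mult.commute intro!: val3_closed)
  show "1 * a = a" by transfer (auto simp: residue_rel_def)
  show "(a + b) * c = a * c + b * c"
    by transfer (auto simp: residue_rel_def ring_distribs intro!: val3_closed)
  show "(0 :: residue3) \<noteq> 1"
    by transfer (use max3_minus[of "-1"] in \<open>auto simp: residue_rel_def\<close>)
  show "a \<noteq> 0 \<Longrightarrow> inverse a * a = 1"
  proof (transfer, goal_cases)
    case (1 a)
    hence "a \<in> val3" "a \<notin> max3" "a \<noteq> 0" by (auto simp: residue_rel_def)
    thus ?case by (auto simp: residue_rel_def inverse_in_val3 val3_closed)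
  qed
  show "a div b = a * inverse b" by (fact divide_residue3_def)
  show "inverse (0 :: residue3) = 0" by transfer (auto simp: residue_rel_def)
qed

end

text \<open>Elements outside \<open>val3\<close> get the junk value 0; hence the membership
  assumptions in the rules for \<open>res\<close>.\<close>

lift_definition res :: "complex \<Rightarrow> residue3" is "\<lambda>x. if x \<in> val3 then x else 0"
  by (auto simp: residue_rel_def)

lemma res_0 [simp]: "res 0 = 0" by transfer (auto simp: residue_rel_def)
lemma res_1 [simp]: "res 1 = 1" by transfer (auto simp: residue_rel_def)

lemma res_add: "x \<in> val3 \<Longrightarrow> y \<in> val3 \<Longrightarrow> res (x + y) = res x + res y"
  by transfer (auto simp: residue_rel_def val3_closed)
lemma res_minus: "x \<in> val3 \<Longrightarrow> res (- x) = - res x"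
  by transfer (auto simp: residue_rel_def val3_closed)
lemma res_mult: "x \<in> val3 \<Longrightarrow> y \<in> val3 \<Longrightarrow> res (x * y) = res x * res y"
  by transfer (auto simp: residue_rel_def val3_closed)
lemma res_eq_0_iff: "x \<in> val3 \<Longrightarrow> res x = 0 \<longleftrightarrow> x \<in> max3"
  by transfer (auto simp: residue_rel_def)

lemma res_max3 [simp]: "x \<in> max3 \<Longrightarrow> res x = 0"
  using res_eq_0_iff[of x] by (simp add: max3_in_val3)

lemma res_power: "x \<in> val3 \<Longrightarrow> res (x ^ n) = res x ^ n"
  by (induction n) (simp_all add: res_mult val3_closed)

lemma res_sum: "(\<And>i. i \<in> I \<Longrightarrow> f i \<in> val3) \<Longrightarrow> res (sum f I) = (\<Sum>i\<in>I. res (f i))"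
  by (induction I rule: infinite_finite_induct) (auto simp: res_add val3_closed)

lemma res_of_nat [simp]: "res (of_nat n) = of_nat n"
  by (induction n) (auto simp: res_add val3_closed)

lemma res_of_int [simp]: "res (of_int n) = of_int n"
  by (cases n rule: int_cases2) (auto simp: res_minus val3_closed)

lemma three_residue3 [simp]: "(3 :: residue3) = 0"
  using res_of_nat[of 3] res_max3[OF three_in_max3] by simp

lemma of_int_residue3_eq_0_iff: "of_int k = (0 :: residue3) \<longleftrightarrow> 3 dvd k"
proof
  assume "3 dvd k"
  thus "of_int k = (0 :: residue3)" by (auto elim!: dvdE)
next
  assume 0: "of_int k = (0 :: residue3)"
  show "3 dvd k"
  proof (rule ccontr)
    assume "\<not> 3 dvd k"
    hence "\<exists>q. k = 3 * q + 1 \<or> k = 3 * q - 1" by presburger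
    then obtain q where "k = 3 * q + 1 \<or> k = 3 * q - 1" by blast
    hence "(of_int k :: residue3) = 1 \<or> (of_int k :: residue3) = - 1" by auto
    with 0 show False by simp
  qed
qed

lemma cube_add_residue3: "(x + y) ^ 3 = x ^ 3 + (y :: residue3) ^ 3"
proof -
  have "(x + y) ^ 3 = x ^ 3 + y ^ 3 + 3 * (x * y * (x + y))"
    by (simp add: power3_eq_cube algebra_simps)
  thus ?thesis by simp
qed

lemma cube_of_int_residue3: "(of_int k :: residue3) ^ 3 = of_int k"
proof -
  have "3 dvd k ^ 3 - k"
  proof -
    have "3 dvd k \<or> 3 dvd k - 1 \<or> 3 dvd k + 1" by presburger
    moreover have "k ^ 3 - k = k * (k - 1) * (k + 1)" by (simp add: power3_eq_cube algebra_simps)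
    ultimately show ?thesis by (auto simp: dvd_mult dvd_mult2)
  qed
  hence "of_int (k ^ 3 - k) = (0 :: residue3)" by (simp only: of_int_residue3_eq_0_iff)
  thus ?thesis by (simp only: of_int_diff of_int_power right_minus_eq)
qed

section \<open>Reduction of polynomials\<close>

lemma map_poly_add_on:
  assumes "f 0 = 0" "\<And>x y. x \<in> A \<Longrightarrow> y \<in> A \<Longrightarrow> f (x + y) = f x + f y"
    and "\<And>i. coeff p i \<in> A" "\<And>i. coeff q i \<in> A"
  shows "map_poly f (p + q) = map_poly f p + map_poly f q"
  by (rule poly_eqI) (simp add: coeff_map_poly assms)

text \<open>\<open>res\<close> is a homomorphism only on \<open>val3\<close>, so the set
  \<open>A\<close> of admissible coefficients is carried along; \<open>A = UNIV\<close> serves the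
  embeddings of integers and rationals.\<close>

lemma map_poly_mult_on:
  assumes f: "f 0 = 0" "\<And>x y. x \<in> A \<Longrightarrow> y \<in> A \<Longrightarrow> f (x + y) = f x + f y"
    "\<And>x y. x \<in> A \<Longrightarrow> y \<in> A \<Longrightarrow> f (x * y) = f x * f y"
    and A: "0 \<in> A" "\<And>x y. x \<in> A \<Longrightarrow> y \<in> A \<Longrightarrow> x + y \<in> A" "\<And>x y. x \<in> A \<Longrightarrow> y \<in> A \<Longrightarrow> x * y \<in> A"
    and c: "\<And>i. coeff p i \<in> A" "\<And>i. coeff q i \<in> A"
  shows "map_poly f (p * q) = map_poly f p * map_poly f q"
proof (rule poly_eqI)
  fix n
  have sum: "f (sum g I) = (\<Sum>i\<in>I. f (g i)) \<and> sum g I \<in> A" if "\<And>i. i \<in> I \<Longrightarrow> g i \<in> A" for g and I :: "nat set"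
    using that
  proof (induction I rule: infinite_finite_induct)
    case (insert i I)
    hence "f (sum g I) = (\<Sum>i\<in>I. f (g i))" "sum g I \<in> A" "g i \<in> A" by auto
    thus ?case using insert(1,2) f(2)[of "g i" "sum g I"] A(2)[of "g i" "sum g I"] by simp
  qed (use f(1) A(1) in auto)
  have "f (\<Sum>i\<le>n. coeff p i * coeff q (n - i)) = (\<Sum>i\<le>n. f (coeff p i * coeff q (n - i)))"
    by (rule conjunct1[OF sum]) (rule A(3)[OF c])
  also have "\<dots> = (\<Sum>i\<le>n. f (coeff p i) * f (coeff q (n - i)))"
    by (intro sum.cong refl f(3) c)
  finally show "coeff (map_poly f (p * q)) n = coeff (map_poly f p * map_poly f q) n"
    by (simp add: coeff_map_poly f(1) coeff_mult)
qed

abbreviation ipoly :: "int poly \<Rightarrow> 'a :: comm_ring_1 \<Rightarrow> 'a" where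
  "ipoly p x \<equiv> poly (map_poly of_int p) x"

abbreviation rpoly :: "rat poly \<Rightarrow> 'a :: field_char_0 \<Rightarrow> 'a" where
  "rpoly p x \<equiv> poly (map_poly of_rat p) x"

lemma of_int_poly_add: "map_poly of_int (p + q) = map_poly of_int p + (map_poly of_int q :: 'a :: comm_ring_1 poly)"
  by (rule map_poly_add_on[where A = UNIV]) auto
lemma of_int_poly_mult: "map_poly of_int (p * q) = map_poly of_int p * (map_poly of_int q :: 'a :: comm_ring_1 poly)"
  by (rule map_poly_mult_on[where A = UNIV]) auto
lemma of_int_poly_power: "map_poly of_int (p ^ n) = (map_poly of_int p :: 'a :: comm_ring_1 poly) ^ n"
  by (induction n) (simp_all add: of_int_poly_mult)
lemma of_int_poly_smult: "map_poly of_int (smult c p) = smult (of_int c) (map_poly of_int p :: 'a :: comm_ring_1 poly)"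
  by (rule map_poly_smult) auto
lemma of_int_poly_diff: "map_poly of_int (p - q) = map_poly of_int p - (map_poly of_int q :: 'a :: comm_ring_1 poly)"
  by (rule poly_eqI) (simp add: coeff_map_poly)
lemma of_int_poly_minus: "map_poly of_int (- q) = - (map_poly of_int q :: 'a :: comm_ring_1 poly)"
  by (rule poly_eqI) (simp add: coeff_map_poly)
lemma of_int_poly_pCons: "map_poly of_int (pCons c p) = pCons (of_int c) (map_poly of_int p :: 'a :: comm_ring_1 poly)"
  by (rule map_poly_pCons) auto
lemma of_int_poly_sum: "map_poly of_int (sum f I) = (\<Sum>i\<in>I. map_poly of_int (f i) :: 'a :: comm_ring_1 poly)"
  by (induction I rule: infinite_finite_induct) (simp_all add: of_int_poly_add)
lemma of_int_poly_pcompose: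
  "map_poly of_int (pcompose p q) = pcompose (map_poly of_int p :: 'a :: comm_ring_1 poly) (map_poly of_int q)"
  by (induction p) (simp_all add: pcompose_pCons of_int_poly_pCons of_int_poly_add of_int_poly_mult)
lemma of_int_poly_monom: "map_poly of_int (monom c n) = (monom (of_int c) n :: 'a :: comm_ring_1 poly)"
  by (rule map_poly_monom) auto

lemmas of_int_poly_simps = of_int_poly_add of_int_poly_mult of_int_poly_power of_int_poly_smult of_int_poly_diff
  of_int_poly_minus of_int_poly_pCons of_int_poly_sum of_int_poly_pcompose of_int_poly_monom

lemma of_rat_poly_add: "map_poly of_rat (p + q) = map_poly of_rat p + (map_poly of_rat q :: 'a :: field_char_0 poly)"
  by (rule map_poly_add_on[where A = UNIV]) (auto simp: of_rat_add)
lemma of_rat_poly_mult: "map_poly of_rat (p * q) = map_poly of_rat p * (map_poly of_rat q :: 'a :: field_char_0 poly)"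
  by (rule map_poly_mult_on[where A = UNIV]) (auto simp: of_rat_add of_rat_mult)
lemma of_rat_poly_power: "map_poly of_rat (p ^ n) = (map_poly of_rat p :: 'a :: field_char_0 poly) ^ n"
  by (induction n) (simp_all add: of_rat_poly_mult)
lemma of_rat_poly_smult: "map_poly of_rat (smult c p) = smult (of_rat c) (map_poly of_rat p :: 'a :: field_char_0 poly)"
  by (rule map_poly_smult) (auto simp: of_rat_mult)
lemma of_rat_poly_diff: "map_poly of_rat (p - q) = map_poly of_rat p - (map_poly of_rat q :: 'a :: field_char_0 poly)"
  by (rule poly_eqI) (simp add: coeff_map_poly of_rat_diff)
lemma of_rat_poly_minus: "map_poly of_rat (- q) = - (map_poly of_rat q :: 'a :: field_char_0 poly)"
  by (rule poly_eqI) (simp add: coeff_map_poly of_rat_minus)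
lemma of_rat_poly_pCons: "map_poly of_rat (pCons c p) = pCons (of_rat c) (map_poly of_rat p :: 'a :: field_char_0 poly)"
  by (rule map_poly_pCons) auto
lemma of_rat_poly_pcompose:
  "map_poly of_rat (pcompose p q) = pcompose (map_poly of_rat p :: 'a :: field_char_0 poly) (map_poly of_rat q)"
  by (induction p) (simp_all add: pcompose_pCons of_rat_poly_pCons of_rat_poly_add of_rat_poly_mult)
lemma of_rat_poly_pderiv: "map_poly of_rat (pderiv p) = pderiv (map_poly of_rat p :: 'a :: field_char_0 poly)"
  by (induction p) (simp_all add: pderiv_pCons of_rat_poly_pCons of_rat_poly_add)
lemma of_rat_of_int_poly: "map_poly of_rat (map_poly of_int p) = (map_poly of_int p :: 'a :: field_char_0 poly)"
  by (simp add: map_poly_map_poly o_def)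
lemma of_rat_poly_eq_0_iff: "map_poly of_rat p = (0 :: 'a :: field_char_0 poly) \<longleftrightarrow> p = 0"
  by (rule map_poly_eq_0_iff) auto

lemmas of_rat_poly_simps = of_rat_poly_add of_rat_poly_mult of_rat_poly_power of_rat_poly_smult of_rat_poly_diff
  of_rat_poly_minus of_rat_poly_pCons of_rat_poly_pcompose of_rat_of_int_poly

lemma ipoly_in_val3: "x \<in> val3 \<Longrightarrow> ipoly p x \<in> val3"
  by (rule is_subring_poly_closed[OF val3_subring]) (auto simp: coeff_map_poly)

lemma res_ipoly: "x \<in> val3 \<Longrightarrow> res (ipoly p x) = ipoly p (res x)"
  by (induction p) (simp_all add: of_int_poly_pCons res_add res_mult ipoly_in_val3 val3_closed)

lemma ipoly_cube_residue3: "ipoly p (x ^ 3) = (ipoly p x :: residue3) ^ 3"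
  by (induction p)
     (simp_all add: of_int_poly_pCons cube_add_residue3 cube_of_int_residue3 power_mult_distrib)

lemma map_poly_res_mult:
  assumes "\<And>i. coeff p i \<in> val3" "\<And>i. coeff q i \<in> val3"
  shows "map_poly res (p * q) = map_poly res p * map_poly res q"
  by (rule map_poly_mult_on[where A = val3]) (auto simp: res_add res_mult val3_closed assms)

lemma map_poly_res_prod:
  assumes "\<And>i k. i \<in> I \<Longrightarrow> coeff (f i) k \<in> val3"
  shows "map_poly res (prod f I) = (\<Prod>i\<in>I. map_poly res (f i)) \<and> (\<forall>k. coeff (prod f I) k \<in> val3)"
  using assms
  by (induction I rule: infinite_finite_induct)
     (auto simp: map_poly_res_mult coeff_1 is_subring_mult_closed_coeffs[OF val3_subring])

lemma order_prod_linear: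
  fixes a :: "'b \<Rightarrow> 'a :: idom"
  assumes "finite I"
  shows "order y (\<Prod>i\<in>I. [:- a i, 1:]) = card {i \<in> I. a i = y}"
  using assms
proof (induction I rule: finite_induct)
  case (insert i I)
  have nz: "(\<Prod>i\<in>I. [:- a i, 1:]) \<noteq> 0" using insert by auto
  have "order y [:- a i, 1:] = (if a i = y then 1 else 0)"
    using order_power_n_n[of y 1] by (auto intro!: order_0I)
  moreover have "{k \<in> insert i I. a k = y} = (if a i = y then insert i {k \<in> I. a k = y} else {k \<in> I. a k = y})"
    by auto
  moreover have "order y (\<Prod>i\<in>insert i I. [:- a i, 1:]) = order y [:- a i, 1:] + order y (\<Prod>i\<in>I. [:- a i, 1:])"
    using insert(1,2) nz by (simp add: order_mult del: mult_pCons_left)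
  ultimately show ?case using insert by simp
qed auto

text \<open>Reducing a polynomial modulo the maximal ideal keeps exactly the roots in the valuation ring;
  the others are sent to infinity.\<close>

lemma reduction_of_split_poly:
  assumes fin: "finite S" and h: "h = smult c (\<Prod>i\<in>S. [:- Y i, 1:])"
    and hO: "\<And>i. coeff h i \<in> val3" and nz: "map_poly res h \<noteq> 0"
  shows "\<exists>c'. c' \<noteq> 0 \<and> map_poly res h = smult c' (\<Prod>i\<in>{i \<in> S. Y i \<in> val3}. [:- res (Y i), 1:])"
proof -
  define S1 where "S1 = {i \<in> S. Y i \<in> val3}"
  define S2 where "S2 = {i \<in> S. Y i \<notin> val3}"
  have S: "S = S1 \<union> S2" "S1 \<inter> S2 = {}" "finite S1" "finite S2" using fin by (auto simp: S1_def S2_def)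
  define p1 where "p1 = (\<Prod>i\<in>S1. [:- Y i, 1:])"
  define p2 where "p2 = (\<Prod>i\<in>S2. [:1, - inverse (Y i):])"
  define c2 where "c2 = c * (\<Prod>i\<in>S2. - Y i)"
  \<comment> \<open>A root Y outside \<open>val3\<close> contributes \<open>- Y\<close> times the
    factor \<open>1 - x / Y\<close>, which reduces to 1.\<close>
  have "(\<Prod>i\<in>S2. [:- Y i, 1:]) = (\<Prod>i\<in>S2. smult (- Y i) [:1, - inverse (Y i):])"
  proof (intro prod.cong refl)
    fix i assume "i \<in> S2"
    hence "Y i \<noteq> 0" by (auto simp: S2_def)
    thus "[:- Y i, 1:] = smult (- Y i) [:1, - inverse (Y i):]" by simp
  qed
  also have "\<dots> = smult (\<Prod>i\<in>S2. - Y i) p2" unfolding p2_def by (rule prod_smult)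
  finally have h2: "h = smult c2 (p1 * p2)"
    unfolding h S(1) by (subst prod.union_disjoint) (use S in \<open>auto simp: p1_def c2_def\<close>)
  have p1: "map_poly res p1 = (\<Prod>i\<in>S1. [:- res (Y i), 1:])" "\<And>k. coeff p1 k \<in> val3"
  proof -
    have "map_poly res p1 = (\<Prod>i\<in>S1. map_poly res [:- Y i, 1:]) \<and> (\<forall>k. coeff p1 k \<in> val3)"
      unfolding p1_def
      by (rule map_poly_res_prod) (auto simp: S1_def coeff_pCons val3_closed split: nat.split)
    moreover have "(\<Prod>i\<in>S1. map_poly res [:- Y i, 1:]) = (\<Prod>i\<in>S1. [:- res (Y i), 1:])"
      by (intro prod.cong) (auto simp: map_poly_pCons res_minus S1_def)
    ultimately show "map_poly res p1 = (\<Prod>i\<in>S1. [:- res (Y i), 1:])" "\<And>k. coeff p1 k \<in> val3" by auto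
  qed
  have p2: "map_poly res p2 = 1" "\<And>k. coeff p2 k \<in> val3"
  proof -
    have inv: "- inverse (Y i) \<in> max3" if "i \<in> S2" for i
      using that by (auto simp: S2_def intro: inverse_in_max3 max3_minus)
    have "map_poly res p2 = (\<Prod>i\<in>S2. map_poly res [:1, - inverse (Y i):]) \<and> (\<forall>k. coeff p2 k \<in> val3)"
      unfolding p2_def
      by (rule map_poly_res_prod) (auto simp: coeff_pCons val3_closed max3_in_val3 inv split: nat.split)
    moreover have "(\<Prod>i\<in>S2. map_poly res [:1, - inverse (Y i):]) = 1"
      using inv by (intro prod.neutral) (auto simp: map_poly_pCons)
    ultimately show "map_poly res p2 = 1" "\<And>k. coeff p2 k \<in> val3" by auto
  qed
  define p where "p = p1 * p2"
  have pO: "\<And>k. coeff p k \<in> val3" unfolding p_def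
    by (rule is_subring_mult_closed_coeffs[OF val3_subring]) (fact p1 p2)+
  have rp: "map_poly res p = (\<Prod>i\<in>S1. [:- res (Y i), 1:])"
    unfolding p_def by (simp add: map_poly_res_mult p1 p2)
  \<comment> \<open>The reduction of p is monic, so p has a unit coefficient; comparing it with the
    coefficient of h puts \<open>c2\<close> into \<open>val3\<close>.\<close>
  have "lead_coeff (map_poly res p) = 1" unfolding rp by (simp add: lead_coeff_prod)
  hence "res (coeff p (degree (map_poly res p))) = 1" by (simp add: coeff_map_poly)
  then obtain d where d: "res (coeff p d) = 1" by blast
  hence "coeff p d \<notin> max3" by auto
  hence "inverse (coeff p d) \<in> val3" "coeff p d \<noteq> 0" using pO[of d] by (auto intro: inverse_in_val3)
  moreover have "coeff h d = c2 * coeff p d" by (simp add: h2 p_def)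
  ultimately have "c2 = coeff h d * inverse (coeff p d)" by (simp add: field_simps)
  also have "\<dots> \<in> val3" by (intro val3_closed hO) fact
  finally have c2: "c2 \<in> val3" .
  have "map_poly res h = smult (res c2) (map_poly res p)"
    unfolding h2 p_def[symmetric] by (rule poly_eqI) (simp add: coeff_map_poly res_mult c2 pO)
  with nz show ?thesis unfolding rp S1_def by (intro exI[of _ "res c2"]) auto
qed

text \<open>With \<open>(t - z) / \<rho>\<close> for \<open>Y t\<close>, the shape of a reduced
  polynomial becomes a count of roots by valuation: the degree counts those with
  \<open>t - z\<close> of valuation at least that of \<open>\<rho>\<close>, the order at 0 those of
  strictly larger valuation.\<close>

corollary card_integral_roots:
  assumes "finite S" "h = smult c (\<Prod>i\<in>S. [:- Y i, 1:])"
    and "\<And>i. coeff h i \<in> val3" and "map_poly res h \<noteq> 0"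
  shows "card {i \<in> S. Y i \<in> val3} = degree (map_poly res h)"
    and "card {i \<in> S. Y i \<in> val3 \<and> res (Y i) = y} = order y (map_poly res h)"
proof -
  define S1 where "S1 = {i \<in> S. Y i \<in> val3}"
  obtain c' where c': "c' \<noteq> 0" "map_poly res h = smult c' (\<Prod>i\<in>S1. [:- res (Y i), 1:])"
    using reduction_of_split_poly[OF assms] unfolding S1_def by blast
  have fin: "finite S1" using assms(1) by (simp add: S1_def)
  show "card {i \<in> S. Y i \<in> val3} = degree (map_poly res h)"
    unfolding c'(2) using c'(1) by (simp add: degree_prod_sum_eq flip: S1_def)
  have "{i \<in> S. Y i \<in> val3 \<and> res (Y i) = y} = {i \<in> S1. res (Y i) = y}" by (auto simp: S1_def)
  thus "card {i \<in> S. Y i \<in> val3 \<and> res (Y i) = y} = order y (map_poly res h)"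
    unfolding c'(2) using c'(1) by (simp add: order_smult order_prod_linear[OF fin])
qed

section \<open>The Newton polygon of a trinomial\<close>

text \<open>Compare 3-adic valuations in
  \<open>j * (n choose j) = n * ((n - 1) choose (j - 1))\<close>. Truncated subtraction makes the
  claim trivial once the multiplicity exceeds r.\<close>

lemma three_power_dvd_binomial:
  assumes n: "3 ^ r dvd n" and j: "j > 0"
  shows "3 ^ (r - multiplicity 3 j) dvd (n choose j)"
proof (cases "multiplicity 3 j \<le> r")
  case True
  define w where "w = multiplicity 3 j"
  obtain j' where j': "j = 3 ^ w * j'" "\<not> 3 dvd j'"
    using multiplicity_decompose'[of j 3] j by (auto simp: w_def)
  have "j * (n choose j) = n * ((n - 1) choose (j - 1))"
    by (rule times_binomial_minus1_eq[OF j])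
  moreover have "3 ^ w * 3 ^ (r - w) dvd n" using n True by (simp add: w_def flip: power_add)
  ultimately have "3 ^ w * 3 ^ (r - w) dvd 3 ^ w * (j' * (n choose j))"
    unfolding j'(1) by (simp add: mult.assoc)
  hence "3 ^ (r - w) dvd j' * (n choose j)" by simp
  moreover have "coprime (3 ^ (r - w)) j'"
    using j'(2) by (intro coprime_power_left_iff[THEN iffD2] disjI1 prime_imp_coprime) auto
  ultimately show ?thesis by (simp add: w_def coprime_dvd_mult_right_iff)
qed auto

text \<open>By Pascal's rule neighbours in row \<open>n - 1\<close> sum to entries of row n, which
  are divisible by 3 in this range; so the entries alternate between 1 and -1 modulo 3.\<close>

lemma not_three_dvd_binomial_pred:
  assumes n: "3 ^ r dvd n" "n > 0" and l: "l < 3 ^ r"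
  shows "\<not> 3 dvd ((n - 1) choose l)"
  using l
proof (induction l)
  case (Suc l)
  have "multiplicity 3 (Suc l) < r"
  proof (rule ccontr)
    assume "\<not> ?thesis"
    hence "3 ^ r dvd Suc l" by (intro multiplicity_dvd') auto
    with Suc.prems show False using dvd_imp_le by fastforce
  qed
  hence "3 ^ 1 dvd (3 :: nat) ^ (r - multiplicity 3 (Suc l))" by (intro le_imp_power_dvd) auto
  also have "\<dots> dvd (n choose Suc l)" by (rule three_power_dvd_binomial[OF n(1)]) simp
  also have "n choose Suc l = ((n - 1) choose l) + ((n - 1) choose Suc l)"
    using n(2) by (cases n) auto
  finally have "3 dvd ((n - 1) choose l) + ((n - 1) choose Suc l)" by simp
  moreover have "\<not> 3 dvd ((n - 1) choose l)" using Suc by simp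
  ultimately show ?case by (meson dvd_add_left_iff)
qed auto

text \<open>The valuation is exactly s, which puts the point \<open>(3 ^ (r - s), s)\<close> on the
  Newton polygon as a possible vertex.\<close>

lemma binomial_three_power_exact:
  assumes n: "n = 3 ^ r * n'" "\<not> 3 dvd n'" and s: "s \<le> r"
  obtains u where "(n choose 3 ^ (r - s)) = 3 ^ s * u" "\<not> 3 dvd u"
proof
  have r: "(3 :: nat) ^ r = 3 ^ (r - s) * 3 ^ s" using s by (simp flip: power_add)
  have "n' > 0" using n(2) by (intro Nat.gr0I) auto
  hence n0: "n > 0" by (simp add: n(1))
  define j where "j = (3 :: nat) ^ (r - s)"
  have "j * (n choose j) = n * ((n - 1) choose (j - 1))"
    by (rule times_binomial_minus1_eq) (simp add: j_def)
  also have "\<dots> = j * (3 ^ s * (n' * ((n - 1) choose (j - 1))))"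
    by (simp add: n(1) r j_def)
  finally show "(n choose 3 ^ (r - s)) = 3 ^ s * (n' * ((n - 1) choose (3 ^ (r - s) - 1)))"
    by (simp add: j_def)
  have "j \<le> 3 ^ r" unfolding j_def by (intro power_increasing) auto
  moreover have "j > 0" by (simp add: j_def)
  ultimately have "j - 1 < 3 ^ r" by linarith
  hence "\<not> 3 dvd ((n - 1) choose (j - 1))"
    using n0 by (intro not_three_dvd_binomial_pred[where r = r]) (auto simp: n(1))
  thus "\<not> 3 dvd n' * ((n - 1) choose (3 ^ (r - s) - 1))"
    using n(2) by (simp add: prime_dvd_mult_iff j_def)
qed

text \<open>The line through \<open>(A, s + 1)\<close> and \<open>(3 * A, s)\<close> has height
  \<open>s + (3 * A - j) / (2 * A)\<close> at j. Multiplied by \<open>2 * A\<close>, the inequality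
  says that the point at j lies strictly above it. The cases compare the powers of 3 in j and in
  A.\<close>

lemma newton_bound_middle:
  fixes j r s :: nat
  defines "A \<equiv> 3 ^ (r - s - 1)"
  assumes s: "s < r" and j: "j > 0" "j \<noteq> A" "j \<noteq> 3 * A"
  shows "2 * A * s + 3 * A < 2 * A * (r - multiplicity 3 j) + j"
proof -
  define w where "w = multiplicity 3 j"
  have w: "3 ^ w dvd j" unfolding w_def by (rule multiplicity_dvd)
  have A: "A > 0" by (simp add: A_def)
  have "w < r - s - 1 \<or> w = r - s - 1 \<or> r - s \<le> w" by linarith
  then consider "w < r - s - 1" | "w = r - s - 1" | l where "w = r - s + l"
    using le_Suc_ex by blast
  hence "2 * A * s + 3 * A < 2 * A * (r - w) + j"
  proof cases
    case 1
    hence "s + 2 \<le> r - w" using s by linarith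
    hence "2 * A * (s + 2) \<le> 2 * A * (r - w)" by (rule mult_le_mono2)
    with A j show ?thesis by (simp add: algebra_simps)
  next
    case 2
    then obtain c where c: "j = A * c" using w by (auto simp: A_def elim: dvdE)
    with j have "c \<ge> 2" by (cases "c = 0 \<or> c = 1") auto
    hence "A * 2 \<le> j" unfolding c by (rule mult_le_mono2)
    moreover have "r - w = s + 1" using 2 s by linarith
    ultimately show ?thesis using A by (simp add: algebra_simps)
  next
    case (3 l)
    have "r - s = Suc (r - s - 1)" using s by simp
    hence "(3 :: nat) ^ (r - s) = 3 * A" unfolding A_def by (metis power_Suc)
    hence "(3 :: nat) ^ w = 3 * A * 3 ^ l" unfolding 3 power_add by simp
    moreover from w obtain c where "j = 3 ^ w * c" by (elim dvdE)
    ultimately have c: "j = 3 * A * (3 ^ l * c)" by (simp add: mult.assoc)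
    show ?thesis
    proof (cases "l = 0")
      case True
      hence "r - w = s" using 3 s by linarith
      moreover have "c \<ge> 2" using c j True by (cases "c = 0 \<or> c = 1") auto
      hence "3 * A * 2 \<le> j" unfolding c using True by (intro mult_le_mono2) auto
      ultimately show ?thesis using A by simp
    next
      \<comment> \<open>The binomial coefficient may lose l factors 3, costing
        \<open>2 * A * l\<close>, but j is at least \<open>3 * A * 3 ^ l\<close>, which more than
        pays for it.\<close>
      case False
      have "c > 0" using c j by (intro Nat.gr0I) auto
      have "1 + l < 3 ^ l" using False by (induction l) (auto, case_tac l, auto)
      also have "(3::nat) ^ l \<le> 3 ^ l * c" using \<open>c > 0\<close> by simp
      finally have "3 * A * (1 + l) < j" unfolding c using A by (intro mult_strict_left_mono) auto
      moreover have "s \<le> r - w + l" using 3 s by linarith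
      hence "2 * A * s \<le> 2 * A * (r - w + l)" by (rule mult_le_mono2)
      ultimately show ?thesis using A by (simp add: algebra_simps)
    qed
  qed
  thus ?thesis by (simp add: w_def)
qed

text \<open>The same comparison with the line from \<open>(0, s + 1)\<close> to
  \<open>(B, s)\<close>, of height \<open>s + 1 - j / B\<close> at j, multiplied by B.\<close>

lemma newton_bound_left:
  fixes j r s :: nat
  defines "B \<equiv> 3 ^ (r - s)"
  assumes s: "s \<le> r" and j: "j > 0" "j \<noteq> B"
  shows "B * s + B < B * (r - multiplicity 3 j) + j"
proof -
  define w where "w = multiplicity 3 j"
  have w: "3 ^ w dvd j" unfolding w_def by (rule multiplicity_dvd)
  have B: "B > 0" by (simp add: B_def)
  consider "w < r - s" | l where "w = r - s + l"
    using le_Suc_ex[of "r - s" w] not_less by blast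
  hence "B * s + B < B * (r - w) + j"
  proof cases
    case 1
    hence "s + 1 \<le> r - w" using s by linarith
    hence "B * (s + 1) \<le> B * (r - w)" by (rule mult_le_mono2)
    with B j show ?thesis by (simp add: algebra_simps)
  next
    case (2 l)
    hence "(3 :: nat) ^ w = B * 3 ^ l" unfolding 2 power_add by (simp add: B_def)
    moreover from w obtain c where "j = 3 ^ w * c" by (elim dvdE)
    ultimately have c: "j = B * (3 ^ l * c)" by (simp add: mult.assoc)
    show ?thesis
    proof (cases "l = 0")
      case True
      hence "r - w = s" using 2 s by linarith
      moreover have "c \<ge> 2" using c j True by (cases "c = 0 \<or> c = 1") auto
      hence "B * 2 \<le> j" unfolding c using True by (intro mult_le_mono2) auto
      ultimately show ?thesis using B by simp
    next
      case False
      have "c > 0" using c j by (intro Nat.gr0I) auto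
      have "1 + l < 3 ^ l" using False by (induction l) (auto, case_tac l, auto)
      also have "(3::nat) ^ l \<le> 3 ^ l * c" using \<open>c > 0\<close> by simp
      finally have "B * (1 + l) < j" unfolding c using B by (intro mult_strict_left_mono) auto
      moreover have "s \<le> r - w + l" using 2 s by linarith
      hence "B * s \<le> B * (r - w + l)" by (rule mult_le_mono2)
      ultimately show ?thesis using B by (simp add: algebra_simps)
    qed
  qed
  thus ?thesis by (simp add: w_def)
qed

section \<open>Rescaling by a root of 3 and counting the roots on a segment\<close>

lemma root_of_three_in_max3:
  assumes "\<rho> ^ e = 3"
  shows "\<rho> \<in> max3" "\<rho> \<noteq> 0"
proof -
  have e: "e > 0" using assms by (intro Nat.gr0I) auto
  show "\<rho> \<noteq> 0" using assms e by (intro notI) (simp add: power_0_left)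
  have O: "\<rho> \<in> val3" using val3_power_iff[OF e, of \<rho>] assms by simp
  have "res \<rho> ^ e = 0" using assms res_power[OF O, of e] res_of_nat[of 3] by simp
  thus "\<rho> \<in> max3" using e O res_eq_0_iff[of \<rho>] by simp
qed

text \<open>As \<open>3 = \<rho> ^ e\<close>, heights become exponents of \<open>\<rho>\<close>: a
  point strictly above the supporting line keeps at least one factor \<open>\<rho>\<close> after the
  division.\<close>

lemma newton_term_in_max3:
  assumes \<rho>: "\<rho> ^ e = 3" and c: "c \<in> val3" and less: "e * s + B < e * v + j"
  shows "inverse (3 ^ s * \<rho> ^ B) * (3 ^ v * c * \<rho> ^ j) \<in> max3"
proof -
  note \<rho>' = root_of_three_in_max3[OF \<rho>]
  obtain d where d: "e * v + j = (e * s + B) + Suc d"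
    using less_imp_Suc_add[OF less] by auto
  have "3 ^ v * \<rho> ^ j = \<rho> ^ (e * v + j)" by (simp add: power_add power_mult \<rho>)
  also have "\<dots> = (3 ^ s * \<rho> ^ B) * \<rho> ^ Suc d" unfolding d by (simp add: power_add power_mult \<rho>)
  finally have "inverse (3 ^ s * \<rho> ^ B) * (3 ^ v * c * \<rho> ^ j) = c * \<rho> ^ Suc d"
    using \<rho>'(2) by (simp add: field_simps)
  also have "\<dots> \<in> max3" using \<rho>' c by (intro max3_mult_left max3_power) auto
  finally show ?thesis .
qed

lemma pcompose_monom_1: "pcompose (monom 1 n) q = (q :: 'a :: comm_semiring_1 poly) ^ n"
  by (induction n) (simp_all add: monom_0 monom_Suc pcompose_pCons one_pCons)

lemma pcompose_prod_linear:
  fixes z :: complex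
  assumes "finite S" "\<rho> \<noteq> 0"
  shows "pcompose (\<Prod>t\<in>S. [:- t, 1:]) [:z, \<rho>:] = smult (\<rho> ^ card S) (\<Prod>t\<in>S. [:- ((t - z) / \<rho>), 1:])"
proof -
  have "pcompose (\<Prod>t\<in>S. [:- t, 1:]) [:z, \<rho>:] = (\<Prod>t\<in>S. smult \<rho> [:- ((t - z) / \<rho>), 1:])"
    unfolding pcompose_prod using assms(2) by (intro prod.cong) (auto simp: pcompose_pCons field_simps)
  thus ?thesis by (simp only: prod_smult prod_constant)
qed

text \<open>z is an approximate root: \<open>z ^ n = \<epsilon>\<close> makes the value of the
  trinomial at z equal to \<open>\<epsilon> + b + a * z\<close>, small at the place when a and
  \<open>b + \<epsilon>\<close> are divisible by high powers of 3.\<close>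

locale trinomial_at_unit =
  fixes n r n' :: nat and a b \<epsilon> :: int and z :: complex and S :: "complex set"
  assumes n: "n = 3 ^ r * n'" "\<not> 3 dvd n'" "n > 1"
    and S: "finite S" "monom 1 n + monom (of_int a) 1 + [:of_int b:] = (\<Prod>t\<in>S. [:- t, 1:])"
    and z: "z \<in> val3" "z \<notin> max3" "z ^ n = of_int \<epsilon>"
begin

text \<open>\<open>F(z + \<rho> Y)\<close> divided by \<open>3 ^ s * \<rho> ^ B\<close>, the size of
  its term at the point \<open>(B, s)\<close>. Points on the line through \<open>(B, s)\<close> with
  the slope given by \<open>\<rho>\<close> yield units, points above it vanish modulo
  \<open>max3\<close>.\<close>

definition scaled :: "nat \<Rightarrow> complex \<Rightarrow> nat \<Rightarrow> complex poly" where
  "scaled s \<rho> B = smult (inverse (3 ^ s * \<rho> ^ B))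
     (pcompose (monom 1 n + monom (of_int a) 1 + [:of_int b:]) [:z, \<rho>:])"

lemma scaled_split:
  assumes "\<rho> \<noteq> 0"
  shows "scaled s \<rho> B = smult (inverse (3 ^ s * \<rho> ^ B) * \<rho> ^ card S) (\<Prod>t\<in>S. [:- ((t - z) / \<rho>), 1:])"
  unfolding scaled_def S(2) pcompose_prod_linear[OF S(1) assms] by simp

lemma coeff_scaled_pos:
  assumes "j > 0"
  shows "coeff (scaled s \<rho> B) j = inverse (3 ^ s * \<rho> ^ B) * (of_nat (n choose j) * z ^ (n - j) * \<rho> ^ j)
           + (if j = 1 then inverse (3 ^ s * \<rho> ^ B) * (of_int a * \<rho> ^ 1) else 0)"
proof -
  have "coeff ([:z, \<rho>:] ^ n) j = of_nat (n choose j) * \<rho> ^ j * z ^ (n - j)"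
  proof (cases "j \<le> n")
    case False
    have "degree ([:z, \<rho>:] ^ n) \<le> 1 * n" by (rule order.trans[OF degree_power_le]) auto
    with False show ?thesis by (simp add: coeff_eq_0)
  qed (rule coeff_linear_poly_power)
  thus ?thesis using assms
    by (auto simp: scaled_def pcompose_monom_1 pcompose_add pcompose_const monom_0 monom_Suc pcompose_pCons coeff_pCons
      algebra_simps split: nat.split)
qed

lemma coeff_scaled_0:
  "coeff (scaled s \<rho> B) 0 = inverse (3 ^ s * \<rho> ^ B) * ((of_int \<epsilon> + of_int b) + of_int a * z)"
proof -
  have "coeff ([:z, \<rho>:] ^ n) 0 = z ^ n" by (simp add: coeff_linear_poly_power)
  thus ?thesis using z(3)
    by (auto simp: scaled_def pcompose_monom_1 pcompose_add monom_0 monom_Suc pcompose_pCons algebra_simps)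
qed

lemma binomial_term:
  assumes \<rho>: "\<rho> ^ e = 3" and j: "j > 0" and less: "e * s + B < e * (r - multiplicity 3 j) + j"
  shows "inverse (3 ^ s * \<rho> ^ B) * (of_nat (n choose j) * z ^ (n - j) * \<rho> ^ j) \<in> max3"
proof -
  obtain c where c: "n choose j = 3 ^ (r - multiplicity 3 j) * c"
    using three_power_dvd_binomial[of r n j] j n(1) by (auto elim: dvdE)
  have "of_nat c * z ^ (n - j) \<in> val3" by (intro val3_closed z)
  from newton_term_in_max3[OF \<rho> this less] show ?thesis by (simp add: c mult_ac)
qed

lemma linear_term:
  assumes \<rho>: "\<rho> ^ e = 3" and a: "3 ^ v dvd a" and less: "e * s + B < e * v + 1"
  shows "inverse (3 ^ s * \<rho> ^ B) * (of_int a * \<rho> ^ 1) \<in> max3"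
proof -
  obtain c where c: "a = 3 ^ v * c" using a by (auto elim: dvdE)
  from newton_term_in_max3[OF \<rho> _ less, of "of_int c"] show ?thesis by (simp add: c)
qed

lemma vertex_term:
  assumes \<rho>: "\<rho> \<noteq> 0" and s: "s \<le> r"
  shows "inverse (3 ^ s * \<rho> ^ (3 ^ (r - s))) * (of_nat (n choose 3 ^ (r - s)) * z ^ (n - 3 ^ (r - s)) * \<rho> ^ (3 ^ (r - s)))
           \<in> val3 - max3" (is "?t \<in> _")
proof -
  obtain u where u: "(n choose 3 ^ (r - s)) = 3 ^ s * u" "\<not> 3 dvd u"
    using binomial_three_power_exact[OF n(1,2) s] .
  have t: "?t = of_nat u * z ^ (n - 3 ^ (r - s))" using \<rho> by (simp add: u(1) field_simps)
  have O: "of_nat u * z ^ (n - 3 ^ (r - s)) \<in> val3" by (intro val3_closed z)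
  have "res (of_nat u * z ^ (n - 3 ^ (r - s))) = of_nat u * res z ^ (n - 3 ^ (r - s))"
    by (simp add: res_mult res_power val3_closed z(1))
  moreover have "of_nat u \<noteq> (0 :: residue3)"
    using u(2) of_int_residue3_eq_0_iff[of "int u"] by (simp add: int_dvd_int_iff[of 3, simplified])
  moreover have "res z \<noteq> 0" using z res_eq_0_iff by simp
  ultimately have "of_nat u * z ^ (n - 3 ^ (r - s)) \<notin> max3" by auto
  with O show ?thesis unfolding t by blast
qed

text \<open>The segment of the Newton polygon of \<open>F(z + Y)\<close> from \<open>(A, s + 1)\<close> to \<open>(3A, s)\<close>,
  of slope \<open>-1/(2A)\<close>; after rescaling by \<open>\<rho>\<close>, it reduces to \<open>u Y\<^sup>3\<^sup>A + u' Y\<^sup>A\<close>.\<close>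

lemma card_middle_class:
  fixes s :: nat
  defines "A \<equiv> 3 ^ (r - s - 1)"
  assumes s: "s < r" and \<rho>: "\<rho> ^ (2 * A) = 3" and div: "3 ^ (s + 2) dvd a" "3 ^ (s + 2) dvd b + \<epsilon>"
  shows "card {t \<in> S. (t - z) / \<rho> \<in> val3 \<and> (t - z) / \<rho> \<notin> max3} = 2 * A"
proof -
  define B where "B = 3 * A"
  note \<rho>' = root_of_three_in_max3[OF \<rho>]
  have A: "A > 0" by (simp add: A_def)
  have "r - s = Suc (r - s - 1)" using s by simp
  hence B: "B = 3 ^ (r - s)" unfolding A_def B_def by (metis power_Suc)
  have A': "A = 3 ^ (r - (s + 1))" by (simp add: A_def)
  define h where "h = scaled s \<rho> B"
  \<comment> \<open>The term \<open>a * x\<close> has height at least \<open>s + 2\<close> at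
    abscissa 1, where the line is still below \<open>s + 2\<close>.\<close>
  have lin: "inverse (3 ^ s * \<rho> ^ B) * (of_int a * \<rho> ^ 1) \<in> max3"
    by (rule linear_term[OF \<rho> div(1)]) (use A in \<open>simp add: B_def algebra_simps\<close>)
  have max: "coeff h j \<in> max3" if j: "j \<noteq> A" "j \<noteq> B" for j
  proof (cases "j = 0")
    case True
    obtain c c' where c: "a = 3 ^ (s + 2) * c" "b + \<epsilon> = 3 ^ (s + 2) * c'" using div by (auto elim!: dvdE)
    have eq: "of_int \<epsilon> + of_int b + of_int a * z = 3 ^ (s + 2) * (of_int c' + of_int c * z) * \<rho> ^ 0"
    proof -
      have "of_int \<epsilon> + of_int b = (of_int (b + \<epsilon>) :: complex)" by simp
      thus ?thesis unfolding c by (simp add: c algebra_simps)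
    qed
    show ?thesis unfolding True h_def coeff_scaled_0 eq
      by (rule newton_term_in_max3[OF \<rho>]) (use A in \<open>auto simp: B_def algebra_simps intro!: val3_closed z\<close>)
  next
    case False
    hence pos: "j > 0" by simp
    have "2 * A * s + B < 2 * A * (r - multiplicity 3 j) + j"
      using newton_bound_middle[OF s, of j] pos j by (simp add: A_def B_def)
    from binomial_term[OF \<rho> pos this] show ?thesis unfolding h_def coeff_scaled_pos[OF pos]
      by (rule max3_add) (use lin in auto)
  qed
  have unitA: "coeff h A \<in> val3 - max3"
  proof -
    \<comment> \<open>Both end points lie on the line, so one factor normalizes both
      coefficients.\<close>
    have "inverse (3 ^ s * \<rho> ^ B) = inverse (3 ^ (s + 1) * \<rho> ^ A)"
    proof -
      have "\<rho> ^ B = \<rho> ^ (2 * A) * \<rho> ^ A" unfolding B_def power_add[symmetric] by simp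
      thus ?thesis by (simp add: \<rho>)
    qed
    hence "inverse (3 ^ s * \<rho> ^ B) * (of_nat (n choose A) * z ^ (n - A) * \<rho> ^ A) \<in> val3 - max3"
      using vertex_term[OF \<rho>'(2), of "s + 1", folded A'] s by (simp only: Suc_leI Suc_eq_plus1[symmetric])
    thus ?thesis unfolding h_def using A lin max3_add max3_diff max3_in_val3 val3_closed(6)
      by (subst coeff_scaled_pos) (auto, metis add_diff_cancel_right')
  qed
  have unitB: "coeff h B \<in> val3 - max3"
  proof -
    have "inverse (3 ^ s * \<rho> ^ B) * (of_nat (n choose B) * z ^ (n - B) * \<rho> ^ B) \<in> val3 - max3"
      using vertex_term[OF \<rho>'(2), of s] s unfolding B by simp
    thus ?thesis unfolding h_def using A
      by (subst coeff_scaled_pos) (auto simp: B_def)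
  qed
  have hO: "coeff h i \<in> val3" for i
    using max[of i] unitA unitB by (cases "i = A \<or> i = B") (auto intro: max3_in_val3)
  define u u' where "u = res (coeff h B)" and "u' = res (coeff h A)"
  have u: "u \<noteq> 0" "u' \<noteq> 0" using unitA unitB by (auto simp: u_def u'_def res_eq_0_iff)
  have AB: "A < B" using A by (simp add: B_def)
  have red: "map_poly res h = monom u B + monom u' A"
    using max AB by (intro poly_eqI) (auto simp: coeff_map_poly u_def u'_def)
  have nz: "map_poly res h \<noteq> 0" using u AB by (auto simp: red poly_eq_iff intro!: exI[of _ B])
  have "degree (map_poly res h) = B" unfolding red using u AB
    by (subst degree_add_eq_left) (auto simp: degree_monom_eq)
  moreover have "order 0 (map_poly res h) = A"
  proof -
    have "monom u B + monom u' A = [:- 0, 1:] ^ A * (monom u (B - A) + [:u':])"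
      using AB by (simp add: monom_altdef algebra_simps flip: power_add)
    moreover have "\<not> [:- 0, 1:] dvd monom u (B - A) + [:u':]"
      using AB u by (simp add: dvd_iff_poly_eq_0 poly_monom power_0_left)
    ultimately show ?thesis unfolding red by (metis order_unique_lemma dvd_triv_left 
        dvd_times_left_cancel_iff power_Suc2 pCons_eq_0_iff power_not_zero zero_neq_one)
  qed
  moreover note card_integral_roots[OF S(1) scaled_split[OF \<rho>'(2), of s B, folded h_def] hO nz]
  ultimately have c: "card {i \<in> S. (i - z) / \<rho> \<in> val3} = B"
    "card {i \<in> S. (i - z) / \<rho> \<in> val3 \<and> res ((i - z) / \<rho>) = 0} = A" by metis+
  \<comment> \<open>Valuation exactly that of \<open>\<rho>\<close>: the \<open>3 * A\<close> roots
    of the reduction minus the \<open>A\<close> of them at 0.\<close>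
  have eq: "{t \<in> S. (t - z) / \<rho> \<in> val3 \<and> (t - z) / \<rho> \<notin> max3}
     = {i \<in> S. (i - z) / \<rho> \<in> val3} - {i \<in> S. (i - z) / \<rho> \<in> val3 \<and> res ((i - z) / \<rho>) = 0}"
    by (auto simp: res_eq_0_iff)
  show ?thesis unfolding eq using c S(1) by (subst card_Diff_subset) (auto simp: B_def)
qed

text \<open>The first segment of the Newton polygon, from height \<open>s + 1\<close> at \<open>0\<close> to \<open>(B, s)\<close>. The case
  \<open>s = r\<close>, \<open>B = 1\<close> is Hensel's lemma, where the height at \<open>0\<close> may be larger than \<open>s + 1\<close>.\<close>

lemma card_left_class:
  fixes s :: nat and c c' :: int
  defines "B \<equiv> 3 ^ (r - s)"
  assumes s: "s \<le> r" and \<rho>: "\<rho> ^ B = 3" and c: "a = 3 ^ (s + 1) * c" "b + \<epsilon> = 3 ^ (s + 1) * c'"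
  shows "card {t \<in> S. (t - z) / \<rho> \<in> val3} = B"
    and "of_int c' + of_int c * z \<notin> max3 \<Longrightarrow> card {t \<in> S. (t - z) / \<rho> \<in> val3 \<and> (t - z) / \<rho> \<notin> max3} = B"
proof -
  note \<rho>' = root_of_three_in_max3[OF \<rho>]
  have B: "B > 0" by (simp add: B_def)
  define h where "h = scaled s \<rho> B"
  have "3 ^ (s + 1) dvd a" by (simp add: c)
  hence lin: "inverse (3 ^ s * \<rho> ^ B) * (of_int a * \<rho> ^ 1) \<in> max3"
    by (rule linear_term[OF \<rho>]) (use B in \<open>simp add: algebra_simps\<close>)
  have max: "coeff h j \<in> max3" if j: "j \<noteq> 0" "j \<noteq> B" for j
  proof -
    have pos: "j > 0" using j by simp
    have "B * s + B < B * (r - multiplicity 3 j) + j"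
      using newton_bound_left[OF s, of j] pos j by (simp add: B_def)
    from binomial_term[OF \<rho> pos this] show ?thesis unfolding h_def coeff_scaled_pos[OF pos]
      by (rule max3_add) (use lin in auto)
  qed
  \<comment> \<open>As \<open>\<rho> ^ B = 3\<close>, the factor \<open>3 ^ (s + 1)\<close> cancels
    exactly; the residue of \<open>c' + c * z\<close> decides whether the height at 0 is
    \<open>s + 1\<close> or more.\<close>
  have c0: "coeff h 0 = of_int c' + of_int c * z"
  proof -
    have "of_int \<epsilon> + of_int b = (of_int (b + \<epsilon>) :: complex)" by simp
    hence eq: "of_int \<epsilon> + of_int b + of_int a * z = 3 ^ (s + 1) * (of_int c' + of_int c * z)"
      unfolding c by (simp add: c algebra_simps)
    show ?thesis unfolding h_def coeff_scaled_0 eq by (simp add: \<rho>)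
  qed
  have unitB: "coeff h B \<in> val3 - max3"
  proof -
    have "inverse (3 ^ s * \<rho> ^ B) * (of_nat (n choose B) * z ^ (n - B) * \<rho> ^ B) \<in> val3 - max3"
      using vertex_term[OF \<rho>'(2), of s] s unfolding B_def by simp
    thus ?thesis unfolding h_def using B lin max3_add max3_diff max3_in_val3 val3_closed(6)
      by (subst coeff_scaled_pos) (auto, metis add_diff_cancel_right')
  qed
  have c0O: "coeff h 0 \<in> val3" unfolding c0 by (intro val3_closed z)
  have hO: "coeff h i \<in> val3" for i
    using max[of i] unitB c0O by (cases "i = 0 \<or> i = B") (auto intro: max3_in_val3)
  define u u' where "u = res (coeff h B)" and "u' = res (coeff h 0)"
  have u: "u \<noteq> 0" using unitB by (auto simp: u_def res_eq_0_iff)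
  have red: "map_poly res h = monom u B + monom u' 0"
    using max B by (intro poly_eqI) (auto simp: coeff_map_poly u_def u'_def)
  have nz: "map_poly res h \<noteq> 0" using u B by (auto simp: red poly_eq_iff intro!: exI[of _ B])
  have deg: "degree (map_poly res h) = B" unfolding red using u B
    by (subst degree_add_eq_left) (auto simp: degree_monom_eq monom_0)
  note cards = card_integral_roots[OF S(1) scaled_split[OF \<rho>'(2), of s B, folded h_def] hO nz]
  show card: "card {t \<in> S. (t - z) / \<rho> \<in> val3} = B" using cards(1) deg by metis
  assume "of_int c' + of_int c * z \<notin> max3"
  hence "u' \<noteq> 0" using c0 c0O by (simp add: u'_def res_eq_0_iff)
  hence "order 0 (map_poly res h) = 0" using B by (intro order_0I) (simp add: red poly_monom power_0_left)
  hence c: "card {i \<in> S. (i - z) / \<rho> \<in> val3 \<and> res ((i - z) / \<rho>) = 0} = 0" using cards(2) by metis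
  have eq: "{t \<in> S. (t - z) / \<rho> \<in> val3 \<and> (t - z) / \<rho> \<notin> max3}
     = {i \<in> S. (i - z) / \<rho> \<in> val3} - {i \<in> S. (i - z) / \<rho> \<in> val3 \<and> res ((i - z) / \<rho>) = 0}"
    by (auto simp: res_eq_0_iff)
  show "card {t \<in> S. (t - z) / \<rho> \<in> val3 \<and> (t - z) / \<rho> \<notin> max3} = B"
    unfolding eq by (subst card_Diff_subset; (simp only: c card diff_zero)?) (use S(1) in auto)
qed

end

section \<open>Residues of the conjugates of a generator\<close>

lemma poly_shift_Suc: "poly_shift j q = pCons (coeff q j) (poly_shift (Suc j) q)"
  by (rule poly_eqI) (simp add: coeff_poly_shift coeff_pCons split: nat.split)

text \<open>\<open>poly_shift\<close> yields the Horner tails of q. In a valuation ring containing x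
  the claim is clear; otherwise \<open>inverse x\<close> is in the ring and each tail is the
  previous one minus a coefficient, divided by x, starting from 0. The leading coefficient of q is
  arbitrary, so x may be non-integral.\<close>

lemma horner_algebraic_int:
  fixes x :: "'a :: field_char_0"
  assumes "ipoly q x = 0"
  shows "algebraic_int (ipoly (poly_shift j q) x)"
  unfolding algebraic_int_iff_valuation_rings
proof (intro allI impI)
  fix V :: "'a set" assume V: "is_valuation_ring V"
  note VD = is_subringD[OF conjunct1[OF V[unfolded is_valuation_ring_def]]]
  have VS: "is_subring V" using V by (simp add: is_valuation_ring_def)
  show "ipoly (poly_shift j q) x \<in> V"
  proof (cases "x \<in> V")
    case True
    show ?thesis by (rule is_subring_poly_closed[OF VS _ True]) (simp add: coeff_map_poly VD(9))
  next
    case False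
    hence x: "inverse x \<in> V" "x \<noteq> 0" using V VD(1) by (auto simp: is_valuation_ring_def)
    show ?thesis
    proof (induction j)
      case 0
      have "poly_shift 0 q = q" by (rule poly_eqI) (simp add: coeff_poly_shift)
      thus ?case using assms VD(1) by simp
    next
      case (Suc j)
      have "ipoly (poly_shift j q) x = of_int (coeff q j) + x * ipoly (poly_shift (Suc j) q) x"
        by (subst poly_shift_Suc) (simp add: of_int_poly_pCons)
      hence "ipoly (poly_shift (Suc j) q) x = (ipoly (poly_shift j q) x - of_int (coeff q j)) * inverse x"
        using x by (simp add: field_simps)
      also have "\<dots> \<in> V" by (intro VD(3,4,9) Suc x)
      finally show ?case .
    qed
  qed
qed

lemma ipoly_algebraic_int:
  fixes x :: "'a :: field_char_0"
  assumes "algebraic_int x"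
  shows "algebraic_int (ipoly p x)"
proof -
  have "ipoly p x \<in> {x :: 'a. algebraic_int x}"
    by (rule is_subring_poly_closed[OF is_subring_algebraic_int]) (use assms in \<open>auto simp: coeff_map_poly\<close>)
  thus ?thesis by simp
qed

text \<open>Without its coefficients divisible by 3, a nonzero rest of r could be made monic,
  against minimality. Integer polynomials can thus play the part of polynomials over F_3 in a
  division with remainder.\<close>

lemma three_dvd_poly_if_minimal:
  fixes \<gamma> :: residue3
  assumes min: "\<And>p. lead_coeff p = 1 \<Longrightarrow> ipoly p \<gamma> = 0 \<Longrightarrow> degree p \<ge> d"
    and r: "ipoly r \<gamma> = 0" "degree r < d"
  shows "\<exists>t. r = smult 3 t"
proof -
  define r' where "r' = map_poly (\<lambda>c. if 3 dvd c then 0 else c) r"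
  have map_eq: "map_poly of_int r' = (map_poly of_int r :: residue3 poly)"
    by (rule poly_eqI) (auto simp: r'_def coeff_map_poly of_int_residue3_eq_0_iff)
  have "r' = 0"
  proof (rule ccontr)
    assume nz: "r' \<noteq> 0"
    define c where "c = lead_coeff r'"
    have "c \<noteq> 0" using nz by (simp add: c_def)
    hence "\<not> 3 dvd c" by (auto simp: c_def r'_def coeff_map_poly split: if_splits)
    hence "3 dvd 1 * c - 1 \<or> 3 dvd - 1 * c - 1" by presburger
    \<comment> \<open>Modulo 3 the leading coefficient is 1 or -1, so a sign makes it 1 up to a
      multiple of 3, which is then subtracted.\<close>
    then obtain s :: int where s: "s = 1 \<or> s = - 1" "3 dvd s * c - 1" by blast
    define r'' where "r'' = smult s r' - monom (s * c - 1) (degree r')"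
    have "coeff r'' (degree r') = 1" by (simp add: r''_def c_def)
    moreover have "degree r'' \<le> degree r'" unfolding r''_def
      by (intro degree_diff_le order.trans[OF degree_smult_le]) (auto simp: degree_monom_le)
    ultimately have r'': "lead_coeff r'' = 1" "degree r'' \<le> degree r'"
      using le_degree[of r'' "degree r'"] by auto
    have "of_int (s * c - 1) = (0 :: residue3)" using s(2) by (simp only: of_int_residue3_eq_0_iff)
    hence "ipoly r'' \<gamma> = of_int s * ipoly r' \<gamma>"
      unfolding r''_def of_int_poly_simps by simp
    hence "ipoly r'' \<gamma> = 0" using r(1) by (simp add: map_eq)
    from min[OF r''(1) this] have "d \<le> degree r'" using r''(2) by simp
    also have "degree r' \<le> degree r" unfolding r'_def by (rule map_poly_degree_leq)
    finally show False using r(2) by simp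
  qed
  hence "\<forall>i. coeff r' i = 0" by simp
  hence "\<And>i. 3 dvd coeff r i \<or> coeff r i = 0" by (simp add: r'_def coeff_map_poly split: if_splits)
  hence "\<forall>i. 3 dvd coeff r i" by (metis dvd_0_right)
  hence "[:3:] dvd r" by (simp add: const_poly_dvd_iff)
  thus ?thesis by (auto elim!: dvdE)
qed

text \<open>Here \<open>S\<close> is the set of all conjugates of a generator of the number field, \<open>\<eta> t\<close> is the conjugate
  over \<open>t\<close> of a generator of the ring of integers, and a field element is given by a rational polynomial,
  whose values at the points of \<open>S\<close> are its conjugates.\<close>

locale monogenic_conjugates =
  fixes S :: "complex set" and \<eta> :: "complex \<Rightarrow> complex" and G P :: "int poly"
  assumes fin: "finite S"
    and G: "map_poly of_int G = (\<Prod>t\<in>S. [:- \<eta> t, 1:])"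
    and P: "t \<in> S \<Longrightarrow> ipoly P (\<eta> t) = t"
    and integral_rep: "(\<And>t. t \<in> S \<Longrightarrow> algebraic_int (rpoly A t)) \<Longrightarrow> \<exists>B. \<forall>t\<in>S. rpoly A t = ipoly B (\<eta> t)"
    and alg: "\<exists>q. lead_coeff q = 1 \<and> (\<forall>t\<in>S. ipoly q (ipoly B t) = 0)"
begin

abbreviation \<gamma> :: "complex \<Rightarrow> residue3" where "\<gamma> t \<equiv> res (\<eta> t)"

lemma G_monic: "lead_coeff G = 1"
proof -
  have "of_int (lead_coeff G) = lead_coeff (map_poly of_int G :: complex poly)"
    by (simp add: coeff_map_poly degree_map_poly)
  also have "\<dots> = 1" unfolding G by (simp add: lead_coeff_prod)
  finally show ?thesis by (simp only: of_int_eq_1_iff)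
qed

lemma G_root: "t \<in> S \<Longrightarrow> ipoly G (\<eta> t) = 0"
  unfolding G using fin by (auto simp: poly_prod)

lemma \<eta>_algebraic_int: "t \<in> S \<Longrightarrow> algebraic_int (\<eta> t)"
  using G_root G_monic by (auto simp: algebraic_int_altdef_ipoly)

lemma \<eta>_val3 [simp]: "t \<in> S \<Longrightarrow> \<eta> t \<in> val3" using \<eta>_algebraic_int by auto

lemma conj_val3 [simp]: "t \<in> S \<Longrightarrow> t \<in> val3" using ipoly_in_val3[of "\<eta> t" P] P[of t] by simp

lemma res_conj: "t \<in> S \<Longrightarrow> res t = ipoly P (\<gamma> t)"
  using res_ipoly[of "\<eta> t" P] P[of t] by simp

lemma G_mod3: "map_poly of_int G = (\<Prod>t\<in>S. [:- \<gamma> t, 1:])"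
proof -
  have "map_poly of_int G = map_poly res (map_poly of_int G)"
    by (rule poly_eqI) (simp add: coeff_map_poly)
  also have "\<dots> = (\<Prod>t\<in>S. map_poly res [:- \<eta> t, 1:])" unfolding G
    by (rule conjunct1[OF map_poly_res_prod]) (auto simp: coeff_pCons val3_closed split: nat.split)
  also have "\<dots> = (\<Prod>t\<in>S. [:- \<gamma> t, 1:])" by (intro prod.cong) (auto simp: map_poly_pCons res_minus)
  finally show ?thesis .
qed

text \<open>The polynomials C that kill \<open>\<gamma> t\<close> form the kernel of the map from
  Z[x] to the residue field; equal kernels mean that t and t' induce the same prime of Z[eta] above
  3.\<close>

definition same_place :: "complex \<Rightarrow> complex \<Rightarrow> bool" where
  "same_place t t' \<longleftrightarrow> t \<in> S \<and> t' \<in> S \<and> (\<forall>C. ipoly C (\<gamma> t) = 0 \<longleftrightarrow> ipoly C (\<gamma> t') = 0)"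

text \<open>A monic annihilator \<open>q0\<close> of the values of B gives \<open>q0 (3 * x)\<close>
  for \<open>B / 3\<close>, and dividing by the content leaves a coefficient prime to 3. That
  coefficient later keeps numerator and denominator from both lying in \<open>max3\<close>.\<close>

lemma primitive_annihilator:
  obtains q where "\<And>t. t \<in> S \<Longrightarrow> ipoly q (ipoly B t / 3) = 0" "\<exists>j. \<not> 3 dvd coeff q j"
proof -
  obtain q0 where q0: "lead_coeff q0 = 1" "\<And>t. t \<in> S \<Longrightarrow> ipoly q0 (ipoly B t) = 0"
    using alg[of B] by blast
  define q1 where "q1 = pcompose q0 [:0, 3:]"
  have q1: "ipoly q1 (ipoly B t / 3) = 0" if "t \<in> S" for t
    using q0(2)[OF that] by (simp add: q1_def of_int_poly_simps poly_pcompose)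
  have "q0 \<noteq> 0" using q0(1) by auto
  hence nz: "q1 \<noteq> 0" by (auto simp: q1_def pcompose_eq_0_iff)
  define q where "q = primitive_part q1"
  have q: "q1 = smult (content q1) q" by (simp add: q_def)
  show ?thesis
  proof (rule that[of q])
    fix t assume "t \<in> S"
    from q1[OF this] show "ipoly q (ipoly B t / 3) = 0" using nz
      by (subst (asm) q) (simp add: of_int_poly_smult)
  next
    have "content q = 1" using nz by (simp add: q_def)
    hence "\<not> [:3:] dvd q" by (simp add: const_poly_dvd_iff_dvd_content)
    thus "\<exists>j. \<not> 3 dvd coeff q j" by (simp add: const_poly_dvd_iff)
  qed
qed

text \<open>A valuation ring of a number field is determined by its maximal ideal on the integers:
  every element is a quotient of two integers that do not both lie in that ideal.\<close>

lemma same_place_quotient: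
  fixes B :: "int poly"
  assumes "same_place t t'"
  defines "x \<equiv> \<lambda>t. ipoly B t / 3"
  shows "x t \<in> val3 \<longleftrightarrow> x t' \<in> val3" "x t \<in> max3 \<longleftrightarrow> x t' \<in> max3"
proof -
  have S: "t \<in> S" "t' \<in> S" using assms(1) by (auto simp: same_place_def)
  obtain q where q: "\<And>t. t \<in> S \<Longrightarrow> ipoly q (x t) = 0" "\<exists>j. \<not> 3 dvd coeff q j"
    unfolding x_def by (rule primitive_annihilator[of B]) blast
  \<comment> \<open>For each j both \<open>h (Suc j)\<close> and \<open>x * h (Suc j)\<close> are
    integral, so the Horner tails offer many ways to write x as a quotient of integers of the
    field.\<close>
  define h where "h = (\<lambda>j t. ipoly (poly_shift j q) (x t))"
  have rec: "h j u = of_int (coeff q j) + x u * h (Suc j) u" for j u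
    unfolding h_def by (subst poly_shift_Suc) (simp add: of_int_poly_pCons)
  have hint: "algebraic_int (h j u)" if "u \<in> S" for j u
    unfolding h_def by (rule horner_algebraic_int[OF q(1)[OF that]])
  have xhint: "algebraic_int (x u * h (Suc j) u)" if "u \<in> S" for j u
  proof -
    have "x u * h (Suc j) u = h j u - of_int (coeff q j)" by (simp add: rec[of j])
    moreover have "h j u - of_int (coeff q j) \<in> {x. algebraic_int x}"
      by (intro is_subringD(3,9)[OF is_subring_algebraic_int]) (simp add: hint that)
    ultimately show ?thesis by simp
  qed
  have rep: "\<exists>C. \<forall>u\<in>S. h j u = ipoly C (\<eta> u)" for j
  proof -
    define A where "A = pcompose (map_poly of_int (poly_shift j q)) (smult (1/3) (map_poly rat_of_int B))"
    have A: "rpoly A u = h j u" for u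
      by (simp add: A_def of_rat_poly_simps poly_pcompose h_def x_def of_rat_divide)
    show ?thesis using integral_rep[of A] by (simp add: A hint)
  qed
  have xrep: "\<exists>C. \<forall>u\<in>S. x u * h (Suc j) u = ipoly C (\<eta> u)" for j
  proof -
    obtain C where C: "\<forall>u\<in>S. h j u = ipoly C (\<eta> u)" using rep by blast
    have "x u * h (Suc j) u = ipoly (C - [:coeff q j:]) (\<eta> u)" if "u \<in> S" for u
    proof -
      have "x u * h (Suc j) u = h j u - of_int (coeff q j)" by (simp add: rec[of j u])
      also have "\<dots> = ipoly (C - [:coeff q j:]) (\<eta> u)" using C that by (simp add: of_int_poly_simps)
      finally show ?thesis .
    qed
    thus ?thesis by blast
  qed
  have transfer: "ipoly C (\<eta> t) \<in> max3 \<longleftrightarrow> ipoly C (\<eta> t') \<in> max3" for C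
    using assms(1) S unfolding same_place_def
    by (metis \<eta>_val3 ipoly_in_val3 res_eq_0_iff res_ipoly)
  \<comment> \<open>If all these pairs lay in \<open>max3\<close>, so would every coefficient of
    q.\<close>
  have "\<exists>j. \<not> (h (Suc j) t \<in> max3 \<and> x t * h (Suc j) t \<in> max3)"
  proof (rule ccontr)
    assume "\<not> ?thesis"
    hence *: "\<And>j. h (Suc j) t \<in> max3" "\<And>j. x t * h (Suc j) t \<in> max3" by auto
    have "poly_shift 0 q = q" by (rule poly_eqI) (simp add: coeff_poly_shift)
    hence "h 0 t = 0" using q(1)[OF S(1)] by (simp add: h_def)
    with *(1) have hm: "h j t \<in> max3" for j by (cases j) auto
    obtain j where j: "\<not> 3 dvd coeff q j" using q(2) by blast
    have "of_int (coeff q j) = h j t - x t * h (Suc j) t" by (simp add: rec[of j])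
    also have "\<dots> \<in> max3" by (intro max3_diff hm *)
    finally have "(of_int (coeff q j) :: residue3) = 0" by (metis res_max3 res_of_int)
    with j show False by (simp add: of_int_residue3_eq_0_iff)
  qed
  then obtain j where j: "\<not> (h (Suc j) t \<in> max3 \<and> x t * h (Suc j) t \<in> max3)" by blast
  define U where "U = h (Suc j)"
  obtain C where C: "\<forall>u\<in>S. U u = ipoly C (\<eta> u)" using rep unfolding U_def by blast
  obtain C' where C': "\<forall>u\<in>S. x u * U u = ipoly C' (\<eta> u)" using xrep unfolding U_def by blast
  have U: "U t \<in> max3 \<longleftrightarrow> U t' \<in> max3" "x t * U t \<in> max3 \<longleftrightarrow> x t' * U t' \<in> max3"
    using transfer C C' S by auto
  have UO: "U u \<in> val3" "x u * U u \<in> val3" if "u \<in> S" for u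
    using hint[OF that] xhint[OF that] by (auto simp: U_def)
  \<comment> \<open>Membership of x in \<open>val3\<close> and \<open>max3\<close> is read off from
    that of \<open>U\<close> and \<open>x * U\<close> in \<open>max3\<close>, which t and t'
    share.\<close>
  have crit: "(x u \<in> val3 \<longleftrightarrow> U u \<notin> max3) \<and> (x u \<in> max3 \<longleftrightarrow> U u \<notin> max3 \<and> x u * U u \<in> max3)"
    if u: "u \<in> S" "\<not> (U u \<in> max3 \<and> x u * U u \<in> max3)" for u
  proof (cases "U u \<in> max3")
    case True
    hence "x u \<notin> val3" using u max3_mult_left by blast
    thus ?thesis using True max3_in_val3 by blast
  next
    case False
    have i: "inverse (U u) \<in> val3" by (rule inverse_in_val3[OF UO(1)[OF u(1)] False])
    have x: "x u = (x u * U u) * inverse (U u)" using False by (cases "U u = 0") auto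
    have "x u \<in> val3" by (subst x) (rule val3_closed(4)[OF UO(2)[OF u(1)] i])
    moreover have "x u \<in> max3" if "x u * U u \<in> max3"
      by (subst x) (rule max3_mult_right[OF that i])
    moreover have "x u * U u \<in> max3" if "x u \<in> max3"
      by (rule max3_mult_right[OF that UO(1)[OF u(1)]])
    ultimately show ?thesis using False by blast
  qed
  show "x t \<in> val3 \<longleftrightarrow> x t' \<in> val3" "x t \<in> max3 \<longleftrightarrow> x t' \<in> max3"
    using crit[OF S(1)] crit[OF S(2)] U j unfolding U_def by blast+
qed

text \<open>Modulo \<open>3\<close>, both \<open>G\<close> and \<open>B\<close> (as polynomials in \<open>\<eta>\<close>) are divisible by the minimal polynomial \<open>g\<close> of
  \<open>\<gamma> t\<close>. If \<open>g\<^sup>i\<close> were the exact power in \<open>G\<close> for some \<open>i < e\<close>, then \<open>B\<^sup>i\<close> would be divisible by \<open>3\<close> at \<open>t\<close>.\<close>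

lemma le_multiplicity:
  assumes t: "t \<in> S" and z: "ipoly B t ^ e / 3 \<in> val3" "ipoly B t ^ e / 3 \<notin> max3" and e: "e > 0"
  shows "e \<le> card {t' \<in> S. \<gamma> t' = \<gamma> t}"
proof -
  let ?z = "ipoly B t"
  define R where "R = (\<lambda>p. lead_coeff p = 1 \<and> ipoly p (\<gamma> t) = 0)"
  have "R G" using G_root[OF t] G_monic res_ipoly[of "\<eta> t" G] t by (simp add: R_def)
  define g where "g = arg_min degree R"
  have g: "R g" and min: "\<And>p. R p \<Longrightarrow> degree g \<le> degree p" unfolding g_def
    by (rule arg_min_natI[of R, OF \<open>R G\<close>]) (rule arg_min_nat_le[of R])
  have g0: "g \<noteq> 0" using g by (auto simp: R_def)
  have div: "\<exists>Q T. C = g * Q + smult 3 T" if C: "ipoly C (\<gamma> t) = 0" for C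
  proof -
    \<comment> \<open>As g is monic, pseudo-division is true division with remainder.\<close>
    obtain Q r where Qr: "pseudo_divmod C g = (Q, r)" by (cases "pseudo_divmod C g")
    from pseudo_divmod[OF g0 Qr] have r: "C = g * Q + r" "r = 0 \<or> degree r < degree g"
      using g by (auto simp: R_def)
    have "ipoly r (\<gamma> t) = 0" using C g by (simp add: r(1) R_def of_int_poly_simps)
    moreover have "degree p \<ge> degree g" if "lead_coeff p = 1" "ipoly p (\<gamma> t) = 0" for p
      using min that by (simp add: R_def)
    ultimately have "\<exists>T. r = smult 3 T"
      using r(2) three_dvd_poly_if_minimal[of "\<gamma> t" "degree g" r] by (auto intro: exI[of _ 0])
    thus ?thesis using r(1) by blast
  qed
  \<comment> \<open>Since \<open>t\<close> is P at \<open>\<eta> t\<close>, this turns the value of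
    B at t into a value at \<open>\<eta> t\<close>.\<close>
  define Z where "Z = pcompose B P"
  have Z: "ipoly Z (\<eta> t) = ?z" by (simp add: Z_def of_int_poly_simps poly_pcompose P[OF t])
  have zO: "?z \<in> val3" using ipoly_in_val3[of t B] t by simp
  have "?z ^ e = 3 * (?z ^ e / 3)" by simp
  also have "\<dots> \<in> max3" by (intro max3_mult_right z) simp
  finally have "res ?z ^ e = 0" by (simp flip: res_power[OF zO])
  hence "res ?z = 0" by simp
  hence zm: "?z \<in> max3" using res_eq_0_iff[OF zO] by simp
  have "ipoly Z (\<gamma> t) = 0" using res_ipoly[of "\<eta> t" Z] t \<open>res ?z = 0\<close> by (simp add: Z)
  then obtain Q T where QT: "Z = g * Q + smult 3 T" using div by blast
  have "\<exists>h T. G = g ^ i * h + smult 3 T" if "i \<le> e" for i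
    using that
  proof (induction i)
    case 0
    show ?case by (rule exI[of _ G], rule exI[of _ 0]) simp
  next
    case (Suc i)
    then obtain h T' where h: "G = g ^ i * h + smult 3 T'" by auto
    have "ipoly h (\<gamma> t) = 0"
    proof (rule ccontr)
      assume "ipoly h (\<gamma> t) \<noteq> 0"
      hence nh: "ipoly h (\<eta> t) \<notin> max3"
        using res_ipoly[of "\<eta> t" h] t by (metis \<eta>_val3 res_max3)
      have "Z - g * Q = [:3:] * T" by (simp add: QT)
      hence "[:3:] dvd Z - g * Q" by (metis dvd_triv_left)
      also have "\<dots> dvd Z ^ i - (g * Q) ^ i"
        by (simp add: power_diff_sumr2)
      finally obtain T'' where T'': "Z ^ i = (g * Q) ^ i + smult 3 T''" by (auto elim!: dvdE simp: algebra_simps)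
      \<comment> \<open>Modulo 3, \<open>Z ^ i * h\<close> is a multiple of G, which vanishes at
        \<open>\<eta> t\<close>. If h is a unit there, \<open>?z ^ i / 3\<close> is integral
        although \<open>i < e\<close>, against the valuation 1/e of \<open>?z\<close>.\<close>
      have "Z ^ i * h = G * Q ^ i + smult 3 (T'' * h - T' * Q ^ i)"
        by (simp add: h T'' power_mult_distrib algebra_simps smult_diff_right)
      hence "ipoly (Z ^ i * h) (\<eta> t) = 3 * ipoly (T'' * h - T' * Q ^ i) (\<eta> t)"
        using G_root[OF t] by (simp add: of_int_poly_simps)
      moreover have "ipoly (Z ^ i * h) (\<eta> t) = ?z ^ i * ipoly h (\<eta> t)"
        by (simp add: of_int_poly_mult of_int_poly_power Z)
      ultimately have eq: "?z ^ i * ipoly h (\<eta> t) = 3 * ipoly (T'' * h - T' * Q ^ i) (\<eta> t)" by simp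
      have "?z ^ i / 3 = ipoly (T'' * h - T' * Q ^ i) (\<eta> t) * inverse (ipoly h (\<eta> t))"
        using eq nh by (cases "ipoly h (\<eta> t) = 0") (auto simp: field_simps)
      also have "\<dots> \<in> val3"
        using t nh by (intro val3_closed ipoly_in_val3 inverse_in_val3) auto
      finally have "?z ^ i / 3 \<in> val3" .
      moreover have "?z ^ (e - i) \<in> max3" using Suc.prems by (intro max3_power zm) auto
      ultimately have "?z ^ (e - i) * (?z ^ i / 3) \<in> max3" by (rule max3_mult_right[rotated])
      moreover have "?z ^ (e - i) * (?z ^ i / 3) = ?z ^ e / 3"
        using Suc.prems by (simp flip: power_add)
      ultimately show False using z(2) by simp
    qed
    then obtain Q' T'' where "h = g * Q' + smult 3 T''" using div by blast
    hence "G = g ^ Suc i * Q' + smult 3 (g ^ i * T'' + T')" by (simp add: h algebra_simps smult_add_right)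
    thus ?case by blast
  qed
  then obtain h T' where h: "G = g ^ e * h + smult 3 T'" by blast
  have "map_poly of_int G = map_poly of_int g ^ e * (map_poly of_int h :: residue3 poly)"
    unfolding h of_int_poly_simps by simp
  moreover have "[:- \<gamma> t, 1:] dvd map_poly of_int g" using g by (simp add: R_def poly_eq_0_iff_dvd)
  ultimately have "[:- \<gamma> t, 1:] ^ e dvd map_poly of_int G"
    by (simp add: dvd_power_same)
  hence "e \<le> order (\<gamma> t) (map_poly of_int G)"
    by (subst (asm) order_divides) (use fin in \<open>simp add: G_mod3\<close>)
  thus ?thesis unfolding G_mod3 by (simp add: order_prod_linear[OF fin])
qed

section \<open>Frobenius and the residue attached to a class\<close>

lemma ipoly_frobenius: "ipoly C ((x :: residue3) ^ 3 ^ f) = ipoly C x ^ 3 ^ f"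
proof (induction f)
  case (Suc f)
  have "ipoly C (x ^ 3 ^ Suc f) = ipoly C ((x ^ 3 ^ f) ^ 3)" by (simp add: mult.commute flip: power_mult)
  also have "\<dots> = (ipoly C x ^ 3 ^ f) ^ 3" by (simp only: ipoly_cube_residue3 Suc)
  also have "\<dots> = ipoly C x ^ 3 ^ Suc f" by (simp add: mult.commute flip: power_mult)
  finally show ?case .
qed simp

text \<open>Conjugates with the same \<open>\<gamma>\<close> as t share its place and, through P,
  its residue, so \<open>closed\<close> puts them into C. By \<open>large\<close> there are at least
  \<open>card C\<close> of them, so they fill C.\<close>

lemma residue_constant_on_class:
  assumes C: "C \<subseteq> S" "C \<noteq> {}"
    and closed: "\<And>t t'. t \<in> C \<Longrightarrow> same_place t t' \<Longrightarrow> res t' = \<zeta> \<Longrightarrow> t' \<in> C"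
    and large: "\<And>t. t \<in> C \<Longrightarrow> card C \<le> card {t' \<in> S. \<gamma> t' = \<gamma> t}"
    and \<zeta>: "\<And>t. t \<in> C \<Longrightarrow> res t = \<zeta>" "\<zeta> ^ 3 ^ f = \<zeta>"
  obtains g where "\<And>t. t \<in> C \<Longrightarrow> \<gamma> t = g" "g ^ 3 ^ f = g" "ipoly P g = \<zeta>"
proof -
  obtain t where t: "t \<in> C" using C(2) by blast
  have finC: "finite C" using C(1) fin finite_subset by blast
  have tS: "t \<in> S" using t C(1) by blast
  have PS: "ipoly P (\<gamma> t) = \<zeta>" using res_conj[OF tS] \<zeta>(1)[OF t] by simp
  have "{t' \<in> S. \<gamma> t' = \<gamma> t} \<subseteq> C"
  proof
    fix t' assume "t' \<in> {t' \<in> S. \<gamma> t' = \<gamma> t}"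
    hence "t' \<in> S" "\<gamma> t' = \<gamma> t" by auto
    thus "t' \<in> C" using closed[OF t, of t'] tS PS by (simp add: same_place_def res_conj)
  qed
  hence eq: "{t' \<in> S. \<gamma> t' = \<gamma> t} = C" using large[OF t] finC by (simp add: card_seteq)
  have "ipoly G (\<gamma> t) = 0" using fin tS unfolding G_mod3 by (auto simp: poly_prod)
  \<comment> \<open>The Frobenius power is again a root of G and has the same integer annihilators;
    the conjugate t' it comes from is therefore in C, where only one residue occurs.\<close>
  hence "ipoly G (\<gamma> t ^ 3 ^ f) = 0" by (simp add: ipoly_frobenius)
  then obtain t' where t': "t' \<in> S" "\<gamma> t' = \<gamma> t ^ 3 ^ f" using fin unfolding G_mod3
    by (auto simp: poly_prod)
  have "same_place t t'" using tS t' by (simp add: same_place_def ipoly_frobenius)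
  moreover have "res t' = \<zeta>" using t' PS \<zeta>(2) by (simp add: res_conj ipoly_frobenius)
  ultimately have "t' \<in> C" by (rule closed[OF t])
  hence "\<gamma> t' = \<gamma> t" using eq by auto
  thus ?thesis using that[of "\<gamma> t"] eq t'(2) PS by auto
qed

text \<open>With \<open>z\<close> the zero of \<open>x\<^sup>N - \<epsilon>\<close> that has residue \<open>\<zeta>\<close>, these are the roots \<open>t\<close> for which \<open>t - z\<close> has
  \<open>3\<close>-adic valuation \<open>1/e\<close> (at least \<open>1\<close> if \<open>e = 1\<close>).\<close>

definition place_class :: "nat \<Rightarrow> int \<Rightarrow> residue3 \<Rightarrow> nat \<Rightarrow> complex set" where
  "place_class N \<epsilon> \<zeta> e = {t \<in> S. res t = \<zeta> \<and> (t ^ N - of_int \<epsilon>) ^ e / 3 \<in> val3 \<and>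
     (e = 1 \<or> (t ^ N - of_int \<epsilon>) ^ e / 3 \<notin> max3)}"

lemma ipoly_power_minus: "ipoly (monom 1 N - [:\<epsilon>:]) (t :: complex) = t ^ N - of_int \<epsilon>"
  by (simp add: of_int_poly_simps poly_monom)

text \<open>The valuation conditions concern values of an integer polynomial divided by 3, hence
  elements of the field, and so depend only on the place. Conditions on \<open>t - z\<close> would
  not have this form.\<close>

lemma place_class_closed:
  assumes "t \<in> place_class N \<epsilon> \<zeta> e" "same_place t t'" "res t' = \<zeta>"
  shows "t' \<in> place_class N \<epsilon> \<zeta> e"
proof -
  have "ipoly ((monom 1 N - [:\<epsilon>:]) ^ e) t / 3 = (t ^ N - of_int \<epsilon>) ^ e / 3" for t :: complex
    by (simp only: of_int_poly_power poly_power ipoly_power_minus)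
  with same_place_quotient[OF assms(2), of "(monom 1 N - [:\<epsilon>:]) ^ e"] assms show ?thesis
    by (auto simp: place_class_def same_place_def)
qed

lemma place_class_disjoint:
  assumes "t \<in> place_class N \<epsilon> \<zeta> e" "t \<in> place_class N \<epsilon> \<zeta>' e'" "e > 0" "e' > 0"
  shows "\<zeta> = \<zeta>' \<and> e = e'"
proof -
  have *: False if t: "t \<in> place_class N \<epsilon> \<zeta> e" "t \<in> place_class N \<epsilon> \<zeta>' e'" and e: "e > 0" "e < e'" for e e' \<zeta> \<zeta>'
  proof -
    define z where "z = t ^ N - of_int \<epsilon>"
    \<comment> \<open>\<open>e' > e > 0\<close> rules out \<open>e' = 1\<close>, so the exactness
      condition is available for \<open>e'\<close>.\<close>
    have z: "z ^ e / 3 \<in> val3" "z ^ e' / 3 \<notin> max3" using t e by (auto simp: place_class_def z_def)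
    have "t \<in> S" using t by (simp add: place_class_def)
    hence zO: "z \<in> val3" unfolding z_def by (intro val3_closed) auto
    have "z ^ e = 3 * (z ^ e / 3)" by simp
    also have "\<dots> \<in> max3" by (intro max3_mult_right z) simp
    finally have "res z ^ e = 0" by (simp flip: res_power[OF zO])
    hence "z \<in> max3" using res_eq_0_iff[OF zO] by simp
    hence "z ^ (e' - e) * (z ^ e / 3) \<in> max3" using e by (intro max3_mult_right max3_power z) auto
    also have "z ^ (e' - e) * (z ^ e / 3) = z ^ e' / 3" using e by (simp flip: power_add)
    finally show False using z(2) by simp
  qed
  have "\<zeta> = \<zeta>'" using assms by (simp add: place_class_def)
  moreover have "e = e'" using *[OF assms(1,2)] *[OF assms(2,1)] assms(3,4) by (metis nat_neq_iff)
  ultimately show ?thesis by simp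
qed

lemma place_class_residue:
  assumes card: "card (place_class N \<epsilon> \<zeta> e) = e" and e: "e > 0" and \<zeta>: "\<zeta> ^ 3 ^ f = \<zeta>"
  obtains g where "\<And>t. t \<in> place_class N \<epsilon> \<zeta> e \<Longrightarrow> \<gamma> t = g" "g ^ 3 ^ f = g" "ipoly P g = \<zeta>"
proof (rule residue_constant_on_class[of "place_class N \<epsilon> \<zeta> e" \<zeta> f])
  show "place_class N \<epsilon> \<zeta> e \<subseteq> S" by (auto simp: place_class_def)
  show "place_class N \<epsilon> \<zeta> e \<noteq> {}" using card e by auto
  show "\<And>t t'. t \<in> place_class N \<epsilon> \<zeta> e \<Longrightarrow> same_place t t' \<Longrightarrow> res t' = \<zeta> \<Longrightarrow> t' \<in> place_class N \<epsilon> \<zeta> e"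
    by (rule place_class_closed)
  show "\<zeta> ^ 3 ^ f = \<zeta>" by fact
  fix t assume t: "t \<in> place_class N \<epsilon> \<zeta> e"
  thus "res t = \<zeta>" by (simp add: place_class_def)
  have tS: "t \<in> S" using t by (simp add: place_class_def)
  show "card (place_class N \<epsilon> \<zeta> e) \<le> card {t' \<in> S. \<gamma> t' = \<gamma> t}"
  \<comment> \<open>For \<open>e = 1\<close> the class gives no exact valuation, but the bound 1 is
    trivial since t itself is counted.\<close>
  proof (cases "e = 1")
    case True
    have "card {t' \<in> S. \<gamma> t' = \<gamma> t} > 0" using fin tS by (auto simp: card_gt_0_iff)
    thus ?thesis using card True by simp
  next
    case False
    show ?thesis unfolding card
      by (rule le_multiplicity[of t "monom 1 N - [:\<epsilon>:]"])
         (use t False e tS in \<open>auto simp: ipoly_power_minus place_class_def simp del: of_int_poly_simps\<close>)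
  qed
qed (rule that)

text \<open>Members of two classes with equal \<open>\<gamma>\<close> share the place and, through
  P, the residue of t, so one of them would lie in both classes.\<close>

lemma inj_on_place_residues:
  assumes E: "\<And>\<zeta> e. (\<zeta>, e) \<in> E \<Longrightarrow> e > 0 \<and> card (place_class N \<epsilon> \<zeta> e) = e \<and> \<zeta> ^ 3 ^ f = \<zeta>"
  obtains g where "inj_on g E" "\<And>\<zeta> e. (\<zeta>, e) \<in> E \<Longrightarrow> g (\<zeta>, e) ^ 3 ^ f = g (\<zeta>, e) \<and> ipoly P (g (\<zeta>, e)) = \<zeta>"
proof -
  have "\<exists>g. \<forall>x\<in>E. (\<forall>t\<in>place_class N \<epsilon> (fst x) (snd x). \<gamma> t = g x) \<and> g x ^ 3 ^ f = g x \<and> ipoly P (g x) = fst x"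
  proof (intro bchoice ballI)
    fix x assume "x \<in> E"
    hence x: "snd x > 0" "card (place_class N \<epsilon> (fst x) (snd x)) = snd x" "fst x ^ 3 ^ f = fst x"
      using E[of "fst x" "snd x"] by auto
    show "\<exists>y. (\<forall>t\<in>place_class N \<epsilon> (fst x) (snd x). \<gamma> t = y) \<and> y ^ 3 ^ f = y \<and> ipoly P y = fst x"
      by (rule place_class_residue[OF x(2,1,3)]) blast
  qed
  then obtain g where g: "\<And>x. x \<in> E \<Longrightarrow> \<forall>t\<in>place_class N \<epsilon> (fst x) (snd x). \<gamma> t = g x"
    "\<And>x. x \<in> E \<Longrightarrow> g x ^ 3 ^ f = g x \<and> ipoly P (g x) = fst x" by blast
  have "inj_on g E"
  proof (rule inj_onI)
    fix x y assume xy: "x \<in> E" "y \<in> E" "g x = g y"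
    have "place_class N \<epsilon> (fst x) (snd x) \<noteq> {}" "place_class N \<epsilon> (fst y) (snd y) \<noteq> {}"
      using E[of "fst x" "snd x"] E[of "fst y" "snd y"] xy by auto
    then obtain t t' where t: "t \<in> place_class N \<epsilon> (fst x) (snd x)" "t' \<in> place_class N \<epsilon> (fst y) (snd y)" by blast
    hence tS: "t \<in> S" "t' \<in> S" by (auto simp: place_class_def)
    have eq: "\<gamma> t = \<gamma> t'" using g(1) xy t by metis
    have "same_place t t'" using tS eq by (simp add: same_place_def)
    moreover have "res t' = fst x" using t(1) tS eq by (simp add: place_class_def res_conj)
    ultimately have "t' \<in> place_class N \<epsilon> (fst x) (snd x)" by (rule place_class_closed[OF t(1)])
    hence "fst x = fst y \<and> snd x = snd y"
      by (rule place_class_disjoint[OF _ t(2)]) (use E[of "fst x" "snd x"] E[of "fst y" "snd y"] xy in auto)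
    thus "x = y" by (simp add: prod_eq_iff)
  qed
  with g(2) show ?thesis by (intro that[of g]) force+
qed

theorem at_most_three_places_of_degree_1:
  assumes "\<And>\<zeta> e. (\<zeta>, e) \<in> E \<Longrightarrow> e > 0 \<and> card (place_class N \<epsilon> \<zeta> e) = e \<and> \<zeta> ^ 3 = \<zeta>"
  shows "card E \<le> 3"
proof -
  obtain g where g: "inj_on g E" "\<And>\<zeta> e. (\<zeta>, e) \<in> E \<Longrightarrow> g (\<zeta>, e) ^ 3 ^ 1 = g (\<zeta>, e) \<and> ipoly P (g (\<zeta>, e)) = \<zeta>"
  proof (rule inj_on_place_residues[of E N \<epsilon> 1])
    show "0 < e \<and> card (place_class N \<epsilon> \<zeta> e) = e \<and> \<zeta> ^ 3 ^ 1 = \<zeta>" if "(\<zeta>, e) \<in> E" for \<zeta> e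
      using assms[OF that] by simp
  qed blast
  define p where "p = (monom 1 3 - monom 1 1 :: residue3 poly)"
  have "coeff p 3 = 1" by (simp add: p_def)
  hence p: "p \<noteq> 0" by auto
  have "degree p \<le> 3" unfolding p_def by (intro degree_diff_le) (auto intro: order.trans[OF degree_monom_le])
  have "g ` E \<subseteq> {x. poly p x = 0}" using g(2) by (auto simp: p_def poly_monom)
  hence "card (g ` E) \<le> card {x. poly p x = 0}" by (intro card_mono poly_roots_finite p)
  also have "\<dots> \<le> degree p" by (rule card_poly_roots_bound[OF p])
  finally show ?thesis using \<open>degree p \<le> 3\<close> by (simp add: card_image[OF g(1)])
qed

theorem at_most_six_places_of_degree_2:
  assumes "\<And>\<zeta> e. (\<zeta>, e) \<in> E \<Longrightarrow> e > 0 \<and> card (place_class N \<epsilon> \<zeta> e) = e \<and> \<zeta> ^ 9 = \<zeta> \<and> \<zeta> ^ 3 \<noteq> \<zeta>"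
  shows "card E \<le> 6"
proof -
  obtain g where g: "inj_on g E" "\<And>\<zeta> e. (\<zeta>, e) \<in> E \<Longrightarrow> g (\<zeta>, e) ^ 3 ^ 2 = g (\<zeta>, e) \<and> ipoly P (g (\<zeta>, e)) = \<zeta>"
  proof (rule inj_on_place_residues[of E N \<epsilon> 2])
    show "0 < e \<and> card (place_class N \<epsilon> \<zeta> e) = e \<and> \<zeta> ^ 3 ^ 2 = \<zeta>" if "(\<zeta>, e) \<in> E" for \<zeta> e
      using assms[OF that] by simp
  qed blast
  \<comment> \<open>This is \<open>(x ^ 9 - x) / (x ^ 3 - x)\<close>, whose roots are the elements
    of F_9 outside F_3.\<close>
  define p where "p = (monom 1 6 + monom 1 4 + monom 1 2 + 1 :: residue3 poly)"
  have "coeff p 6 = 1" by (simp add: p_def)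
  hence p: "p \<noteq> 0" by auto
  have "degree p \<le> 6" unfolding p_def by (intro degree_add_le) (auto intro: order.trans[OF degree_monom_le])
  have "g ` E \<subseteq> {x. poly p x = 0}"
  proof
    fix x assume "x \<in> g ` E"
    then obtain \<zeta> e where x: "x = g (\<zeta>, e)" "(\<zeta>, e) \<in> E" by auto
    have x9: "x ^ 9 = x" and Px: "ipoly P x = \<zeta>" using g(2)[OF x(2)] x(1) by auto
    \<comment> \<open>An x in F_3 would put \<open>\<zeta>\<close>, the value of P at x, into
      F_3.\<close>
    have x3: "x ^ 3 \<noteq> x"
    proof
      assume "x ^ 3 = x"
      hence "\<zeta> ^ 3 = \<zeta>" using ipoly_cube_residue3[of P x] Px by simp
      thus False using assms[OF x(2)] by simp
    qed
    have "(x ^ 3 - x) * (x ^ 6 + x ^ 4 + x ^ 2 + 1) = x ^ 9 - x" by (simp add: eval_nat_numeral algebra_simps)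
    hence "x ^ 6 + x ^ 4 + x ^ 2 + 1 = 0" using x9 x3 by simp
    thus "x \<in> {x. poly p x = 0}" by (simp add: p_def poly_monom)
  qed
  hence "card (g ` E) \<le> card {x. poly p x = 0}" by (intro card_mono poly_roots_finite p)
  also have "\<dots> \<le> degree p" by (rule card_poly_roots_bound[OF p])
  finally show ?thesis using \<open>degree p \<le> 6\<close> by (simp add: card_image[OF g(1)])
qed

text \<open>On the residue class of \<open>z\<close>, the numbers \<open>t\<^sup>N - \<epsilon> = t\<^sup>N - z\<^sup>N\<close> and \<open>t - z\<close> differ by a unit,
  since \<open>x\<^sup>N - \<epsilon>\<close> is separable modulo \<open>3\<close>.\<close>

lemma place_class_eq:
  assumes z: "z \<in> val3" "z \<notin> max3" "z ^ N = of_int \<epsilon>" and N: "\<not> 3 dvd N" and \<rho>: "\<rho> ^ e = 3"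
  shows "place_class N \<epsilon> (res z) e =
    {t \<in> S. (t - z) / \<rho> \<in> val3 \<and> (e = 1 \<or> (t - z) / \<rho> \<notin> max3)}"
proof -
  note \<rho>' = root_of_three_in_max3[OF \<rho>]
  have e: "e > 0" using \<rho> by (intro Nat.gr0I) auto
  have N0: "N > 0" using N by (intro Nat.gr0I) auto
  have "t \<in> place_class N \<epsilon> (res z) e \<longleftrightarrow> (t - z) / \<rho> \<in> val3 \<and> (e = 1 \<or> (t - z) / \<rho> \<notin> max3)"
    if t: "t \<in> S" for t
  proof -
    have tO: "t \<in> val3" using t by simp
    define Y where "Y = (t - z) / \<rho>"
    have Yres: "res t = res z" if "Y \<in> val3"
    proof -
      have "t = z + \<rho> * Y" using \<rho>'(2) by (simp add: Y_def)
      moreover have "\<rho> * Y \<in> max3" by (rule max3_mult_right[OF \<rho>'(1) that])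
      ultimately show ?thesis using z(1) by (simp add: res_add max3_in_val3)
    qed
    have main: "(t ^ N - of_int \<epsilon>) ^ e / 3 \<in> val3 \<longleftrightarrow> Y \<in> val3"
        "(t ^ N - of_int \<epsilon>) ^ e / 3 \<in> max3 \<longleftrightarrow> Y \<in> max3" if eq: "res t = res z"
    proof -
      \<comment> \<open>The cofactor in \<open>t ^ N - z ^ N = (t - z) * w\<close>; all its N
        summands have the same residue, which yields \<open>N * z ^ (N - 1)\<close>, nonzero modulo
        3.\<close>
      define w where "w = (\<Sum>i<N. z ^ (N - Suc i) * t ^ i)"
      have "t ^ N - of_int \<epsilon> = (t - z) * w"
        unfolding w_def z(3)[symmetric] by (rule power_diff_sumr2[THEN trans]) (simp add: mult.commute)
      also have "\<dots> = \<rho> * (Y * w)" using \<rho>'(2) by (simp add: Y_def)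
      finally have x: "(t ^ N - of_int \<epsilon>) ^ e / 3 = (Y * w) ^ e" by (simp add: power_mult_distrib \<rho>)
      have wO: "w \<in> val3" unfolding w_def by (intro val3_closed z tO)
      have "res w = (\<Sum>i<N. res z ^ (N - 1))" unfolding w_def
      proof (subst res_sum)
        show "(\<Sum>i<N. res (z ^ (N - Suc i) * t ^ i)) = (\<Sum>i<N. res z ^ (N - 1))"
          using z tO eq by (intro sum.cong refl) (simp add: res_mult res_power val3_closed flip: power_add)
      qed (intro val3_closed z tO)
      also have "\<dots> = of_nat N * res z ^ (N - 1)" by simp
      also have "of_nat N \<noteq> (0 :: residue3)"
        using N of_int_residue3_eq_0_iff[of "int N"] by (simp add: int_dvd_int_iff[of 3, simplified])
      hence "of_nat N * res z ^ (N - 1) \<noteq> 0" using z by (simp add: res_eq_0_iff)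
      finally have w: "w \<notin> max3" by auto
      hence w0: "w \<noteq> 0" by auto
      have iw: "inverse w \<in> val3" by (rule inverse_in_val3[OF wO w])
      have Y: "Y = (Y * w) * inverse w" using w0 by simp
      have YO: "Y * w \<in> val3 \<longleftrightarrow> Y \<in> val3" using Y wO iw val3_closed(4) by metis
      have Ym: "Y * w \<in> max3 \<longleftrightarrow> Y \<in> max3" using Y wO iw max3_mult_right by metis
      have pm: "y ^ e \<in> max3 \<longleftrightarrow> y \<in> max3" for y
        using e val3_power_iff[OF e, of y] res_power[of y e] res_eq_0_iff
        by (metis max3_in_val3 power_eq_0_iff)
      show "(t ^ N - of_int \<epsilon>) ^ e / 3 \<in> val3 \<longleftrightarrow> Y \<in> val3" unfolding x using e YO by simp
      show "(t ^ N - of_int \<epsilon>) ^ e / 3 \<in> max3 \<longleftrightarrow> Y \<in> max3" unfolding x pm Ym ..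
    qed
    show ?thesis using Yres main t unfolding place_class_def Y_def by blast
  qed
  moreover have "place_class N \<epsilon> (res z) e \<subseteq> S" by (auto simp: place_class_def)
  ultimately show ?thesis by blast
qed

end

section \<open>Counting places above 3\<close>

lemma one_neq_minus_one_residue3: "(1 :: residue3) \<noteq> - 1"
proof
  assume "(1 :: residue3) = - 1"
  hence "of_int 2 = (0 :: residue3)" by (simp add: eq_neg_iff_add_eq_0)
  thus False unfolding of_int_residue3_eq_0_iff by simp
qed

lemma neq_minus_residue3: "(x :: residue3) \<noteq> 0 \<Longrightarrow> x \<noteq> - x"
  using one_neq_minus_one_residue3 by (metis mult_cancel_left1 mult_minus_right mult.right_neutral)

text \<open>Outside F_3, w and 1 are linearly independent over F_3. The height at 0 is thereby exact
  at all such residues at once.\<close>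

lemma linear_residue3_neq_0:
  assumes "(w :: residue3) ^ 3 \<noteq> w" and c: "\<not> (3 dvd c \<and> 3 dvd c')"
  shows "of_int c' + of_int c * w \<noteq> 0"
proof
  assume eq: "of_int c' + of_int c * w = 0"
  show False
  proof (cases "of_int c = (0 :: residue3)")
    case True
    with eq have "of_int c' = (0 :: residue3)" by simp
    with True c show False by (simp add: of_int_residue3_eq_0_iff)
  next
    case False
    hence "w = of_int (- c') / of_int c" using eq by (simp add: field_simps eq_neg_iff_add_eq_0 add.commute)
    hence "w ^ 3 = w" by (simp only: power_divide cube_of_int_residue3)
    with assms(1) show False by simp
  qed
qed

lemma exists_root_of_three:
  assumes "e > 0"
  obtains \<rho> :: complex where "\<rho> ^ e = 3"
proof (rule that[of "of_real (root e 3)"])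
  have "root e 3 ^ e = 3" using assms by simp
  thus "complex_of_real (root e 3) ^ e = 3" by (simp flip: of_real_power)
qed

section \<open>Residues of roots of unity of order 4 and 8\<close>

lemma residue_ii: "res \<i> ^ 2 = - 1" "z \<in> {\<i>, - \<i>} \<Longrightarrow> res z ^ 9 = res z \<and> res z ^ 3 \<noteq> res z"
  "card (res ` {\<i>, - \<i>}) = 2" "z \<in> {\<i>, - \<i>} \<Longrightarrow> z \<in> val3 \<and> z \<notin> max3"
proof -
  have i: "\<i> \<in> val3" by auto
  show j: "res \<i> ^ 2 = - 1" using res_power[OF i, of 2] res_minus[of 1] by simp
  define j where "j = res \<i>"
  have m: "res (- \<i>) = - j" using res_minus[OF i] by (simp add: j_def)
  have j0: "j \<noteq> 0" using j by (auto simp: j_def)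
  have j3: "j ^ 3 = - j" using j by (simp add: j_def power3_eq_cube power2_eq_square)
  have "j ^ 9 = (j ^ 3) ^ 3" by (simp flip: power_mult)
  also have "\<dots> = j" by (simp add: j3)
  finally have j9: "j ^ 9 = j" .
  have ne: "j \<noteq> - j" by (rule neq_minus_residue3[OF j0])
  show "card (res ` {\<i>, - \<i>}) = 2" using ne by (simp add: m flip: j_def)
  assume z: "z \<in> {\<i>, - \<i>}"
  show "res z ^ 9 = res z \<and> res z ^ 3 \<noteq> res z"
    using z j3 j9 ne m by (auto simp flip: j_def)
  have "res z \<noteq> 0" using z m j0 by (auto simp flip: j_def)
  thus "z \<in> val3 \<and> z \<notin> max3" using z i by (auto intro: val3_closed)
qed

definition \<omega> :: complex where "\<omega> = csqrt \<i>"

text \<open>The primitive eighth roots of unity: as \<open>\<omega> ^ 4 = - 1\<close>, the negatives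
  are the fifth and seventh powers.\<close>

definition \<Omega> :: "complex set" where "\<Omega> = {\<omega>, \<omega> ^ 3, - \<omega>, - (\<omega> ^ 3)}"

lemma \<omega>: "\<omega> ^ 4 = - 1" "\<omega> \<in> val3"
proof -
  have "\<omega> ^ 4 = (\<omega> ^ 2) ^ 2" by (simp flip: power_mult)
  also have "\<omega> ^ 2 = \<i>" unfolding \<omega>_def by (rule power2_csqrt)
  finally show "\<omega> ^ 4 = - 1" by simp
  thus "\<omega> \<in> val3" using val3_power_iff[of 4 \<omega>] val3_closed(5)[of 1] by simp
qed

lemma \<Omega>: "z \<in> \<Omega> \<Longrightarrow> res z ^ 9 = res z \<and> res z ^ 3 \<noteq> res z" "card (res ` \<Omega>) = 4"
  "z \<in> \<Omega> \<Longrightarrow> z \<in> val3 \<and> z \<notin> max3" "z \<in> \<Omega> \<Longrightarrow> z ^ 4 = - 1"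
proof -
  define w where "w = res \<omega>"
  have w4: "w ^ 4 = - 1" using res_power[OF \<omega>(2), of 4] res_minus[of 1] \<omega>(1) by (simp add: w_def)
  have res: "res (\<omega> ^ 3) = w ^ 3" "res (- \<omega>) = - w" "res (- (\<omega> ^ 3)) = - (w ^ 3)"
    using \<omega>(2) by (simp_all add: res_minus res_power val3_closed w_def)
  have w0: "w \<noteq> 0" using w4 by auto
  have w2: "w ^ 2 \<noteq> 1" "w ^ 2 \<noteq> - 1"
  proof -
    have "w ^ 4 = (w ^ 2) ^ 2" by (simp flip: power_mult)
    hence "(w ^ 2) ^ 2 \<noteq> 1" using w4 one_neq_minus_one_residue3 by metis
    thus "w ^ 2 \<noteq> 1" "w ^ 2 \<noteq> - 1" by (metis one_power2, metis power2_minus one_power2)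
  qed
  have "w ^ 3 = w * w ^ 2" by (simp add: power3_eq_cube power2_eq_square)
  hence w3: "w ^ 3 \<noteq> w" "w ^ 3 \<noteq> - w" using w2 w0
    by (metis mult.right_neutral mult_left_cancel, metis mult_minus1_right mult_left_cancel)
  have neg: "w \<noteq> - w" "w ^ 3 \<noteq> - (w ^ 3)"
    by (rule neq_minus_residue3[OF w0]) (rule neq_minus_residue3, use w0 in simp)
  have w9: "w ^ 9 = w" "(w ^ 3) ^ 3 = w"
  proof -
    have "w ^ 9 = (w ^ 4) ^ 2 * w" by (simp flip: power_mult power_Suc2)
    thus "w ^ 9 = w" by (simp add: w4)
    thus "(w ^ 3) ^ 3 = w" by (simp flip: power_mult)
  qed
  have w27: "(w ^ 3) ^ 9 = w ^ 3"
  proof -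
    have "(w ^ 3) ^ 9 = (w ^ 9) ^ 3" by (simp flip: power_mult)
    thus ?thesis by (simp add: w9)
  qed
  have img: "res ` \<Omega> = {w, w ^ 3, - w, - (w ^ 3)}" by (simp add: \<Omega>_def res flip: w_def)
  have "w \<noteq> w ^ 3" "w \<noteq> - (w ^ 3)" "- w \<noteq> - (w ^ 3)" using w3 by (metis minus_minus)+
  hence "distinct [w, w ^ 3, - w, - (w ^ 3)]" using w3 neg
    by (simp only: distinct.simps list.set insert_iff empty_iff) blast
  from distinct_card[OF this] show "card (res ` \<Omega>) = 4" unfolding img by simp
  assume z: "z \<in> \<Omega>"
  hence rz: "res z \<in> {w, w ^ 3, - w, - (w ^ 3)}" using img by blast
  have w3': "w \<noteq> w ^ 3" "- w \<noteq> w ^ 3" using w3 by auto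
  show "res z ^ 9 = res z \<and> res z ^ 3 \<noteq> res z" using rz w9 w27 w3 w3' by auto
  have "res z \<noteq> 0" using rz w0 by auto
  thus "z \<in> val3 \<and> z \<notin> max3" using z \<omega>(2) by (auto simp: \<Omega>_def intro: val3_closed)
  have "(\<omega> ^ 3) ^ 4 = (\<omega> ^ 4) ^ 3" by (simp flip: power_mult)
  thus "z ^ 4 = - 1" using z by (auto simp: \<Omega>_def \<omega>(1))
qed

lemma dvd_add_mod_iff:
  fixes x :: int
  assumes "m dvd M"
  shows "m dvd x + c \<longleftrightarrow> m dvd x mod M + c"
proof -
  have "x + c = M * (x div M) + (x mod M + c)" by simp
  thus ?thesis using assms by (metis dvd_add_right_iff dvd_mult2)
qed

lemma mod_of_dvd_quotient:
  fixes x :: int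
  assumes "x - s = m * c" "3 dvd c"
  shows "x mod (m * 3) = s mod (m * 3)"
  unfolding mod_eq_dvd_iff assms(1) using assms(2) by (rule mult_dvd_mono[OF dvd_refl])

locale monogenic_trinomial = monogenic_conjugates +
  fixes k r :: nat and a b :: int
  assumes k: "k > 0" and r: "r > 0"
    and F: "monom 1 (2 ^ k * 3 ^ r) + monom (of_int a) 1 + [:of_int b:] = (\<Prod>t\<in>S. [:- t, 1:])"
begin

text \<open>Only the exponent \<open>2 ^ k\<close> prime to 3 occurs, since
  \<open>x ^ N - \<epsilon>\<close> must be separable modulo 3; the factor \<open>3 ^ r\<close> of
  the degree is recovered from \<open>\<epsilon> ^ 3 ^ r = \<epsilon>\<close> for a sign.\<close>

definition sign_root :: "int \<Rightarrow> complex \<Rightarrow> bool" where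
  "sign_root \<epsilon> z \<longleftrightarrow> z \<in> val3 \<and> z \<notin> max3 \<and> z ^ 2 ^ k = of_int \<epsilon> \<and> \<bar>\<epsilon>\<bar> = 1"

lemma not_three_dvd_two_power: "\<not> 3 dvd (2 :: nat) ^ k"
proof
  assume "3 dvd (2 :: nat) ^ k"
  hence "(3 :: nat) dvd 2" by (rule prime_dvd_power_nat[rotated]) simp
  thus False by simp
qed

lemma trinomial_at_unit:
  assumes "sign_root \<epsilon> z"
  shows "trinomial_at_unit (2 ^ k * 3 ^ r) r (2 ^ k) a b \<epsilon> z S"
proof
  have z: "z ^ 2 ^ k = of_int \<epsilon>" "\<epsilon> = 1 \<or> \<epsilon> = - 1" using assms by (auto simp: sign_root_def)
  have "odd (3 ^ r :: nat)" by simp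
  hence "\<epsilon> ^ 3 ^ r = \<epsilon>" using z(2) by (auto simp: power_minus_odd)
  thus "z ^ (2 ^ k * 3 ^ r) = of_int \<epsilon>" by (simp add: power_mult z(1) flip: of_int_power)
  have "(1::nat) < 2 ^ k" using k by (intro one_less_power) auto
  also have "\<dots> \<le> 2 ^ k * 3 ^ r" by simp
  finally show "1 < (2 :: nat) ^ k * 3 ^ r" .
qed (use assms not_three_dvd_two_power fin F in \<open>auto simp: sign_root_def\<close>)

lemma card_middle:
  assumes z: "sign_root \<epsilon> z" and s: "j + s + 1 = r" and div: "3 ^ (s + 2) dvd a" "3 ^ (s + 2) dvd b + \<epsilon>"
  shows "card (place_class (2 ^ k) \<epsilon> (res z) (2 * 3 ^ j)) = 2 * 3 ^ j"
proof -
  interpret T: trinomial_at_unit "2 ^ k * 3 ^ r" r "2 ^ k" a b \<epsilon> z S by (rule trinomial_at_unit[OF z])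
  obtain \<rho> :: complex where \<rho>: "\<rho> ^ (2 * 3 ^ j) = 3"
    by (rule exists_root_of_three[of "2 * 3 ^ j"]) auto
  have "(2 :: nat) * 3 ^ j \<noteq> 1" by simp
  moreover have j: "s < r" "r - s - 1 = j" using s by auto
  ultimately show ?thesis
    using T.card_middle_class[OF j(1), of \<rho>] \<rho> div place_class_eq[OF _ _ _ not_three_dvd_two_power \<rho>, of z \<epsilon>] z
    unfolding j(2) by (simp add: sign_root_def)
qed

text \<open>The first segment with \<open>B = 3 ^ j\<close>. The unit condition makes its height at
  0 exactly \<open>s + 1\<close>; positive j avoids the looser definition of the class for
  \<open>e = 1\<close>.\<close>

lemma card_left:
  assumes z: "sign_root \<epsilon> z" and s: "j + s = r" "j > 0" and c: "a = 3 ^ (s + 1) * c" "b + \<epsilon> = 3 ^ (s + 1) * c'"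
    and unit: "of_int c' + of_int c * res z \<noteq> 0"
  shows "card (place_class (2 ^ k) \<epsilon> (res z) (3 ^ j)) = 3 ^ j"
proof -
  interpret T: trinomial_at_unit "2 ^ k * 3 ^ r" r "2 ^ k" a b \<epsilon> z S by (rule trinomial_at_unit[OF z])
  obtain \<rho> :: complex where \<rho>: "\<rho> ^ (3 ^ j) = 3"
    by (rule exists_root_of_three[of "3 ^ j"]) auto
  have "res (of_int c' + of_int c * z) = of_int c' + of_int c * res z"
    using z by (simp add: res_add res_mult val3_closed sign_root_def)
  hence u: "of_int c' + of_int c * z \<notin> max3" using unit by auto
  have "(3 :: nat) ^ j \<noteq> 1" using s by simp
  moreover have j: "s \<le> r" "r - s = j" using s by auto
  ultimately show ?thesis
    using T.card_left_class(2)[OF j(1), of \<rho>, OF _ c u] \<rho> place_class_eq[OF _ _ _ not_three_dvd_two_power \<rho>, of z \<epsilon>] z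
    unfolding j(2) by (simp add: sign_root_def)
qed

text \<open>The segment of length 1, \<open>s = r\<close>: one root is congruent to z modulo 3,
  however large the height at 0.\<close>

lemma card_hensel:
  assumes z: "sign_root \<epsilon> z" and div: "3 ^ (r + 1) dvd a" "3 ^ (r + 1) dvd b + \<epsilon>"
  shows "card (place_class (2 ^ k) \<epsilon> (res z) 1) = 1"
proof -
  interpret T: trinomial_at_unit "2 ^ k * 3 ^ r" r "2 ^ k" a b \<epsilon> z S by (rule trinomial_at_unit[OF z])
  obtain c c' where c: "a = 3 ^ (r + 1) * c" "b + \<epsilon> = 3 ^ (r + 1) * c'" using div by (auto elim!: dvdE)
  have \<rho>: "(3 :: complex) ^ (3 ^ (r - r)) = 3" by simp
  have \<rho>1: "(3 :: complex) ^ 1 = 3" by simp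
  show ?thesis using T.card_left_class(1)[OF _ \<rho> c] place_class_eq[OF _ _ _ not_three_dvd_two_power \<rho>1, of z \<epsilon>] z
    by (simp add: sign_root_def)
qed

text \<open>\<open>M\<close> collects exponents e that occur at both residues 1 and -1, so two of
  them make four classes over F_3.\<close>

lemma two_classes_contradiction:
  assumes good: "\<And>z e. z \<in> {1, - 1} \<Longrightarrow> e \<in> M \<Longrightarrow> e > 0 \<and> card (place_class (2 ^ k) 1 (res z) e) = e"
    and M: "card M \<ge> 2"
  shows False
proof -
  have "card ({1, - 1 :: residue3} \<times> M) \<le> 3"
  proof (rule at_most_three_places_of_degree_1[of _ "2 ^ k" 1])
    fix \<zeta> :: residue3 and e assume *: "(\<zeta>, e) \<in> {1, - 1} \<times> M"
    have "res (- 1) = - 1" using res_minus[of 1] by simp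
    then obtain z where "z \<in> {1, - 1}" "\<zeta> = res z" using * by force
    moreover have "\<zeta> ^ 3 = \<zeta>" using * by auto
    ultimately show "e > 0 \<and> card (place_class (2 ^ k) 1 \<zeta> e) = e \<and> \<zeta> ^ 3 = \<zeta>" using good[of z e] * by blast
  qed
  moreover have "card ({1, - 1 :: residue3} \<times> M) = 2 * card M"
    using one_neq_minus_one_residue3 by (simp add: card_cartesian_product)
  ultimately show False using M by simp
qed

lemma quadratic_classes_contradiction:
  assumes good: "\<And>z e. z \<in> Z \<Longrightarrow> e \<in> M \<Longrightarrow> e > 0 \<and> card (place_class (2 ^ k) \<epsilon> (res z) e) = e"
    and Z: "\<And>z. z \<in> Z \<Longrightarrow> res z ^ 9 = res z \<and> res z ^ 3 \<noteq> res z"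
    and M: "card (res ` Z) * card M > 6"
  shows False
proof -
  have "card ((res ` Z) \<times> M) \<le> 6"
    by (rule at_most_six_places_of_degree_2[of _ "2 ^ k" \<epsilon>]) (use good Z in auto)
  thus False using M by (simp add: card_cartesian_product)
qed

lemma sign_root_one: "z \<in> {1, - 1} \<Longrightarrow> sign_root 1 z"
  using k max3_minus[of "- 1"] by (auto simp: sign_root_def val3_closed)

text \<open>Height at least 3 at 0 exposes the middle segments for \<open>s = 0\<close> and
  \<open>s = 1\<close>.\<close>

lemma no_two_middle_classes:
  assumes "r \<ge> 2" "27 dvd a" "27 dvd b + 1"
  shows False
proof (rule two_classes_contradiction)
  show "2 \<le> card {2 * 3 ^ (r - 1), 2 * 3 ^ (r - 2) :: nat}"
  proof -
    have "r - 1 = Suc (r - 2)" using assms by simp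
    hence "2 * 3 ^ (r - 1) \<noteq> (2 * 3 ^ (r - 2) :: nat)" by simp
    thus ?thesis by simp
  qed
  fix z :: complex and e :: nat
  assume z: "z \<in> {1, - 1}" and e: "e \<in> {2 * 3 ^ (r - 1), 2 * 3 ^ (r - 2)}"
  note z' = sign_root_one[OF z]
  have "9 dvd a" "9 dvd b + 1" using assms by (auto intro: dvd_trans[of 9 27])
  with card_middle[OF z', of "r - 1" 0] card_middle[OF z', of "r - 2" 1] assms e
  show "e > 0 \<and> card (place_class (2 ^ k) 1 (res z) e) = e" by auto
qed

lemma no_middle_and_hensel:
  assumes "r = 1" "9 dvd a" "9 dvd b + 1"
  shows False
proof (rule two_classes_contradiction)
  show "2 \<le> card {2, 1 :: nat}" by simp
  fix z :: complex and e :: nat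
  assume z: "z \<in> {1, - 1}" and e: "e \<in> {2, 1 :: nat}"
  note z' = sign_root_one[OF z]
  show "e > 0 \<and> card (place_class (2 ^ k) 1 (res z) e) = e"
    using card_middle[OF z', of "r - 1" 0] card_hensel[OF z'] assms e by auto
qed

text \<open>The conditions on \<open>c' + c\<close> and \<open>c' - c\<close> are the unit condition
  at 1 and -1: the height at 0 is exactly 2, and the middle segment for \<open>s = 0\<close> is
  joined by the first segment for \<open>s = 1\<close>.\<close>

lemma no_middle_and_left:
  assumes "r \<ge> 2" "a = 9 * c" "b + 1 = 9 * c'" "\<not> 3 dvd c' + c" "\<not> 3 dvd c' - c"
  shows False
proof (rule two_classes_contradiction)
  show "2 \<le> card {2 * 3 ^ (r - 1), 3 ^ (r - 1) :: nat}" by simp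
  fix z :: complex and e :: nat
  assume z: "z \<in> {1, - 1}" and e: "e \<in> {2 * 3 ^ (r - 1), 3 ^ (r - 1)}"
  note z' = sign_root_one[OF z]
  have "of_int (c' + c) \<noteq> (0 :: residue3)" "of_int (c' - c) \<noteq> (0 :: residue3)"
    using assms(4,5) by (simp_all only: of_int_residue3_eq_0_iff not_False_eq_True)
  hence "of_int c' + of_int c * res z \<noteq> 0" using z res_minus[of 1] by auto
  with card_middle[OF z', of "r - 1" 0] card_left[OF z', of "r - 1" 1 c c'] assms e
  show "e > 0 \<and> card (place_class (2 ^ k) 1 (res z) e) = e" by auto
qed

section \<open>Contradictions at roots of unity of order 4 and 8\<close>

lemma sign_root_ii: "k = 1 \<Longrightarrow> z \<in> {\<i>, - \<i>} \<Longrightarrow> sign_root (- 1) z"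
  unfolding sign_root_def using residue_ii(4)[of z] by auto

text \<open>Height at least 4 at 0 exposes the middle segments for \<open>s = 0, 1, 2\<close>, with
  \<open>e = 18, 6, 2\<close>, and a Hensel root.\<close>

lemma no_four_classes_hensel:
  assumes "k = 1" "r = 3" "81 dvd a" "81 dvd b - 1"
  shows False
proof (rule quadratic_classes_contradiction)
  show "card (res ` {\<i>, - \<i>}) * card {18, 6, 2, 1 :: nat} > 6" by (simp add: residue_ii(3) del: image_insert)
  fix z :: complex assume z: "z \<in> {\<i>, - \<i>}"
  thus "res z ^ 9 = res z \<and> res z ^ 3 \<noteq> res z" by (rule residue_ii)
  fix e :: nat assume e: "e \<in> {18, 6, 2, 1}"
  note z' = sign_root_ii[OF assms(1) z]
  have "9 dvd a" "9 dvd b - 1" "27 dvd a" "27 dvd b - 1"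
    using assms by (auto intro: dvd_trans[of _ 81])
  with card_middle[OF z', of "r - 1" 0] card_middle[OF z', of "r - 2" 1] card_middle[OF z', of "r - 3" 2] card_hensel[OF z'] assms e
  show "e > 0 \<and> card (place_class (2 ^ k) (- 1) (res z) e) = e" by auto
qed

lemma no_four_classes_left:
  assumes "k = 1" "r \<ge> 4" "a = 81 * c" "b - 1 = 81 * c'" "\<not> (3 dvd c \<and> 3 dvd c')"
  shows False
proof (rule quadratic_classes_contradiction)
  \<comment> \<open>In terms of \<open>A\<close> the four exponents are 54, 18, 6 and 3 times
    \<open>A\<close>, hence distinct.\<close>
  define A where "A = (3 :: nat) ^ (r - 4)"
  have A: "3 ^ (r - 1) = 27 * A" "3 ^ (r - 2) = 9 * A" "3 ^ (r - 3) = 3 * A" "A > 0"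
  proof -
    have "r - 3 = Suc (r - 4)" "r - 2 = Suc (Suc (r - 4))" "r - 1 = Suc (Suc (Suc (r - 4)))"
      using assms by simp_all
    thus "3 ^ (r - 1) = 27 * A" "3 ^ (r - 2) = 9 * A" "3 ^ (r - 3) = 3 * A" "A > 0"
      by (simp_all add: A_def del: diff_Suc_numeral)
  qed
  show "card (res ` {\<i>, - \<i>}) * card {2 * 3 ^ (r - 1), 2 * 3 ^ (r - 2), 2 * 3 ^ (r - 3), 3 ^ (r - 3) :: nat} > 6"
    using A(4) unfolding A residue_ii(3) by simp
  fix z :: complex assume z: "z \<in> {\<i>, - \<i>}"
  thus w: "res z ^ 9 = res z \<and> res z ^ 3 \<noteq> res z" by (rule residue_ii)
  fix e :: nat assume e: "e \<in> {2 * 3 ^ (r - 1), 2 * 3 ^ (r - 2), 2 * 3 ^ (r - 3), 3 ^ (r - 3)}"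
  note z' = sign_root_ii[OF assms(1) z]
  have div: "9 dvd a" "9 dvd b - 1" "27 dvd a" "27 dvd b - 1" "81 dvd a" "81 dvd b - 1"
    unfolding assms(3,4) by (auto intro: dvd_mult2)
  have "of_int c' + of_int c * res z \<noteq> 0"
    by (rule linear_residue3_neq_0) (use w assms(5) in auto)
  with card_middle[OF z', of "r - 1" 0] card_middle[OF z', of "r - 2" 1] card_middle[OF z', of "r - 3" 2]
    card_left[OF z', of "r - 3" 3 c c'] assms e div
  show "e > 0 \<and> card (place_class (2 ^ k) (- 1) (res z) e) = e" by auto
qed

lemma sign_root_\<Omega>:
  assumes z: "z \<in> \<Omega>" and \<epsilon>: "k = 2 \<and> \<epsilon> = - 1 \<or> k \<ge> 3 \<and> \<epsilon> = 1"
  shows "sign_root \<epsilon> z"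
proof (cases "k = 2")
  case True
  thus ?thesis unfolding sign_root_def using \<epsilon> \<Omega>(3,4)[OF z] by simp
next
  case False
  then obtain l where l: "k = 3 + l" using \<epsilon> le_Suc_ex by blast
  have "z ^ 8 = (z ^ 4) ^ 2" by (simp flip: power_mult)
  hence "z ^ 8 = 1" by (simp add: \<Omega>(4)[OF z])
  hence "z ^ 2 ^ k = 1" unfolding l power_add by (simp add: power_mult)
  thus ?thesis using \<epsilon> False \<Omega>(3)[OF z] by (simp add: sign_root_def)
qed

lemma no_eight_classes_hensel:
  assumes "k = 2" "r = 1" "9 dvd a" "9 dvd b - 1"
  shows False
proof (rule quadratic_classes_contradiction)
  show "card (res ` \<Omega>) * card {2, 1 :: nat} > 6" by (simp add: \<Omega>)
  fix z :: complex assume z: "z \<in> \<Omega>"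
  thus "res z ^ 9 = res z \<and> res z ^ 3 \<noteq> res z" by (rule \<Omega>)
  fix e :: nat assume e: "e \<in> {2, 1}"
  have z': "sign_root (- 1) z" by (rule sign_root_\<Omega>[OF z]) (use assms in auto)
  show "e > 0 \<and> card (place_class (2 ^ k) (- 1) (res z) e) = e"
    using card_middle[OF z', of "r - 1" 0] card_hensel[OF z'] assms e by auto
qed

text \<open>At each of four residues the middle segment for \<open>s = 0\<close> meets a first
  segment for \<open>s = 1\<close>, whose height at 0 is exactly 2.\<close>

lemma no_eight_classes_left:
  assumes \<epsilon>: "k = 2 \<and> \<epsilon> = - 1 \<or> k \<ge> 3 \<and> \<epsilon> = 1" and "r \<ge> 2"
    and "a = 9 * c" "b + \<epsilon> = 9 * c'" "\<not> (3 dvd c \<and> 3 dvd c')"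
  shows False
proof (rule quadratic_classes_contradiction)
  show "card (res ` \<Omega>) * card {2 * 3 ^ (r - 1), 3 ^ (r - 1) :: nat} > 6" by (simp add: \<Omega>)
  fix z :: complex assume z: "z \<in> \<Omega>"
  thus w: "res z ^ 9 = res z \<and> res z ^ 3 \<noteq> res z" by (rule \<Omega>)
  fix e :: nat assume e: "e \<in> {2 * 3 ^ (r - 1), 3 ^ (r - 1)}"
  note z' = sign_root_\<Omega>[OF z \<epsilon>]
  have "of_int c' + of_int c * res z \<noteq> 0"
    by (rule linear_residue3_neq_0) (use w assms(5) in auto)
  with card_middle[OF z', of "r - 1" 0] card_left[OF z', of "r - 1" 1 c c'] assms e
  show "e > 0 \<and> card (place_class (2 ^ k) \<epsilon> (res z) e) = e" by auto
qed

theorem not_monogenic_trinomial: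
  assumes "(k \<ge> 1 \<and> r = 3 \<and> [a = 0] (mod 243) \<and> [b = -1] (mod 243)) \<or>
      (k \<in> {1, 2} \<and> r \<ge> 4 \<and>
        (a mod 243, b mod 243) \<in> {81, 162} \<times> {80, 161, 242} \<union> {0} \<times> {80, 161}) \<or>
      (k \<ge> 1 \<and> r = 1 \<and> [a = 0] (mod 27) \<and> [b = -1] (mod 27)) \<or>
      (k \<ge> 1 \<and> r \<ge> 2 \<and>
        (a mod 27, b mod 27) \<in> {9, 18} \<times> {26} \<union> {0} \<times> {8, 17}) \<or>
      (k \<ge> 1 \<and> r \<ge> 3 \<and>
        (a mod 81, b mod 81) \<in> {0} \<times> {26, 53} \<union> {27, 54} \<times> {26, 53, 80}) \<or>
      (k \<ge> 1 \<and> r = 2 \<and> [a = 0] (mod 81) \<and> [b = -1] (mod 81)) \<or>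
      (k = 1 \<and> r = 3 \<and> [a = 0] (mod 243) \<and> [b = 1] (mod 243)) \<or>
      (k = 1 \<and> r \<ge> 4 \<and>
        (a mod 243, b mod 243) \<in> {81, 162} \<times> {1, 82, 163} \<union> {0} \<times> {82, 163}) \<or>
      (k = 2 \<and> r = 1 \<and> [a = 0] (mod 27) \<and> [b = 1] (mod 27)) \<or>
      (k = 2 \<and> r \<ge> 2 \<and>
        (a mod 27, b mod 27) \<in> {9, 18} \<times> {1, 10, 19} \<union> {0} \<times> {10, 19}) \<or>
      (k \<ge> 3 \<and> r \<ge> 2 \<and>
        (a mod 27, b mod 27) \<in> {9, 18} \<times> {8, 17})"
  shows False
  using assms
proof (elim disjE conjE, goal_cases)
  case 1
  hence "a mod 243 = 0" "b mod 243 = 242" by (simp_all add: cong_def)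
  hence "27 dvd a + 0" "27 dvd b + 1"
    using dvd_add_mod_iff[of 27 243 a 0] dvd_add_mod_iff[of 27 243 b "1"] by auto
  thus ?case using 1 by (intro no_two_middle_classes) auto
next
  case 2
  hence "(a mod 243 = 0 \<or> a mod 243 = 81 \<or> a mod 243 = 162) \<and> (b mod 243 = 80 \<or> b mod 243 = 161 \<or> b mod 243 = 242)"
    by auto
  hence "27 dvd a + 0" "27 dvd b + 1"
    using dvd_add_mod_iff[of 27 243 a 0] dvd_add_mod_iff[of 27 243 b "1"] by auto
  thus ?case using 2 by (intro no_two_middle_classes) auto
next
  case 3
  hence "a mod 27 = 0" "b mod 27 = 26" by (simp_all add: cong_def)
  hence "9 dvd a + 0" "9 dvd b + 1"
    using dvd_add_mod_iff[of 9 27 a 0] dvd_add_mod_iff[of 9 27 b "1"] by auto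
  thus ?case using 3 by (intro no_middle_and_hensel) auto
next
  case 4
  hence *: "(a mod 27 = 9 \<or> a mod 27 = 18) \<and> b mod 27 = 26 \<or> a mod 27 = 0 \<and> (b mod 27 = 8 \<or> b mod 27 = 17)" by auto
  hence "9 dvd a + 0" "9 dvd b + 1"
    using dvd_add_mod_iff[of 9 27 a 0] dvd_add_mod_iff[of 9 27 b "1"] by auto
  then obtain c c' where c: "a = 9 * c" "b + 1 = 9 * c'" by (auto elim!: dvdE)
  \<comment> \<open>\<open>9 * (c' + c)\<close> equals \<open>a + b + 1\<close>, so the test takes
    place modulo 27.\<close>
  moreover have "\<not> 3 dvd c' + c"
  proof
    assume "3 dvd c' + c"
    hence "9 * 3 dvd 9 * (c' + c)" by (rule mult_dvd_mono[OF dvd_refl])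
    also have "9 * (c' + c) = (a + b) + 1" using c by simp
    finally have "((a + b) + 1) mod 27 = 0" by (intro dvd_imp_mod_0) simp
    hence "((a mod 27 + b mod 27) + 1) mod 27 = 0" by (metis mod_add_left_eq mod_add_eq)
    with * show False by auto
  qed
  moreover have "\<not> 3 dvd c' - c"
  proof
    assume "3 dvd c' - c"
    hence "9 * 3 dvd 9 * (c' - c)" by (rule mult_dvd_mono[OF dvd_refl])
    also have "9 * (c' - c) = (b - a) + 1" using c by simp
    finally have "((b - a) + 1) mod 27 = 0" by (intro dvd_imp_mod_0) simp
    hence "((b mod 27 - a mod 27) + 1) mod 27 = 0" by (metis mod_add_left_eq mod_diff_eq)
    with * show False by auto
  qed
  ultimately show ?case using 4 by (intro no_middle_and_left[of c c']) auto
next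
  case 5
  hence "(a mod 81 = 0 \<or> a mod 81 = 27 \<or> a mod 81 = 54) \<and> (b mod 81 = 26 \<or> b mod 81 = 53 \<or> b mod 81 = 80)"
    by auto
  hence "27 dvd a + 0" "27 dvd b + 1"
    using dvd_add_mod_iff[of 27 81 a 0] dvd_add_mod_iff[of 27 81 b "1"] by auto
  thus ?case using 5 by (intro no_two_middle_classes) auto
next
  case 6
  hence "a mod 81 = 0" "b mod 81 = 80" by (simp_all add: cong_def)
  hence "27 dvd a + 0" "27 dvd b + 1"
    using dvd_add_mod_iff[of 27 81 a 0] dvd_add_mod_iff[of 27 81 b "1"] by auto
  thus ?case using 6 by (intro no_two_middle_classes) auto
next
  case 7
  hence "a mod 243 = 0" "b mod 243 = 1" by (simp_all add: cong_def)
  hence "81 dvd a + 0" "81 dvd b + (- 1)"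
    using dvd_add_mod_iff[of 81 243 a 0] dvd_add_mod_iff[of 81 243 b "(- 1)"] by auto
  thus ?case using 7 by (intro no_four_classes_hensel) auto
next
  case 8
  hence *: "(a mod 243 = 81 \<or> a mod 243 = 162) \<and> (b mod 243 = 1 \<or> b mod 243 = 82 \<or> b mod 243 = 163) \<or>
    a mod 243 = 0 \<and> (b mod 243 = 82 \<or> b mod 243 = 163)" by auto
  hence "81 dvd a + 0" "81 dvd b + (- 1)"
    using dvd_add_mod_iff[of 81 243 a 0] dvd_add_mod_iff[of 81 243 b "(- 1)"] by auto
  then obtain c c' where c: "a = 81 * c" "b - 1 = 81 * c'" by (auto elim!: dvdE)
  moreover have "\<not> (3 dvd c \<and> 3 dvd c')" using * c mod_of_dvd_quotient[of a 0 81 c] mod_of_dvd_quotient[of b 1 81 c'] by auto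
  ultimately show ?case using 8 by (intro no_four_classes_left[of c c']) auto
next
  case 9
  hence "a mod 27 = 0" "b mod 27 = 1" by (simp_all add: cong_def)
  hence "9 dvd a + 0" "9 dvd b + (- 1)"
    using dvd_add_mod_iff[of 9 27 a 0] dvd_add_mod_iff[of 9 27 b "(- 1)"] by auto
  thus ?case using 9 by (intro no_eight_classes_hensel) auto
next
  case 10
  hence *: "(a mod 27 = 9 \<or> a mod 27 = 18) \<and> (b mod 27 = 1 \<or> b mod 27 = 10 \<or> b mod 27 = 19) \<or>
    a mod 27 = 0 \<and> (b mod 27 = 10 \<or> b mod 27 = 19)" by auto
  hence "9 dvd a + 0" "9 dvd b + (- 1)"
    using dvd_add_mod_iff[of 9 27 a 0] dvd_add_mod_iff[of 9 27 b "(- 1)"] by auto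
  then obtain c c' where c: "a = 9 * c" "b - 1 = 9 * c'" by (auto elim!: dvdE)
  moreover have "\<not> (3 dvd c \<and> 3 dvd c')" using * c mod_of_dvd_quotient[of a 0 9 c] mod_of_dvd_quotient[of b 1 9 c'] by auto
  ultimately show ?case using 10 by (intro no_eight_classes_left[of "- 1" c c']) auto
next
  case 11
  hence *: "(a mod 27 = 9 \<or> a mod 27 = 18) \<and> (b mod 27 = 8 \<or> b mod 27 = 17)" by auto
  hence "9 dvd a + 0" "9 dvd b + 1"
    using dvd_add_mod_iff[of 9 27 a 0] dvd_add_mod_iff[of 9 27 b "1"] by auto
  then obtain c c' where c: "a = 9 * c" "b + 1 = 9 * c'" by (auto elim!: dvdE)
  moreover have "\<not> (3 dvd c \<and> 3 dvd c')" using * c mod_of_dvd_quotient[of a 0 9 c] by auto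
  \<comment> \<open>Here neither c nor c' is divisible by 3, so one of \<open>c' + c\<close> and
    \<open>c' - c\<close> is, and the unit condition fails at 1 or at -1. For
    \<open>k \<ge> 3\<close> the primitive eighth roots of unity are available instead.\<close>
  ultimately show ?case using 11 by (intro no_eight_classes_left[of 1 c c']) auto
qed

end

section \<open>Rational polynomials and number fields\<close>

lemma irreducible_rat_bezout:
  fixes p A :: "rat poly"
  assumes "Factorial_Ring.irreducible p" "\<not> p dvd A"
  obtains U V where "U * A + V * p = 1"
proof -
  have "Rings.coprime p A" using assms
    by (metis irreducible_imp_prime_elem_gcd prime_elem_imp_coprime)
  hence "fst (bezout_coefficients A p) * A + snd (bezout_coefficients A p) * p = 1"
    by (metis bezout_coefficients_fst_snd coprime_iff_gcd_eq_1 gcd.commute)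
  thus ?thesis by (rule that)
qed

lemma irreducible_rat_dvd:
  assumes p: "Factorial_Ring.irreducible p" "rpoly p (x :: 'a :: field_char_0) = 0" and A: "rpoly A x = 0"
  shows "p dvd A"
proof (rule ccontr)
  assume "\<not> p dvd A"
  from irreducible_rat_bezout[OF p(1) this] obtain U V where "U * A + V * p = 1" .
  hence "rpoly (U * A + V * p) x = 1" by simp
  thus False using p(2) A by (simp add: of_rat_poly_simps)
qed

text \<open>This stands in for the embeddings of the number field: a polynomial relation at one root
  holds at every conjugate.\<close>

lemma irreducible_rat_transfer:
  assumes p: "Factorial_Ring.irreducible p" "rpoly p (x :: 'a :: field_char_0) = 0"
    and A: "rpoly A x = 0" and y: "rpoly p y = 0"
  shows "rpoly A (y :: 'a) = 0"
  using irreducible_rat_dvd[OF p A] y by (auto elim!: dvdE simp: of_rat_poly_mult)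

text \<open>A Bezout identity between p and its derivative excludes multiple roots.\<close>

lemma irreducible_rat_split:
  fixes p :: "rat poly"
  assumes p: "Factorial_Ring.irreducible p" and monic: "lead_coeff p = 1"
  shows "map_poly of_rat p = (\<Prod>z | rpoly p z = 0. [:- z, 1 :: complex:])" "finite {z :: complex. rpoly p z = 0}"
proof -
  have deg: "degree p > 0"
  proof (rule ccontr)
    assume "\<not> ?thesis"
    then obtain c where "p = [:c:]" by (auto elim: degree_eq_zeroE)
    hence "p = 1" using monic by (simp add: one_pCons)
    thus False using p by (simp add: Factorial_Ring.irreducible_def)
  qed
  have nz: "map_poly of_rat p \<noteq> (0 :: complex poly)" using deg by (auto simp: of_rat_poly_eq_0_iff)
  thus "finite {z :: complex. rpoly p z = 0}" by (rule poly_roots_finite)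
  have "pderiv p \<noteq> 0" using deg by (simp add: pderiv_eq_0_iff)
  hence "\<not> p dvd pderiv p" using deg by (auto dest!: dvd_imp_degree_le simp: degree_pderiv)
  from irreducible_rat_bezout[OF p this] obtain U V where UV: "U * pderiv p + V * p = 1" .
  have "rsquarefree (map_poly of_rat p :: complex poly)"
    unfolding rsquarefree_roots
  proof (intro allI notI)
    fix a :: complex assume a: "poly (map_poly of_rat p) a = 0 \<and> poly (pderiv (map_poly of_rat p)) a = 0"
    have "rpoly (U * pderiv p + V * p) a = 1" by (simp add: UV)
    thus False using a by (simp add: of_rat_poly_simps of_rat_poly_pderiv)
  qed
  from complex_poly_decompose_rsquarefree[OF this] show "map_poly of_rat p = (\<Prod>z | rpoly p z = 0. [:- z, 1 :: complex:])"
    using monic by (simp add: degree_map_poly coeff_map_poly)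
qed

lemma exists_minimal_poly:
  fixes x :: "'a :: field_char_0"
  assumes "algebraic_int x"
  obtains p where "Factorial_Ring.irreducible p" "lead_coeff p = 1" "rpoly p x = 0"
proof -
  define R where "R = (\<lambda>p. lead_coeff p = 1 \<and> rpoly p x = 0)"
  obtain q where q: "lead_coeff q = 1" "ipoly q x = 0" using assms by (auto simp: algebraic_int_altdef_ipoly)
  have "R (map_poly of_int q)" using q by (simp add: R_def of_rat_of_int_poly degree_map_poly coeff_map_poly)
  define p where "p = arg_min degree R"
  have p: "R p" and min: "\<And>p'. R p' \<Longrightarrow> degree p \<le> degree p'" unfolding p_def
    by (rule arg_min_natI[of R, OF \<open>R (map_poly of_int q)\<close>]) (rule arg_min_nat_le[of R])
  have min': "degree p \<le> degree u" if "u \<noteq> 0" "rpoly u x = 0" for u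
    using min[of "smult (inverse (lead_coeff u)) u"] that by (simp add: R_def of_rat_poly_smult)
  have p0: "p \<noteq> 0" using p by (auto simp: R_def)
  have "Factorial_Ring.irreducible p"
  proof (rule Factorial_Ring.irreducibleI)
    show "p \<noteq> 0" by (fact p0)
    show "\<not> p dvd 1"
    proof
      assume "p dvd 1"
      then obtain c where "p = [:c:]" by (auto simp: is_unit_poly_iff)
      thus False using p by (auto simp: R_def of_rat_poly_pCons)
    qed
    fix u v assume uv: "p = u * v"
    have nz: "u \<noteq> 0" "v \<noteq> 0" using uv p0 by auto
    have deg: "degree p = degree u + degree v" unfolding uv by (rule degree_mult_eq[OF nz])
    have "rpoly u x = 0 \<or> rpoly v x = 0" using p by (simp add: R_def uv of_rat_poly_mult)
    hence "degree p \<le> degree u \<or> degree p \<le> degree v" using min' nz by blast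
    hence "degree v = 0 \<or> degree u = 0" using deg by linarith
    thus "u dvd 1 \<or> v dvd 1" using nz by (auto simp: is_unit_iff_degree)
  qed
  thus ?thesis using that[of p] p by (simp add: R_def)
qed

section \<open>Rings and fields generated by one complex number\<close>

lemma complex_ring_simps [simp]:
  "carrier complex_ring = UNIV" "\<one>\<^bsub>complex_ring\<^esub> = 1" "\<zero>\<^bsub>complex_ring\<^esub> = 0"
  "x \<oplus>\<^bsub>complex_ring\<^esub> y = x + y" "x \<otimes>\<^bsub>complex_ring\<^esub> y = x * y"
  by (simp_all add: ring_of_type_algebra_def)

lemma complex_ring_a_inv [simp]: "\<ominus>\<^bsub>complex_ring\<^esub> x = - x"
proof -
  have "ring complex_ring" by (rule ring_from_type_algebra)
  from ring.is_abelian_group[OF this] have "abelian_group complex_ring" .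
  from abelian_group.minus_equality[OF this, of "- x" x] show ?thesis by simp
qed

lemma complex_ring_m_inv [simp]:
  assumes "x \<noteq> 0"
  shows "inv\<^bsub>complex_ring\<^esub> x = inverse x"
proof -
  have "cring complex_ring" by (rule cring_from_type_algebra)
  hence "comm_monoid complex_ring" by (rule cring.axioms(2))
  from comm_monoid.comm_inv_char[OF this, of x "inverse x"] assms show ?thesis by simp
qed

lemma int_adjoin_iff: "x \<in> int_adjoin \<eta> \<longleftrightarrow> (\<exists>B. x = ipoly B \<eta>)"
proof
  assume "x \<in> int_adjoin \<eta>"
  thus "\<exists>B. x = ipoly B \<eta>" unfolding int_adjoin_def
  proof (induction rule: generate_ring.induct)
    case one
    show ?case by (rule exI[of _ 1]) simp
  next
    case (incl h)
    thus ?case by (intro exI[of _ "[:0, 1:]"]) (simp add: of_int_poly_pCons)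
  next
    case (a_inv h)
    then obtain B where "h = ipoly B \<eta>" by blast
    thus ?case by (intro exI[of _ "- B"]) (simp add: of_int_poly_simps)
  next
    case (eng_add h1 h2)
    then obtain B1 B2 where "h1 = ipoly B1 \<eta>" "h2 = ipoly B2 \<eta>" by blast
    thus ?case by (intro exI[of _ "B1 + B2"]) (simp add: of_int_poly_simps)
  next
    case (eng_mult h1 h2)
    then obtain B1 B2 where "h1 = ipoly B1 \<eta>" "h2 = ipoly B2 \<eta>" by blast
    thus ?case by (intro exI[of _ "B1 * B2"]) (simp add: of_int_poly_simps)
  qed
next
  have one: "1 \<in> int_adjoin \<eta>" and eta: "\<eta> \<in> int_adjoin \<eta>"
    and neg: "\<And>x. x \<in> int_adjoin \<eta> \<Longrightarrow> - x \<in> int_adjoin \<eta>"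
    and add: "\<And>x y. x \<in> int_adjoin \<eta> \<Longrightarrow> y \<in> int_adjoin \<eta> \<Longrightarrow> x + y \<in> int_adjoin \<eta>"
    and mult: "\<And>x y. x \<in> int_adjoin \<eta> \<Longrightarrow> y \<in> int_adjoin \<eta> \<Longrightarrow> x * y \<in> int_adjoin \<eta>"
    unfolding int_adjoin_def
    using generate_ring.a_inv[of _ complex_ring "{\<eta>}"] generate_ring.one[of complex_ring "{\<eta>}"]
      generate_ring.incl[of \<eta> "{\<eta>}" complex_ring]
      generate_ring.eng_add[of _ complex_ring "{\<eta>}"] generate_ring.eng_mult[of _ complex_ring "{\<eta>}"]
    by auto
  have "is_subring (int_adjoin \<eta>)" unfolding is_subring_def
    using one add[OF _ neg] mult by auto
  hence "ipoly B \<eta> \<in> int_adjoin \<eta>" for B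
    by (rule is_subring_poly_closed[OF _ _ eta]) (simp add: coeff_map_poly is_subringD(9) \<open>is_subring _\<close>)
  thus "\<exists>B. x = ipoly B \<eta> \<Longrightarrow> x \<in> int_adjoin \<eta>" by blast
qed

lemma rpoly_in_rat_adjoin: "rpoly A \<theta> \<in> rat_adjoin \<theta>"
proof -
  have one: "1 \<in> rat_adjoin \<theta>" and eta: "\<theta> \<in> rat_adjoin \<theta>"
    and neg: "\<And>x. x \<in> rat_adjoin \<theta> \<Longrightarrow> - x \<in> rat_adjoin \<theta>"
    and inv: "\<And>x. x \<in> rat_adjoin \<theta> \<Longrightarrow> x \<noteq> 0 \<Longrightarrow> inverse x \<in> rat_adjoin \<theta>"
    and add: "\<And>x y. x \<in> rat_adjoin \<theta> \<Longrightarrow> y \<in> rat_adjoin \<theta> \<Longrightarrow> x + y \<in> rat_adjoin \<theta>"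
    and mult: "\<And>x y. x \<in> rat_adjoin \<theta> \<Longrightarrow> y \<in> rat_adjoin \<theta> \<Longrightarrow> x * y \<in> rat_adjoin \<theta>"
    unfolding rat_adjoin_def
    using generate_field.a_inv[of _ complex_ring "{\<theta>}"] generate_field.one[of complex_ring "{\<theta>}"]
      generate_field.incl[of \<theta> "{\<theta>}" complex_ring] generate_field.m_inv[of _ complex_ring "{\<theta>}"]
      generate_field.eng_add[of _ complex_ring "{\<theta>}"] generate_field.eng_mult[of _ complex_ring "{\<theta>}"]
    by auto
  have sub: "is_subring (rat_adjoin \<theta>)" unfolding is_subring_def
    using one add[OF _ neg] mult by auto
  have rat: "of_rat c \<in> rat_adjoin \<theta>" for c
  proof (cases c)
    case (Fract p q)
    have "of_int p * inverse (of_int q) \<in> rat_adjoin \<theta>"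
      using Fract by (intro mult inv is_subringD(9)[OF sub]) auto
    thus ?thesis using Fract by (simp add: of_rat_rat divide_inverse)
  qed
  show ?thesis
    by (rule is_subring_poly_closed[OF sub _ eta]) (auto simp: coeff_map_poly rat)
qed

lemma rat_adjoin_imp_rpoly:
  assumes p: "Factorial_Ring.irreducible p" "rpoly p \<theta> = 0" and x: "x \<in> rat_adjoin \<theta>"
  shows "\<exists>A. x = rpoly A \<theta>"
  using x unfolding rat_adjoin_def
proof (induction rule: generate_field.induct)
  case one
  show ?case by (rule exI[of _ 1]) simp
next
  case (incl h)
  thus ?case by (intro exI[of _ "[:0, 1:]"]) (simp add: of_rat_poly_pCons)
next
  case (a_inv h)
  then obtain B where "h = rpoly B \<theta>" by blast
  thus ?case by (intro exI[of _ "- B"]) (simp add: of_rat_poly_simps)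
next
  case (m_inv h)
  then obtain B where B: "h = rpoly B \<theta>" by blast
  have h: "h \<noteq> 0" using m_inv by simp
  hence "\<not> p dvd B" using p(2) B by (auto elim!: dvdE simp: of_rat_poly_mult)
  from irreducible_rat_bezout[OF p(1) this] obtain U V where UV: "U * B + V * p = 1" .
  have "rpoly (U * B + V * p) \<theta> = 1" by (simp add: UV)
  hence "rpoly U \<theta> * h = 1" using p(2) B by (simp add: of_rat_poly_simps)
  hence "inverse h = rpoly U \<theta>" using h by (simp add: field_simps)
  thus ?case using h by auto
next
  case (eng_add h1 h2)
  then obtain B1 B2 where "h1 = rpoly B1 \<theta>" "h2 = rpoly B2 \<theta>" by blast
  thus ?case by (intro exI[of _ "B1 + B2"]) (simp add: of_rat_poly_simps)
next
  case (eng_mult h1 h2)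
  then obtain B1 B2 where "h1 = rpoly B1 \<theta>" "h2 = rpoly B2 \<theta>" by blast
  thus ?case by (intro exI[of _ "B1 * B2"]) (simp add: of_rat_poly_simps)
qed

lemma coeff_prod_algebraic_int:
  fixes f :: "'b \<Rightarrow> 'a :: field_char_0"
  assumes "\<And>i. i \<in> I \<Longrightarrow> algebraic_int (f i)"
  shows "algebraic_int (coeff (\<Prod>i\<in>I. [:- f i, 1:]) k)"
proof -
  note sub = is_subring_algebraic_int[where 'a = 'a]
  have "\<forall>k. coeff (\<Prod>i\<in>I. [:- f i, 1:]) k \<in> {x. algebraic_int x}"
    using assms
  proof (induction I rule: infinite_finite_induct)
    case (insert i I)
    have "coeff [:- f i, 1:] k \<in> {x. algebraic_int x}" for k
      using insert by (auto simp: coeff_pCons split: nat.split)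
    with insert show ?case
      using is_subring_mult_closed_coeffs[OF sub, of "[:- f i, 1:]" "\<Prod>i\<in>I. [:- f i, 1:]"]
      by (simp del: mult_pCons_left)
  qed (auto simp: coeff_1)
  thus ?thesis by simp
qed

text \<open>A generator h of the ring of integers is written as a rational polynomial D in
  \<open>\<theta>\<close>, and its conjugate at t is the value of D at t. Identities at
  \<open>\<theta>\<close> then transfer to all of S.\<close>

theorem monogenic_imp_conjugates:
  fixes F :: "int poly"
  assumes F: "lead_coeff F = 1" "Factorial_Ring.irreducible (map_poly rat_of_int F)"
    and \<theta>: "ipoly F \<theta> = 0" and mono: "monogenic (rat_adjoin \<theta>)"
  defines "S \<equiv> {t :: complex. ipoly F t = 0}"
  obtains \<eta> G P where "monogenic_conjugates S \<eta> G P"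
proof -
  define Fq where "Fq = map_poly rat_of_int F"
  have Fq: "rpoly Fq t = ipoly F t" for t :: complex by (simp add: Fq_def of_rat_of_int_poly)
  have irr: "Factorial_Ring.irreducible Fq" using F(2) by (simp add: Fq_def)
  have S: "rpoly Fq t = 0" if "t \<in> S" for t using that by (simp add: Fq S_def)
  have \<theta>S: "\<theta> \<in> S" using \<theta> by (simp add: S_def)
  have transfer: "rpoly A t = 0" if "rpoly A \<theta> = 0" "t \<in> S" for A t
    by (rule irreducible_rat_transfer[OF irr S[OF \<theta>S] that(1) S[OF that(2)]])
  have Sint: "algebraic_int t" if "t \<in> S" for t
    using that F(1) by (auto simp: algebraic_int_altdef_ipoly S_def)
  obtain h where h: "h \<in> ring_of_integers (rat_adjoin \<theta>)" "ring_of_integers (rat_adjoin \<theta>) = int_adjoin h"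
    using mono by (auto simp: monogenic_def)
  hence hint: "algebraic_int h" and hK: "h \<in> rat_adjoin \<theta>" by (auto simp: ring_of_integers_def)
  obtain D where D: "h = rpoly D \<theta>" using rat_adjoin_imp_rpoly[OF irr S[OF \<theta>S] hK] by blast
  have rep: "\<exists>B. \<forall>t\<in>S. rpoly A t = ipoly B (rpoly D t)" if "algebraic_int (rpoly A \<theta>)" for A
  proof -
    have "rpoly A \<theta> \<in> int_adjoin h" unfolding h(2)[symmetric]
      using that rpoly_in_rat_adjoin by (simp add: ring_of_integers_def)
    then obtain B where B: "rpoly A \<theta> = ipoly B h" by (auto simp: int_adjoin_iff)
    define A' where "A' = A - pcompose (map_poly of_int B) D"
    have A': "rpoly A' t = rpoly A t - ipoly B (rpoly D t)" for t :: complex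
      by (simp add: A'_def of_rat_poly_simps poly_pcompose)
    have "rpoly A' \<theta> = 0" using A' B D by simp
    from transfer[OF this] show ?thesis using A' by auto
  qed
  \<comment> \<open>\<open>\<theta>\<close> is itself integral, hence an integer polynomial P in
    h.\<close>
  have "algebraic_int (rpoly [:0, 1:] \<theta>)" using Sint[OF \<theta>S] by (simp add: of_rat_poly_simps)
  from rep[OF this] obtain P where P_rep: "\<forall>t\<in>S. rpoly [:0, 1:] t = ipoly P (rpoly D t)" by blast
  have P: "ipoly P (rpoly D t) = t" if "t \<in> S" for t
  proof -
    have "ipoly P (rpoly D t) = rpoly [:0, 1:] t" by (rule sym, rule bspec[OF P_rep that])
    also have "\<dots> = t" by (simp add: of_rat_poly_simps)
    finally show ?thesis .
  qed
  obtain p where p: "Factorial_Ring.irreducible p" "lead_coeff p = 1" "rpoly p h = 0"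
    using exists_minimal_poly[OF hint] .
  have roots: "{z :: complex. rpoly p z = 0} = rpoly D ` S"
  proof (intro equalityI subsetI)
    fix z assume "z \<in> rpoly D ` S"
    then obtain t where t: "t \<in> S" "z = rpoly D t" by auto
    have "rpoly (pcompose p D) \<theta> = 0" using p(3) D by (simp add: of_rat_poly_simps poly_pcompose)
    from transfer[OF this t(1)] t(2) show "z \<in> {z. rpoly p z = 0}" by (simp add: of_rat_poly_simps poly_pcompose)
  next
    fix z :: complex assume "z \<in> {z. rpoly p z = 0}"
    hence z: "rpoly p z = 0" by simp
    have P\<theta>: "ipoly P h = \<theta>" using P[OF \<theta>S] D by simp
    \<comment> \<open>\<open>F(P(x))\<close> and \<open>D(P(x)) - x\<close> vanish at h, hence at
      its conjugate z; so \<open>P(z)\<close> is in S and D maps it to z.\<close>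
    define A where "A = map_poly rat_of_int (pcompose F P)"
    define A' where "A' = pcompose D (map_poly rat_of_int P) - [:0, 1:]"
    have A: "rpoly A x = ipoly F (ipoly P x)" "rpoly A' x = rpoly D (ipoly P x) - x" for x :: complex
      by (simp_all add: A_def A'_def of_rat_poly_simps of_int_poly_simps poly_pcompose)
    have "rpoly A h = 0" "rpoly A' h = 0" using A P\<theta> \<theta> D by simp_all
    from this[THEN irreducible_rat_transfer[OF p(1,3) _ z]]
    have "ipoly P z \<in> S" "rpoly D (ipoly P z) = z" using A by (simp_all add: S_def)
    thus "z \<in> rpoly D ` S" by force
  qed
  have finS: "finite S"
  proof -
    have "Fq \<noteq> 0" using irr by auto
    hence "map_poly of_rat Fq \<noteq> (0 :: complex poly)" by (simp add: of_rat_poly_eq_0_iff)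
    from poly_roots_finite[OF this] show ?thesis unfolding S_def Fq .
  qed
  have inj: "inj_on (rpoly D) S" by (rule inj_on_inverseI[where g = "ipoly P"]) (rule P)
  have pprod: "map_poly of_rat p = (\<Prod>t\<in>S. [:- rpoly D t, 1 :: complex:])"
    by (rule irreducible_rat_split(1)[OF p(1,2), THEN trans])
       (simp only: roots prod.reindex[OF inj] o_def)
  have \<eta>int: "algebraic_int (rpoly D t)" if "t \<in> S" for t
  proof -
    obtain q where q: "lead_coeff q = 1" "ipoly q h = 0" using hint by (auto simp: algebraic_int_altdef_ipoly)
    have "rpoly (pcompose (map_poly of_int q) D) \<theta> = 0" using q(2) D by (simp add: of_rat_poly_simps poly_pcompose)
    from transfer[OF this that] have "ipoly q (rpoly D t) = 0" by (simp add: of_rat_poly_simps poly_pcompose)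
    thus ?thesis using q(1) by (auto simp: algebraic_int_altdef_ipoly)
  qed
  \<comment> \<open>The coefficients of p are rational algebraic integers, so \<open>floor\<close>
    only changes their type.\<close>
  define G where "G = map_poly floor p"
  have G: "map_poly of_int G = (map_poly of_rat p :: complex poly)"
  proof (rule poly_eqI)
    fix k
    have "algebraic_int (of_rat (coeff p k) :: complex)"
      using coeff_prod_algebraic_int[of S "rpoly D" k] \<eta>int unfolding pprod[symmetric]
      by (simp add: coeff_map_poly)
    hence "(of_rat (coeff p k) :: complex) \<in> \<int>" by (rule rational_algebraic_int_is_int) simp
    then obtain m where "(of_rat (coeff p k) :: complex) = of_int m" by (auto elim: Ints_cases)
    hence "of_rat (coeff p k) = (of_rat (of_int m) :: complex)" by simp
    hence "coeff p k = of_int m" by (simp only: of_rat_eq_iff)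
    thus "coeff (map_poly of_int G) k = coeff (map_poly of_rat p :: complex poly) k"
      by (simp add: G_def coeff_map_poly)
  qed
  show ?thesis
  proof (rule that[of "rpoly D" G P], unfold_locales)
    show "finite S" by (fact finS)
    show "map_poly of_int G = (\<Prod>t\<in>S. [:- rpoly D t, 1 :: complex:])" unfolding G by (fact pprod)
    show "ipoly P (rpoly D t) = t" if "t \<in> S" for t by (rule P[OF that])
    show "\<exists>B. \<forall>t\<in>S. rpoly A t = ipoly B (rpoly D t)" if "\<And>t. t \<in> S \<Longrightarrow> algebraic_int (rpoly A t)" for A
      by (rule rep) (rule that[OF \<theta>S])
    fix B :: "int poly"
    have "algebraic_int (ipoly B \<theta>)" by (rule ipoly_algebraic_int[OF Sint[OF \<theta>S]])
    then obtain q where q: "lead_coeff q = 1" "ipoly q (ipoly B \<theta>) = 0" by (auto simp: algebraic_int_altdef_ipoly)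
    have eq: "rpoly (map_poly rat_of_int (pcompose q B)) t = ipoly q (ipoly B t)" for t :: complex
      by (simp add: of_rat_poly_simps of_int_poly_simps poly_pcompose)
    hence "rpoly (map_poly rat_of_int (pcompose q B)) \<theta> = 0" using q by simp
    from transfer[OF this] show "\<exists>q. lead_coeff q = 1 \<and> (\<forall>t\<in>S. ipoly q (ipoly B t) = 0)"
      using q(1) eq by auto
  qed
qed

theorem corollary2p6:
  fixes k r :: nat and a b :: int and F :: "int poly" and \<theta> :: complex and K :: "complex set"
  assumes "k > 0" and "r > 0"
    and "F = Polynomial.monom 1 (2 ^ k * 3 ^ r) + Polynomial.monom a 1 + [:b:]"
    and "Factorial_Ring.irreducible (map_poly rat_of_int F)"
    and "poly (map_poly complex_of_int F) \<theta> = 0"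
    and "K = rat_adjoin \<theta>"
    and "(k \<ge> 1 \<and> r = 3 \<and> [a = 0] (mod 243) \<and> [b = -1] (mod 243)) \<or>
      (k \<in> {1, 2} \<and> r \<ge> 4 \<and>
        (a mod 243, b mod 243) \<in> {81, 162} \<times> {80, 161, 242} \<union> {0} \<times> {80, 161}) \<or>
      (k \<ge> 1 \<and> r = 1 \<and> [a = 0] (mod 27) \<and> [b = -1] (mod 27)) \<or>
      (k \<ge> 1 \<and> r \<ge> 2 \<and>
        (a mod 27, b mod 27) \<in> {9, 18} \<times> {26} \<union> {0} \<times> {8, 17}) \<or>
      (k \<ge> 1 \<and> r \<ge> 3 \<and>
        (a mod 81, b mod 81) \<in> {0} \<times> {26, 53} \<union> {27, 54} \<times> {26, 53, 80}) \<or>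
      (k \<ge> 1 \<and> r = 2 \<and> [a = 0] (mod 81) \<and> [b = -1] (mod 81)) \<or>
      (k = 1 \<and> r = 3 \<and> [a = 0] (mod 243) \<and> [b = 1] (mod 243)) \<or>
      (k = 1 \<and> r \<ge> 4 \<and>
        (a mod 243, b mod 243) \<in> {81, 162} \<times> {1, 82, 163} \<union> {0} \<times> {82, 163}) \<or>
      (k = 2 \<and> r = 1 \<and> [a = 0] (mod 27) \<and> [b = 1] (mod 27)) \<or>
      (k = 2 \<and> r \<ge> 2 \<and>
        (a mod 27, b mod 27) \<in> {9, 18} \<times> {1, 10, 19} \<union> {0} \<times> {10, 19}) \<or>
      (k \<ge> 3 \<and> r \<ge> 2 \<and>
        (a mod 27, b mod 27) \<in> {9, 18} \<times> {8, 17})"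
  shows "\<not> monogenic K"
proof
  assume mono: "monogenic K"
  define S where "S = {t :: complex. ipoly F t = 0}"
  have n: "(2 :: nat) ^ k * 3 ^ r > 1"
  proof -
    have "(1::nat) < 2 ^ k" using assms(1) by (intro one_less_power) auto
    also have "\<dots> \<le> 2 ^ k * 3 ^ r" by simp
    finally show ?thesis .
  qed
  have "degree (monom a 1 + [:b:]) \<le> 1"
    by (intro degree_add_le) (auto intro: degree_monom_le)
  hence deg: "degree (monom a 1 + [:b:]) < degree (monom (1 :: int) (2 ^ k * 3 ^ r))"
    using n by (simp add: degree_monom_eq)
  have F: "F = monom 1 (2 ^ k * 3 ^ r) + (monom a 1 + [:b:])" using assms(3) by (simp add: add.assoc)
  have "degree F = 2 ^ k * 3 ^ r" unfolding F using deg by (simp add: degree_add_eq_left degree_monom_eq)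
  moreover have "coeff (monom a 1 + [:b:]) (2 ^ k * 3 ^ r) = 0"
    by (rule coeff_eq_0) (use deg in \<open>simp add: degree_monom_eq\<close>)
  hence "coeff F (2 ^ k * 3 ^ r) = 1" unfolding F coeff_add[of "monom 1 _"] by (simp only: coeff_monom) simp
  ultimately have monic: "lead_coeff F = 1" by simp
  obtain \<eta> G P where "monogenic_conjugates S \<eta> G P"
    using monogenic_imp_conjugates[OF monic assms(4,5)] mono assms(6) unfolding S_def by blast
  moreover have "monom 1 (2 ^ k * 3 ^ r) + monom (of_int a) 1 + [:of_int b:] = (\<Prod>t\<in>S. [:- t, 1 :: complex:])"
  proof -
    have "lead_coeff (map_poly rat_of_int F) = 1" using monic by (simp add: degree_map_poly coeff_map_poly)
    from irreducible_rat_split(1)[OF assms(4) this]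
    have "map_poly of_int F = (\<Prod>t\<in>S. [:- t, 1 :: complex:])" by (simp add: of_rat_of_int_poly S_def)
    thus ?thesis by (simp add: assms(3) of_int_poly_simps)
  qed
  ultimately have "monogenic_trinomial S \<eta> G P k r a b"
    using assms(1,2) by (simp add: monogenic_trinomial_def monogenic_trinomial_axioms_def)
  from monogenic_trinomial.not_monogenic_trinomial[OF this assms(7)] show False .
qed

end
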